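(* In the two-size first-fit model with parameters $p_1,p_2>0$, $p_1+p_2=1$, and scaling parameter $r$, as $r\to\infty$, $$\frac1r\Big(F_1(p_1 r;\infty),\,F_2(p_1 r+2p_2 r;\infty)\Big)\xrightarrow{P}(p_1,p_2).$$
   Context: Two-size first-fit model with scaling parameter $r>0$. Fix $p_1,p_2>0$ with $p_1+p_2=1$ and put $\alpha_1=1$, $\alpha_2=2$. Items of type $i\in\{1,2\}$ ("$i$-items") have size $\alpha_i$ and arrive as independent Poisson processes of rates $p_i r$. Items are stored on the half-axis $[0,\infty)$. First-fit discipline: an arriving $i$-item is immediately placed into the left-most interval $[x,x+\alpha_i)$, $x\ge 0$, that does not intersect the intervals occupied by items currently present. Each item departs (freeing its interval) after an independent exponentially distributed service time of mean $1$. All items occupy intervals with integer endpoints, so the system is an irreducible positive recurrent continuous-time Markov chain on a countable state space, with a unique stationary distribution for each $r$. For a state, $F_i(x)$ is the number of $i$-items located completely within $[0,x)$. $F_i(x;\infty)$ denotes the random variable $F_i(x)$ when the state has the stationary distribution (of the system with parameter $r$). $\xrightarrow{P}$ denotes convergence in probability. *)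

theory Defs
  imports "HOL-Probability.Probability"
begin

section \<open>Continuous-time Markov chains on a discrete state space\<close>

text \<open>
  \<open>P t x\<close> is the law at time \<open>t\<close> of the chain started in \<open>x\<close>, and \<open>q x y\<close> is the rate of jumping
  from \<open>x\<close> to \<open>y \<noteq> x\<close>; the values \<open>q x x\<close> are not used. The derivative at time 0 on the diagonal
  is minus the total jump rate, i.e. the Q-matrix is conservative. As every \<open>P t x\<close> is a probability
  distribution, no mass is lost to explosion.
\<close>

definition markov_transition_function ::
  "'s set \<Rightarrow> ('s \<Rightarrow> 's \<Rightarrow> real) \<Rightarrow> (real \<Rightarrow> 's \<Rightarrow> 's pmf) \<Rightarrow> bool" where
  "markov_transition_function S q P \<longleftrightarrow>
     (\<forall>t\<ge>0. \<forall>x\<in>S. set_pmf (P t x) \<subseteq> S) \<and>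
     (\<forall>x\<in>S. P 0 x = return_pmf x) \<and>
     (\<forall>s\<ge>0. \<forall>t\<ge>0. \<forall>x\<in>S. P (s + t) x = bind_pmf (P s x) (P t)) \<and>
     (\<forall>x\<in>S. \<forall>y\<in>S. x \<noteq> y \<longrightarrow> ((\<lambda>h. pmf (P h x) y / h) \<longlongrightarrow> q x y) (at_right 0)) \<and>
     (\<forall>x\<in>S. ((\<lambda>h. (pmf (P h x) x - 1) / h) \<longlongrightarrow> - (\<Sum>\<^sub>\<infinity>y\<in>S - {x}. q x y)) (at_right 0))"

definition stationary_distribution ::
  "'s set \<Rightarrow> (real \<Rightarrow> 's \<Rightarrow> 's pmf) \<Rightarrow> 's pmf \<Rightarrow> bool" where
  "stationary_distribution S P \<mu> \<longleftrightarrow>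
     set_pmf \<mu> \<subseteq> S \<and> (\<forall>t\<ge>0. bind_pmf \<mu> (P t) = \<mu>)"

text \<open>The probability spaces \<open>M r\<close> may vary with the index, since the limit is a constant.\<close>

definition converges_in_probability ::
  "('i \<Rightarrow> 'a measure) \<Rightarrow> ('i \<Rightarrow> 'a \<Rightarrow> 'b::metric_space) \<Rightarrow> 'b \<Rightarrow> 'i filter \<Rightarrow> bool" where
  "converges_in_probability M X c F \<longleftrightarrow>
     (\<forall>\<epsilon>>0. ((\<lambda>r. measure (M r) {\<omega> \<in> space (M r). dist (X r \<omega>) c > \<epsilon>}) \<longlongrightarrow> 0) F)"


section \<open>The two-size first-fit model\<close>

definition item_size :: "nat \<Rightarrow> real" where
  "item_size i = (if i = 1 then 1 else 2)"

text \<open>A configuration is the set of the items present; \<open>(i, y)\<close> is an item of type \<open>i\<close> that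
  occupies the interval with left endpoint \<open>y\<close>.\<close>

type_synonym item = "nat \<times> real"

definition occupied :: "item \<Rightarrow> real set" where
  "occupied a = {snd a ..< snd a + item_size (fst a)}"

definition configurations :: "item set set" where
  "configurations =
     {A. finite A \<and> A \<subseteq> {1, 2} \<times> \<nat> \<and> pairwise (\<lambda>a b. occupied a \<inter> occupied b = {}) A}"

definition first_fit_position :: "nat \<Rightarrow> item set \<Rightarrow> real" where
  "first_fit_position i A =
     (LEAST x. 0 \<le> x \<and> (\<forall>a\<in>A. {x ..< x + item_size i} \<inter> occupied a = {}))"

definition arrival :: "nat \<Rightarrow> item set \<Rightarrow> item set" where
  "arrival i A = insert (i, first_fit_position i A) A"

definition first_fit_rate :: "(nat \<Rightarrow> real) \<Rightarrow> real \<Rightarrow> item set \<Rightarrow> item set \<Rightarrow> real" where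
  "first_fit_rate p r A B =
     (\<Sum>i\<in>{1, 2}. if B = arrival i A then p i * r else 0) +
     (\<Sum>a\<in>A. if B = A - {a} then 1 else 0)"

definition items_within :: "nat \<Rightarrow> real \<Rightarrow> item set \<Rightarrow> nat" where
  "items_within i x A = card {a \<in> A. fst a = i \<and> occupied a \<subseteq> {0 ..< x}}"


text \<open>\<open>LEAST\<close> on the reals is only meaningful if the minimum is attained; it is, at an integer
  point, so the configurations are closed under arrivals.\<close>

lemma first_fit_position:
  assumes A: "A \<in> configurations" and i: "i \<in> {1, 2}"
  defines "fits \<equiv> \<lambda>x. 0 \<le> x \<and> (\<forall>a\<in>A. {x ..< x + item_size i} \<inter> occupied a = {})"
  shows "first_fit_position i A \<in> \<nat>" "fits (first_fit_position i A)"
    "\<And>x. fits x \<Longrightarrow> first_fit_position i A \<le> x"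
proof -
  have fin: "finite A" and nat: "\<And>j y. (j, y) \<in> A \<Longrightarrow> y \<in> \<nat>"
    using A by (auto simp: configurations_def)
  have disj: "{x ..< x + item_size i} \<inter> occupied (j, y) = {} \<longleftrightarrow>
      x + item_size i \<le> y \<or> y + item_size j \<le> x" for x y j
  proof (intro iffI)
    assume e: "{x ..< x + item_size i} \<inter> occupied (j, y) = {}"
    then have "max x y \<notin> {x ..< x + item_size i} \<inter> occupied (j, y)" by simp
    then show "x + item_size i \<le> y \<or> y + item_size j \<le> x"
      by (auto simp: occupied_def item_size_def max_def split: if_splits)
  qed (auto simp: occupied_def)
  have floor: "fits (real (nat \<lfloor>x\<rfloor>))" if x: "fits x" for x
  proof -
    have x0: "0 \<le> x" using x by (simp add: fits_def)
    have "{real (nat \<lfloor>x\<rfloor>) ..< real (nat \<lfloor>x\<rfloor>) + item_size i} \<inter> occupied (j, y) = {}"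
      if a: "(j, y) \<in> A" for j y
    proof -
      obtain n where n: "y = real n" using nat[OF a] by (auto simp: Nats_def)
      have "x + item_size i \<le> y \<or> y + item_size j \<le> x"
        using x a disj unfolding fits_def by blast
      show ?thesis
      proof -
        obtain d where d: "item_size j = real d"
          by (metis item_size_def of_nat_1 of_nat_numeral)
        have x1: "real (nat \<lfloor>x\<rfloor>) \<le> x" "x < real (nat \<lfloor>x\<rfloor>) + 1"
          using x0 by (auto; linarith)+
        have "real n + real d \<le> real (nat \<lfloor>x\<rfloor>)" if "y + item_size j \<le> x"
        proof -
          have "real (n + d) < real (nat \<lfloor>x\<rfloor> + 1)" using that x1(2) n d by linarith
          then show ?thesis unfolding of_nat_less_iff of_nat_add[symmetric] of_nat_le_iff by simp
        qed
        then show ?thesis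
          using \<open>x + item_size i \<le> y \<or> y + item_size j \<le> x\<close> x1
          unfolding disj n d by linarith
      qed
    qed
    then show ?thesis by (auto simp: fits_def)
  qed
  define b where "b = (\<Sum>a\<in>A. snd a + 2)"
  have pos: "0 \<le> snd a" if "a \<in> A" for a
    using nat[of "fst a" "snd a"] that by (auto simp: Nats_def)
  have "fits b"
  proof -
    have "b \<ge> 0" unfolding b_def using pos by (intro sum_nonneg) force
    moreover have "y + item_size j \<le> b" if "(j, y) \<in> A" for j y
    proof -
      have "snd (j, y) + 2 \<le> b" unfolding b_def
        using that fin pos by (intro member_le_sum) force+
      then show ?thesis by (simp add: item_size_def)
    qed
    ultimately show ?thesis unfolding fits_def by (metis disj surj_pair)
  qed
  define m where "m = (LEAST n. fits (real n))"
  have m: "fits (real m)" unfolding m_def by (rule LeastI) (rule floor[OF \<open>fits b\<close>])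
  have le: "real m \<le> x" if "fits x" for x
  proof -
    have "m \<le> nat \<lfloor>x\<rfloor>" unfolding m_def by (rule Least_le) (rule floor[OF that])
    then have "real m \<le> real (nat \<lfloor>x\<rfloor>)" by simp
    also have "\<dots> \<le> x" using that by (auto simp: fits_def)
    finally show ?thesis .
  qed
  have "first_fit_position i A = real m"
    unfolding first_fit_position_def fits_def[symmetric]
    using m le by (auto simp: fits_def intro!: Least_equality)
  then show "first_fit_position i A \<in> \<nat>" "fits (first_fit_position i A)"
    "\<And>x. fits x \<Longrightarrow> first_fit_position i A \<le> x"
    using m le by auto
qed

lemma arrival_in_configurations:
  assumes "A \<in> configurations" "i \<in> {1, 2}"
  shows "arrival i A \<in> configurations"
  using assms first_fit_position(1,2)[OF assms]
  by (auto simp: configurations_def arrival_def pairwise_insert occupied_def)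

end

theory Submission
  imports Defs
begin

text \<open>
  Stationarity means that every bounded function of the configuration has mean drift 0; the proof
  evaluates this identity for a few functions of the occupied cells in an initial segment.

  For \<open>K \<le> (p 1 - \<epsilon>) * r\<close> the square of the number \<open>V\<close> of vacant cells below \<open>K\<close> shows that \<open>V\<close> stays
  bounded in mean. Every departing 2-item opens a gap of length 2, and if no other cell is vacant, a
  1-item destroys this gap with positive probability. Hence only boundedly many 2-items lie below
  \<open>K\<close>, so 1-items fill \<open>[0, p 1 * r)\<close> up to \<open>o(r)\<close> cells and only \<open>o(r)\<close> of them lie further right.

  Between \<open>J \<approx> p 1 * r\<close> and \<open>K \<approx> p 1 * r + 2 * p 2 * r\<close> the configuration thus consists of 2-items and
  gaps, up to \<open>o(r)\<close> disturbances. Mark the items that are preceded by a gap of odd length. A 2-item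
  that arrives goes to the left end of a gap and preserves the marks; if a marked 2-item departs, its
  mark moves to the next item on the right, or cancels with the mark there. As a mark is created only
  at rate \<open>o(r)\<close>, few marks cancel, and comparing the gains and losses of pairs of marks at distance at
  most \<open>d\<close> shows that there are only \<open>o(r)\<close> such pairs, for each \<open>d\<close>; so the number of marks is
  \<open>o(r)\<close>. The vacant cells that are not accounted for by marks can hold 2-items, and a quadratic drift
  argument bounds their number by \<open>o(r)\<close>. Hence the segment is full up to \<open>o(r)\<close> cells.
\<close>

section \<open>Generators and stationary distributions\<close>

text \<open>The hypotheses give only pointwise derivatives of transition probabilities, and the jump
  rates grow with the number of items. Mean drift 0 is thus available only once this number is known
  to have finite mean, which must itself come from stationarity; a test function supported on
  configurations of at most \<open>n\<close> items breaks the circle.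

  Between \<open>J\<close> and \<open>K\<close> a quadratic drift of the vacant cells alone fails:
  gaps of length one can accumulate, and no 2-item fills them. Marks measure this parity waste. If
  the next item is adjacent, a departing marked 2-item shifts its mark by exactly two cells. Summed
  over all distances up to \<open>d\<close>, the effects of such shifts on pairs cancel except at
  the edge: pairs enter the range from distances \<open>d + 1\<close>, \<open>d + 2\<close> and
  leave it from \<open>d - 1\<close>, \<open>d\<close>. Equilibrium bounds the former by the latter
  up to o(r), so an induction on the distance works; it starts at distance 1, which is impossible,
  and 2, which requires a 1-item. Marks without another mark within \<open>d\<close> cells to the
  right number at most \<open>K / d + 1\<close>, so \<open>d\<close> may be fixed before
  \<open>r\<close> grows.\<close>

lemma expectation_bind_pmf:
  fixes f :: "'b \<Rightarrow> real"
  assumes "\<And>x. \<bar>f x\<bar> \<le> c"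
  shows "measure_pmf.expectation (bind_pmf M N) f
    = measure_pmf.expectation M (\<lambda>x. measure_pmf.expectation (N x) f)"
  unfolding measure_pmf_bind
  by (rule integral_bind[where B=c and B'=1 and K="count_space UNIV"])
    (use assms in \<open>auto simp: measure_pmf.finite_measure_axioms measure_subprob\<close>)

lemma integrable_pmf_bounded:
  fixes f :: "'b \<Rightarrow> real"
  assumes "\<And>x. x \<in> set_pmf M \<Longrightarrow> \<bar>f x\<bar> \<le> c"
  shows "integrable (measure_pmf M) f"
  by (rule measure_pmf.integrable_const_bound[where B=c]) (use assms in \<open>auto simp: AE_measure_pmf_iff\<close>)

lemma abs_expectation_pmf_le:
  fixes f :: "'b \<Rightarrow> real"
  assumes "\<And>x. \<bar>f x\<bar> \<le> c"
  shows "\<bar>measure_pmf.expectation M f\<bar> \<le> c"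
proof -
  have "integrable (measure_pmf M) f" by (rule integrable_pmf_bounded) (rule assms)
  moreover have "- c \<le> f x" "f x \<le> c" for x using assms[of x] by auto
  ultimately have "measure_pmf.expectation M f \<le> c" "- c \<le> measure_pmf.expectation M f"
    by (auto intro: measure_pmf.integral_le_const measure_pmf.integral_ge_const)
  then show ?thesis by simp
qed

context
  fixes S :: "'s set" and q :: "'s \<Rightarrow> 's \<Rightarrow> real" and P :: "real \<Rightarrow> 's \<Rightarrow> 's pmf"
  assumes mtf: "markov_transition_function S q P"
begin

text \<open>Chapman-Kolmogorov, keeping only the paths that are back in \<open>x\<close> after every
  step of length \<open>t\<close>.\<close>

lemma return_probability_power:
  assumes x: "x \<in> S" and t: "0 \<le> t"
  shows "pmf (P t x) x ^ n \<le> pmf (P (real n * t) x) x"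
proof (induction n)
  case 0
  then show ?case using mtf x unfolding markov_transition_function_def by simp
next
  case (Suc n)
  have "P (t + real n * t) x = bind_pmf (P t x) (P (real n * t))"
    using mtf x t unfolding markov_transition_function_def by simp
  then have "pmf (P (real (Suc n) * t) x) x
      = measure_pmf.expectation (P t x) (\<lambda>y. pmf (P (real n * t) y) x)"
    by (simp add: pmf_bind algebra_simps)
  also have "\<dots> \<ge> measure_pmf.expectation (P t x) (\<lambda>y. pmf (P (real n * t) x) x * indicator {x} y)"
    by (intro integral_mono integrable_pmf_bounded[where c=1])
      (auto simp: pmf_le_1 split: split_indicator)
  also have "measure_pmf.expectation (P t x) (\<lambda>y. pmf (P (real n * t) x) x * indicator {x} y)
      = pmf (P (real n * t) x) x * pmf (P t x) x"
    by (simp add: measure_pmf_single)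
  finally show ?case
    using mult_right_mono[OF Suc.IH, of "pmf (P t x) x"] by (simp add: mult.commute)
qed

text \<open>By Bernoulli's inequality the derivative of the return probability at 0 controls it at all
  times.\<close>

lemma leave_probability_le:
  assumes x: "x \<in> S" and t: "0 < t"
  shows "1 - pmf (P t x) x \<le> t * (\<Sum>\<^sub>\<infinity>y\<in>S - {x}. q x y)"
proof (rule field_le_epsilon)
  fix e :: real assume e: "0 < e"
  define R where "R = (\<Sum>\<^sub>\<infinity>y\<in>S - {x}. q x y)"
  have "((\<lambda>h. (pmf (P h x) x - 1) / h) \<longlongrightarrow> - R) (at_right 0)"
    using mtf x unfolding markov_transition_function_def R_def by simp
  then have "\<forall>\<^sub>F h in at_right 0. dist ((pmf (P h x) x - 1) / h) (- R) < e / t"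
    by (rule tendstoD) (use e t in simp)
  then obtain d where d: "d > 0"
    and D: "\<And>h. 0 < h \<Longrightarrow> h < d \<Longrightarrow> dist ((pmf (P h x) x - 1) / h) (- R) < e / t"
    unfolding eventually_at_right_field by auto
  obtain n :: nat where n: "t / d < real n" using reals_Archimedean2 by blast
  with t d have n0: "0 < real n" by (smt (verit) divide_pos_pos)
  define h where "h = t / real n"
  have h: "0 < h" "h < d" "real n * h = t"
    using t d n n0 by (auto simp: h_def field_simps)
  have "- R - e / t < (pmf (P h x) x - 1) / h"
    using D[OF h(1,2)] by (auto simp: dist_real_def)
  then have l: "- h * (R + e / t) < pmf (P h x) x - 1" using h(1) by (simp add: field_simps)
  have "1 + real n * (pmf (P h x) x - 1) \<le> (1 + (pmf (P h x) x - 1)) ^ n"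
    by (rule Bernoulli_inequality) (use pmf_nonneg[of "P h x" x] in linarith)
  also have "\<dots> \<le> pmf (P t x) x"
    using return_probability_power[OF x, of h n] h by simp
  finally have "1 - pmf (P t x) x \<le> real n * (1 - pmf (P h x) x)" by (simp add: algebra_simps)
  also have "\<dots> \<le> real n * (h * (R + e / t))" using l n0 by (intro mult_left_mono) auto
  also have "\<dots> = (real n * h) * (R + e / t)" by simp
  also have "\<dots> = t * R + e" using t unfolding h(3) by (simp add: distrib_left)
  finally show "1 - pmf (P t x) x \<le> t * R + e" .
qed

lemma leave_rate_finite:
  assumes "finite Y" "Y \<subseteq> S - {x}" "\<And>y. y \<in> S - {x} - Y \<Longrightarrow> q x y = 0"
  shows "(\<Sum>\<^sub>\<infinity>y\<in>S - {x}. q x y) = (\<Sum>y\<in>Y. q x y)"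
proof -
  have "(\<Sum>\<^sub>\<infinity>y\<in>S - {x}. q x y) = (\<Sum>\<^sub>\<infinity>y\<in>Y. q x y)"
    by (rule infsum_cong_neutral) (use assms in auto)
  then show ?thesis using assms(1) by simp
qed

text \<open>Conservativity is the point: the diagonal derivative is minus the total rate into
  \<open>Y\<close>, so the probability \<open>e h\<close> of being outside \<open>insert x Y\<close>
  at time \<open>h\<close> is o(h). A bounded \<open>f\<close> turns this into an error of at most
  \<open>2 * c * e h\<close>.\<close>

lemma generator_tendsto:
  fixes f :: "'s \<Rightarrow> real"
  assumes x: "x \<in> S" and Y: "finite Y" "Y \<subseteq> S - {x}" "\<And>y. y \<in> S - {x} - Y \<Longrightarrow> q x y = 0"
    and f: "\<And>x. \<bar>f x\<bar> \<le> c"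
  shows "((\<lambda>h. (measure_pmf.expectation (P h x) f - f x) / h)
    \<longlongrightarrow> (\<Sum>y\<in>Y. q x y * (f y - f x))) (at_right 0)"
proof -
  define e where "e h = 1 - pmf (P h x) x - (\<Sum>y\<in>Y. pmf (P h x) y)" for h
  define s where "s h = (\<Sum>y\<in>Y. pmf (P h x) y * (f y - f x))" for h
  have bound: "\<bar>measure_pmf.expectation (P h x) f - f x - s h\<bar> \<le> 2 * c * e h" for h
  proof -
    have fin: "finite (insert x Y)" using Y by simp
    have "e h = 1 - measure (P h x) (insert x Y)"
      unfolding e_def measure_measure_pmf_finite[OF fin]
      using Y by (subst sum.insert) auto
    also have "\<dots> = measure (P h x) (- insert x Y)"
      using measure_pmf.prob_compl[of "insert x Y" "P h x"] by (simp add: Compl_eq_Diff_UNIV)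
    finally have e: "e h = measure_pmf.expectation (P h x) (indicator (- insert x Y))" by simp
    have c: "\<bar>f y - f x\<bar> \<le> 2 * c" for y using f[of y] f[of x] by linarith
    have c0: "0 \<le> c" using f[of x] by linarith
    have int: "integrable (P h x) f" "integrable (P h x) (\<lambda>y. (f y - f x) * indicator Y y)"
      "integrable (P h x) (\<lambda>y. (f y - f x) * indicator (- insert x Y) y)"
      by (rule integrable_pmf_bounded[where c=c], rule f)
        (rule integrable_pmf_bounded[where c="2*c"], use c c0 in \<open>auto split: split_indicator\<close>)+
    have "measure_pmf.expectation (P h x) f - f x = measure_pmf.expectation (P h x) (\<lambda>y. f y - f x)"
      using int by simp
    also have "\<dots> = measure_pmf.expectation (P h x)
        (\<lambda>y. (f y - f x) * indicator Y y + (f y - f x) * indicator (- insert x Y) y)"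
      using Y by (intro Bochner_Integration.integral_cong) (auto split: split_indicator)
    also have "\<dots> = measure_pmf.expectation (P h x) (\<lambda>y. (f y - f x) * indicator Y y)
       + measure_pmf.expectation (P h x) (\<lambda>y. (f y - f x) * indicator (- insert x Y) y)"
      using int by simp
    also have "measure_pmf.expectation (P h x) (\<lambda>y. (f y - f x) * indicator Y y) = s h"
      unfolding s_def
      by (subst integral_measure_pmf_real[where A=Y]) (use Y in \<open>auto split: split_indicator_asm intro!: sum.cong\<close>)
    finally have "measure_pmf.expectation (P h x) f - f x - s h
      = measure_pmf.expectation (P h x) (\<lambda>y. (f y - f x) * indicator (- insert x Y) y)"
      by linarith
    then have "\<bar>measure_pmf.expectation (P h x) f - f x - s h\<bar>
      = \<bar>measure_pmf.expectation (P h x) (\<lambda>y. (f y - f x) * indicator (- insert x Y) y)\<bar>"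
      by (rule arg_cong)
    also have "\<dots> \<le> measure_pmf.expectation (P h x) (\<lambda>y. \<bar>(f y - f x) * indicator (- insert x Y) y\<bar>)"
      by (rule integral_abs_bound)
    also have "\<dots> \<le> measure_pmf.expectation (P h x) (\<lambda>y. 2 * c * indicator (- insert x Y) y)"
      by (intro integral_mono integrable_abs int integrable_pmf_bounded[where c="2*c"])
        (use c c0 in \<open>auto split: split_indicator\<close>)
    also have "\<dots> = 2 * c * e h" by (simp add: e)
    finally show ?thesis .
  qed
  have y: "((\<lambda>h. pmf (P h x) y / h) \<longlongrightarrow> q x y) (at_right 0)" if "y \<in> Y" for y
  proof -
    have "y \<in> S" "x \<noteq> y" using Y(2) that by auto
    with mtf x show ?thesis unfolding markov_transition_function_def by blast
  qed
  have "((\<lambda>h. \<Sum>y\<in>Y. pmf (P h x) y / h * (f y - f x))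
      \<longlongrightarrow> (\<Sum>y\<in>Y. q x y * (f y - f x))) (at_right 0)"
    by (intro tendsto_sum tendsto_mult y tendsto_const)
  moreover have "(\<Sum>y\<in>Y. pmf (P h x) y / h * (f y - f x)) = s h / h" for h
    unfolding s_def sum_divide_distrib by simp
  ultimately have s: "((\<lambda>h. s h / h) \<longlongrightarrow> (\<Sum>y\<in>Y. q x y * (f y - f x))) (at_right 0)"
    by simp
  have "((\<lambda>h. (pmf (P h x) x - 1) / h) \<longlongrightarrow> - (\<Sum>\<^sub>\<infinity>y\<in>S - {x}. q x y)) (at_right 0)"
    using mtf x unfolding markov_transition_function_def by simp
  moreover have "(\<Sum>\<^sub>\<infinity>y\<in>S - {x}. q x y) = (\<Sum>y\<in>Y. q x y)"
    by (rule leave_rate_finite) (fact Y)+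
  ultimately have "((\<lambda>h. (pmf (P h x) x - 1) / h) \<longlongrightarrow> - (\<Sum>y\<in>Y. q x y)) (at_right 0)"
    by simp
  then have "((\<lambda>h. - ((pmf (P h x) x - 1) / h) - (\<Sum>y\<in>Y. pmf (P h x) y / h)) \<longlongrightarrow>
      - (- (\<Sum>y\<in>Y. q x y)) - (\<Sum>y\<in>Y. q x y)) (at_right 0)"
    by (intro tendsto_intros y)
  moreover have "- ((pmf (P h x) x - 1) / h) - (\<Sum>y\<in>Y. pmf (P h x) y / h) = e h / h" for h
    unfolding e_def sum_divide_distrib[symmetric] by (simp add: diff_divide_distrib)
  ultimately have "((\<lambda>h. e h / h) \<longlongrightarrow> 0) (at_right 0)" by simp
  then have "((\<lambda>h. 2 * c * (e h / h)) \<longlongrightarrow> 2 * c * 0) (at_right 0)" by (intro tendsto_intros)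
  then have lim: "((\<lambda>h. 2 * c * (e h / h)) \<longlongrightarrow> 0) (at_right 0)" by simp
  have *: "norm ((measure_pmf.expectation (P h x) f - f x - s h) / h) \<le> 2 * c * (e h / h)"
    if "0 < h" for h
  proof -
    have "norm ((measure_pmf.expectation (P h x) f - f x - s h) / h)
        = \<bar>measure_pmf.expectation (P h x) f - f x - s h\<bar> / h"
      using that by (simp only: real_norm_def abs_divide abs_of_pos)
    also have "\<dots> \<le> 2 * c * e h / h"
      by (rule divide_right_mono[OF bound]) (use that in simp)
    finally show ?thesis by (simp only: times_divide_eq_right)
  qed
  have "((\<lambda>h. (measure_pmf.expectation (P h x) f - f x - s h) / h) \<longlongrightarrow> 0) (at_right 0)"
    by (rule Lim_null_comparison[OF _ lim])
      (use * in \<open>auto simp only: eventually_at_right_field intro!: exI[of _ 1] zero_less_one\<close>)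
  from tendsto_add[OF this s] show ?thesis
    by (simp only: add_divide_distrib[symmetric] diff_add_cancel add_0)
qed

text \<open>The bound is uniform in \<open>h\<close>, and so provides the dominating function when
  \<open>h\<close> tends to 0 under the stationary law.\<close>

lemma expectation_difference_le:
  fixes f :: "'s \<Rightarrow> real"
  assumes x: "x \<in> S" and h: "0 < h" and f: "\<And>x. \<bar>f x\<bar> \<le> c"
  shows "\<bar>(measure_pmf.expectation (P h x) f - f x) / h\<bar> \<le> 2 * c * (\<Sum>\<^sub>\<infinity>y\<in>S - {x}. q x y)"
proof -
  have c: "\<bar>f y - f x\<bar> \<le> 2 * c" for y using f[of y] f[of x] by linarith
  have c0: "0 \<le> c" using f[of x] by linarith
  have int: "integrable (P h x) f" by (rule integrable_pmf_bounded, rule f)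
  then have "\<bar>measure_pmf.expectation (P h x) f - f x\<bar>
      = \<bar>measure_pmf.expectation (P h x) (\<lambda>y. f y - f x)\<bar>" by simp
  also have "\<dots> \<le> measure_pmf.expectation (P h x) (\<lambda>y. \<bar>f y - f x\<bar>)" by (rule integral_abs_bound)
  also have "\<dots> \<le> measure_pmf.expectation (P h x) (\<lambda>y. 2 * c * indicator (- {x}) y)"
    using c c0 int by (intro integral_mono integrable_abs integrable_pmf_bounded[where c="2*c"])
        (auto split: split_indicator)
  also have "\<dots> = 2 * c * (1 - pmf (P h x) x)"
    using measure_pmf.prob_compl[of "{x}" "P h x"] by (simp add: Compl_eq_Diff_UNIV measure_pmf_single)
  also have "\<dots> \<le> 2 * c * (h * (\<Sum>\<^sub>\<infinity>y\<in>S - {x}. q x y))"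
    by (intro mult_left_mono leave_probability_le[OF x h]) (use c0 in simp)
  finally have "\<bar>measure_pmf.expectation (P h x) f - f x\<bar> / h
      \<le> 2 * c * (h * (\<Sum>\<^sub>\<infinity>y\<in>S - {x}. q x y)) / h"
    using h by (intro divide_right_mono) auto
  with h show ?thesis by (simp only: abs_divide abs_of_pos) simp
qed

section \<open>Mean drift under the stationary law\<close>

definition difference_quotient :: "('s \<Rightarrow> real) \<Rightarrow> nat \<Rightarrow> 's \<Rightarrow> real" where
  "difference_quotient f n x = (measure_pmf.expectation (P (inverse (real (Suc n))) x) f - f x)
     / inverse (real (Suc n))"

context
  fixes \<mu> :: "'s pmf" and Y :: "'s \<Rightarrow> 's set" and w :: "'s \<Rightarrow> real" and f :: "'s \<Rightarrow> real" and c :: real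
  assumes stat: "stationary_distribution S P \<mu>"
    and Y: "\<And>x. x \<in> S \<Longrightarrow> finite (Y x)" "\<And>x. x \<in> S \<Longrightarrow> Y x \<subseteq> S - {x}"
      "\<And>x y. x \<in> S \<Longrightarrow> y \<in> S - {x} - Y x \<Longrightarrow> q x y = 0"
    and f: "\<And>x. \<bar>f x\<bar> \<le> c"
    and int: "integrable (measure_pmf \<mu>) (\<lambda>x. w x * (\<Sum>y\<in>Y x. q x y))"
    and w: "\<And>x. 0 \<le> w x"
begin

text \<open>Dominated convergence along the times \<open>1 / (n + 1)\<close>. The weight
  \<open>w\<close> is later either 1 or the indicator of a set on which the exit rates are bounded;
  the second choice allows the passage to the limit before the exit rate is known to be
  integrable.\<close>

lemma stationary_difference_quotient:
  "(\<lambda>n. measure_pmf.expectation \<mu> (\<lambda>x. w x * difference_quotient f n x))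
    \<longlonglongrightarrow> measure_pmf.expectation \<mu> (\<lambda>x. w x * (\<Sum>y\<in>Y x. q x y * (f y - f x)))"
  "integrable (measure_pmf \<mu>) (\<lambda>x. w x * (\<Sum>y\<in>Y x. q x y * (f y - f x)))"
  "integrable (measure_pmf \<mu>) (\<lambda>x. w x * difference_quotient f n x)"
proof -
  have S: "x \<in> S" if "x \<in> set_pmf \<mu>" for x
    using stat that unfolding stationary_distribution_def by auto
  have lim: "AE x in \<mu>. (\<lambda>n. w x * difference_quotient f n x)
      \<longlonglongrightarrow> w x * (\<Sum>y\<in>Y x. q x y * (f y - f x))"
  proof (intro AE_pmfI tendsto_mult tendsto_const)
    fix x assume "x \<in> set_pmf \<mu>"
    then have x: "x \<in> S" by (rule S)
    have *: "filterlim (\<lambda>n. inverse (real (Suc n))) (at_right 0) sequentially"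
      unfolding filterlim_at using LIMSEQ_inverse_real_of_nat by auto
    show "(\<lambda>n. difference_quotient f n x) \<longlonglongrightarrow> (\<Sum>y\<in>Y x. q x y * (f y - f x))"
      unfolding difference_quotient_def
      by (rule filterlim_compose[OF generator_tendsto[OF x Y(1-3)[OF x] f] *])
  qed
  have bd: "AE x in \<mu>. norm (w x * difference_quotient f n x) \<le> 2 * c * (w x * (\<Sum>y\<in>Y x. q x y))" for n
  proof (intro AE_pmfI)
    fix x assume "x \<in> set_pmf \<mu>"
    then have x: "x \<in> S" by (rule S)
    have "\<bar>difference_quotient f n x\<bar> \<le> 2 * c * (\<Sum>y\<in>Y x. q x y)"
      using expectation_difference_le[OF x _ f, of "inverse (real (Suc n))"]
        leave_rate_finite[OF Y(1-3)[OF x]] by (simp add: difference_quotient_def)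
    from mult_left_mono[OF this w[of x]] w[of x]
    show "norm (w x * difference_quotient f n x) \<le> 2 * c * (w x * (\<Sum>y\<in>Y x. q x y))"
      by (simp add: abs_mult mult_ac)
  qed
  show "integrable (measure_pmf \<mu>) (\<lambda>x. w x * difference_quotient f n x)"
    by (rule integrable_dominated_convergence2[OF _ _ integrable_mult_right[OF int] lim bd]) auto
  show "integrable (measure_pmf \<mu>) (\<lambda>x. w x * (\<Sum>y\<in>Y x. q x y * (f y - f x)))"
    by (rule integrable_dominated_convergence[OF _ _ integrable_mult_right[OF int] lim bd]) auto
  show "(\<lambda>n. measure_pmf.expectation \<mu> (\<lambda>x. w x * difference_quotient f n x))
    \<longlonglongrightarrow> measure_pmf.expectation \<mu> (\<lambda>x. w x * (\<Sum>y\<in>Y x. q x y * (f y - f x)))"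
    by (rule integral_dominated_convergence[OF _ _ integrable_mult_right[OF int] lim bd]) auto
qed

lemma integrable_difference_quotient: "integrable (measure_pmf \<mu>) (difference_quotient f n)"
  and expectation_difference_quotient: "measure_pmf.expectation \<mu> (difference_quotient f n) = 0"
proof -
  let ?h = "inverse (real (Suc n))"
  have i: "integrable (measure_pmf \<mu>) (\<lambda>x. measure_pmf.expectation (P ?h x) f)"
      "integrable (measure_pmf \<mu>) f"
    by (auto intro: integrable_pmf_bounded[where c=c] f abs_expectation_pmf_le)
  then show "integrable (measure_pmf \<mu>) (difference_quotient f n)"
    unfolding difference_quotient_def by simp
  have "measure_pmf.expectation \<mu> (\<lambda>x. measure_pmf.expectation (P ?h x) f) = measure_pmf.expectation \<mu> f"
    using expectation_bind_pmf[OF f, of \<mu> "P ?h"] stat unfolding stationary_distribution_def by simp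
  with i show "measure_pmf.expectation \<mu> (difference_quotient f n) = 0"
    unfolding difference_quotient_def by simp
qed

end

lemma stationary_generator:
  fixes f :: "'s \<Rightarrow> real"
  assumes stat: "stationary_distribution S P \<mu>"
    and Y: "\<And>x. x \<in> S \<Longrightarrow> finite (Y x)" "\<And>x. x \<in> S \<Longrightarrow> Y x \<subseteq> S - {x}"
      "\<And>x y. x \<in> S \<Longrightarrow> y \<in> S - {x} - Y x \<Longrightarrow> q x y = 0"
    and f: "\<And>x. \<bar>f x\<bar> \<le> c"
    and int: "integrable (measure_pmf \<mu>) (\<lambda>x. (\<Sum>y\<in>Y x. q x y))"
  shows "integrable (measure_pmf \<mu>) (\<lambda>x. (\<Sum>y\<in>Y x. q x y * (f y - f x)))"
    "measure_pmf.expectation \<mu> (\<lambda>x. (\<Sum>y\<in>Y x. q x y * (f y - f x))) = 0"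
proof -
  have int': "integrable (measure_pmf \<mu>) (\<lambda>x. 1 * (\<Sum>y\<in>Y x. q x y))" using int by simp
  note a = stat Y f int' zero_le_one
  note i = stationary_difference_quotient[OF a, simplified]
  show "integrable (measure_pmf \<mu>) (\<lambda>x. (\<Sum>y\<in>Y x. q x y * (f y - f x)))"
    by (rule i(2))
  have "(\<lambda>n::nat. 0) \<longlonglongrightarrow> measure_pmf.expectation \<mu> (\<lambda>x. (\<Sum>y\<in>Y x. q x y * (f y - f x)))"
    using i(1) expectation_difference_quotient[OF a] by simp
  then show "measure_pmf.expectation \<mu> (\<lambda>x. (\<Sum>y\<in>Y x. q x y * (f y - f x))) = 0"
    by (simp add: LIMSEQ_const_iff)
qed

text \<open>Outside \<open>D\<close> the function \<open>f\<close> attains its minimum 0, so its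
  difference quotients are nonnegative there. Discarding them turns the identity into an inequality
  that involves the exit rates on \<open>D\<close> only.\<close>

lemma stationary_generator_indicator_le:
  fixes f :: "'s \<Rightarrow> real"
  assumes stat: "stationary_distribution S P \<mu>"
    and Y: "\<And>x. x \<in> S \<Longrightarrow> finite (Y x)" "\<And>x. x \<in> S \<Longrightarrow> Y x \<subseteq> S - {x}"
      "\<And>x y. x \<in> S \<Longrightarrow> y \<in> S - {x} - Y x \<Longrightarrow> q x y = 0"
    and f: "\<And>x. \<bar>f x\<bar> \<le> c"
    and int: "integrable (measure_pmf \<mu>) (\<lambda>x. indicator D x * (\<Sum>y\<in>Y x. q x y))"
    and nonneg: "\<And>x. 0 \<le> f x" and supp: "\<And>x. x \<notin> D \<Longrightarrow> f x = 0"
  shows "integrable (measure_pmf \<mu>) (\<lambda>x. indicator D x * (\<Sum>y\<in>Y x. q x y * (f y - f x)))"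
    "measure_pmf.expectation \<mu> (\<lambda>x. indicator D x * (\<Sum>y\<in>Y x. q x y * (f y - f x))) \<le> 0"
proof -
  note a = stat Y f int
  have w: "0 \<le> (indicator D x :: real)" for x by simp
  note i = stationary_difference_quotient[where w="indicator D", OF a w]
  show "integrable (measure_pmf \<mu>) (\<lambda>x. indicator D x * (\<Sum>y\<in>Y x. q x y * (f y - f x)))"
    by (rule i(2))
  have "measure_pmf.expectation \<mu> (\<lambda>x. indicator D x * difference_quotient f n x) \<le> 0" for n
  proof -
    have "0 \<le> difference_quotient f n x" if "x \<notin> D" for x
      using supp[OF that] nonneg unfolding difference_quotient_def
      by (intro divide_nonneg_nonneg) (auto intro!: integral_nonneg)
    then have "measure_pmf.expectation \<mu> (\<lambda>x. indicator D x * difference_quotient f n x)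
      \<le> measure_pmf.expectation \<mu> (difference_quotient f n)"
      by (intro integral_mono i(3) integrable_difference_quotient[where w="indicator D", OF a w])
        (auto split: split_indicator)
    then show ?thesis using expectation_difference_quotient[where w="indicator D", OF a w] by simp
  qed
  then show "measure_pmf.expectation \<mu> (\<lambda>x. indicator D x * (\<Sum>y\<in>Y x. q x y * (f y - f x))) \<le> 0"
    by (intro LIMSEQ_le_const2[OF i(1)]) auto
qed

end

section \<open>Configurations as sets of cells\<close>

declare One_nat_def [simp del]

text \<open>\<open>S\<close> and \<open>T\<close> are the sets of left endpoints of the 1-items and of the 2-items, respectively.\<close>

definition cells_ok :: "nat set \<Rightarrow> nat set \<Rightarrow> bool" where
  "cells_ok S T \<longleftrightarrow> finite S \<and> finite T \<and> S \<inter> T = {} \<and> S \<inter> Suc ` T = {} \<and> T \<inter> Suc ` T = {}"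

definition occ :: "nat set \<Rightarrow> nat set \<Rightarrow> nat set" where
  "occ S T = S \<union> T \<union> Suc ` T"

definition first_free :: "nat set \<Rightarrow> nat" where
  "first_free C = (LEAST k. k \<notin> C)"

definition first_pair :: "nat set \<Rightarrow> nat" where
  "first_pair C = (LEAST k. k \<notin> C \<and> Suc k \<notin> C)"

definition generator ::
    "real \<Rightarrow> real \<Rightarrow> (nat set \<Rightarrow> nat set \<Rightarrow> real) \<Rightarrow> nat set \<Rightarrow> nat set \<Rightarrow> real" where
  "generator a b F S T =
     a * (F (insert (first_free (occ S T)) S) T - F S T) +
     b * (F S (insert (first_pair (occ S T)) T) - F S T) +
     (\<Sum>k\<in>S. F (S - {k}) T - F S T) + (\<Sum>k\<in>T. F S (T - {k}) - F S T)"

definition starts :: "nat \<Rightarrow> item set \<Rightarrow> nat set" where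
  "starts i A = {k. (i, real k) \<in> A}"

lemma configuration_eq_starts:
  assumes "A \<in> configurations"
  shows "A = (\<lambda>k. (1, real k)) ` starts 1 A \<union> (\<lambda>k. (2, real k)) ` starts 2 A"
proof -
  have "A \<subseteq> {1, 2} \<times> \<nat>" using assms unfolding configurations_def by auto
  then show ?thesis by (auto simp: starts_def Nats_def image_def)
qed

lemma finite_starts: "A \<in> configurations \<Longrightarrow> finite (starts i A)"
proof -
  assume "A \<in> configurations"
  then have "finite A" unfolding configurations_def by auto
  then have "finite ((\<lambda>k. (i, real k)) -` A)" by (rule finite_vimageI) (auto intro: injI)
  then show ?thesis unfolding starts_def vimage_def .
qed

lemma disjoint_cells_iff:
  "{real k ..< real k + item_size i} \<inter> occupied (j, real m) = {} \<longleftrightarrow>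
    k + (if i = 1 then 1 else 2) \<le> m \<or> m + (if j = 1 then 1 else 2) \<le> k"
proof (intro iffI)
  assume e: "{real k ..< real k + item_size i} \<inter> occupied (j, real m) = {}"
  \<comment> \<open>If two half-open intervals meet, the larger left endpoint lies in both.\<close>
  then have "max (real k) (real m) \<notin> {real k ..< real k + item_size i} \<inter> occupied (j, real m)" by simp
  then have "real k + item_size i \<le> real m \<or> real m + item_size j \<le> real k"
    by (auto simp: occupied_def item_size_def max_def split: if_splits)
  then show "k + (if i = 1 then 1 else 2) \<le> m \<or> m + (if j = 1 then 1 else 2) \<le> k"
    by (auto simp: item_size_def split: if_splits)
next
  assume "k + (if i = 1 then 1 else 2) \<le> m \<or> m + (if j = 1 then 1 else 2) \<le> k"
  then have "real k + item_size i \<le> real m \<or> real m + item_size j \<le> real k"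
    by (auto simp: item_size_def split: if_splits)
  then show "{real k ..< real k + item_size i} \<inter> occupied (j, real m) = {}"
    by (auto simp: occupied_def)
qed

lemma configuration_disjoint:
  assumes "A \<in> configurations" "(i, real k) \<in> A" "(j, real m) \<in> A" "(i, k) \<noteq> (j, m)"
  shows "k + (if i = 1 then 1 else 2) \<le> m \<or> m + (if j = 1 then 1 else 2) \<le> k"
proof -
  have "occupied (i, real k) \<inter> occupied (j, real m) = {}"
    using assms unfolding configurations_def pairwise_def by auto
  then show ?thesis unfolding disjoint_cells_iff[symmetric] by (simp add: occupied_def)
qed

lemma cells_ok_starts:
  assumes "A \<in> configurations"
  shows "cells_ok (starts 1 A) (starts 2 A)"
proof -
  have "False" if "(1, real k) \<in> A" "(2, real k) \<in> A" for k
    using configuration_disjoint[OF assms that] by simp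
  moreover have "False" if "(1, real (Suc k)) \<in> A" "(2, real k) \<in> A" for k
    using configuration_disjoint[OF assms that] by simp
  moreover have "False" if "(2, real (Suc k)) \<in> A" "(2, real k) \<in> A" for k
    using configuration_disjoint[OF assms that] by simp
  ultimately show ?thesis
    unfolding cells_ok_def using finite_starts[OF assms] by (auto simp: starts_def)
qed

lemma fits_iff:
  assumes "A \<in> configurations" and "i \<in> {1, 2}"
  shows "(\<forall>a\<in>A. {real k ..< real k + item_size i} \<inter> occupied a = {}) \<longleftrightarrow>
    k \<notin> occ (starts 1 A) (starts 2 A) \<and> (i = 2 \<longrightarrow> Suc k \<notin> occ (starts 1 A) (starts 2 A))"
    (is "?l \<longleftrightarrow> ?r")
proof -
  have "?l \<longleftrightarrow> (\<forall>m\<in>starts 1 A. k + i \<le> m \<or> m + 1 \<le> k) \<and> (\<forall>m\<in>starts 2 A. k + i \<le> m \<or> m + 2 \<le> k)"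
    by (subst configuration_eq_starts[OF assms(1)])
      (use assms(2) in \<open>auto simp: ball_Un disjoint_cells_iff simp del: One_nat_def\<close>)
  also have "\<dots> \<longleftrightarrow> ?r"
  proof -
    have S: "k \<notin> S \<longleftrightarrow> (\<forall>m\<in>S. k + 1 \<le> m \<or> m + 1 \<le> k)"
      "k \<notin> S \<and> Suc k \<notin> S \<longleftrightarrow> (\<forall>m\<in>S. k + 2 \<le> m \<or> m + 1 \<le> k)"
      "k \<notin> S \<union> Suc ` S \<longleftrightarrow> (\<forall>m\<in>S. k + 1 \<le> m \<or> m + 2 \<le> k)"
      "k \<notin> S \<union> Suc ` S \<and> Suc k \<notin> S \<union> Suc ` S \<longleftrightarrow> (\<forall>m\<in>S. k + 2 \<le> m \<or> m + 2 \<le> k)"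
      for S :: "nat set"
    proof -
      have e: "k + 1 \<le> m \<or> m + 1 \<le> k \<longleftrightarrow> m \<noteq> k"
        "k + 2 \<le> m \<or> m + 1 \<le> k \<longleftrightarrow> m \<noteq> k \<and> m \<noteq> Suc k"
        "k + 1 \<le> m \<or> m + 2 \<le> k \<longleftrightarrow> m \<noteq> k \<and> Suc m \<noteq> k"
        "k + 2 \<le> m \<or> m + 2 \<le> k \<longleftrightarrow> m \<noteq> k \<and> m \<noteq> Suc k \<and> Suc m \<noteq> k" for m by auto
      show "k \<notin> S \<longleftrightarrow> (\<forall>m\<in>S. k + 1 \<le> m \<or> m + 1 \<le> k)"
        "k \<notin> S \<and> Suc k \<notin> S \<longleftrightarrow> (\<forall>m\<in>S. k + 2 \<le> m \<or> m + 1 \<le> k)"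
        "k \<notin> S \<union> Suc ` S \<longleftrightarrow> (\<forall>m\<in>S. k + 1 \<le> m \<or> m + 2 \<le> k)"
        "k \<notin> S \<union> Suc ` S \<and> Suc k \<notin> S \<union> Suc ` S \<longleftrightarrow> (\<forall>m\<in>S. k + 2 \<le> m \<or> m + 2 \<le> k)"
        unfolding e by auto
    qed
    from assms(2) consider "i = 1" | "i = 2" by auto
    then show ?thesis
    proof cases
      case 1
      then show ?thesis using S(1)[of "starts 1 A"] S(3)[of "starts 2 A"] unfolding occ_def by auto
    next
      case 2
      then show ?thesis using S(2)[of "starts 1 A"] S(4)[of "starts 2 A"] unfolding occ_def by auto
    qed
  qed
  finally show ?thesis .
qed

lemma first_fit_position_cells:
  assumes A: "A \<in> configurations"
  shows "first_fit_position 1 A = real (first_free (occ (starts 1 A) (starts 2 A)))"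
    and "first_fit_position 2 A = real (first_pair (occ (starts 1 A) (starts 2 A)))"
proof -
  have "first_fit_position i A = real (LEAST k. k \<notin> occ (starts 1 A) (starts 2 A) \<and>
      (i = 2 \<longrightarrow> Suc k \<notin> occ (starts 1 A) (starts 2 A)))" if i: "i \<in> {1, 2}" for i
  proof -
    note f = first_fit_position[OF A i]
    obtain n where n: "first_fit_position i A = real n" using f(1) by (auto simp: Nats_def)
    have "(LEAST k. k \<notin> occ (starts 1 A) (starts 2 A) \<and>
      (i = 2 \<longrightarrow> Suc k \<notin> occ (starts 1 A) (starts 2 A))) = n"
      unfolding fits_iff[OF A i, symmetric]
    proof (rule Least_equality)
      show "\<forall>a\<in>A. {real n ..< real n + item_size i} \<inter> occupied a = {}" using f(2) n by simp
      show "n \<le> k" if "\<forall>a\<in>A. {real k ..< real k + item_size i} \<inter> occupied a = {}" for k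
        using f(3)[of "real k"] that n by simp
    qed
    then show ?thesis using n by simp
  qed
  from this[of 1] this[of 2] show
    "first_fit_position 1 A = real (first_free (occ (starts 1 A) (starts 2 A)))"
    "first_fit_position 2 A = real (first_pair (occ (starts 1 A) (starts 2 A)))"
    by (simp_all add: first_free_def first_pair_def)
qed

lemma starts_arrival:
  assumes A: "A \<in> configurations"
  shows "starts 1 (arrival 1 A) = insert (first_free (occ (starts 1 A) (starts 2 A))) (starts 1 A)"
    "starts 2 (arrival 1 A) = starts 2 A"
    "starts 1 (arrival 2 A) = starts 1 A"
    "starts 2 (arrival 2 A) = insert (first_pair (occ (starts 1 A) (starts 2 A))) (starts 2 A)"
  by (auto simp: arrival_def starts_def first_fit_position_cells[OF A])

definition successors :: "item set \<Rightarrow> item set set" where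
  "successors A = {arrival 1 A, arrival 2 A} \<union> (\<lambda>a. A - {a}) ` A"

lemma arrival_new:
  assumes A: "A \<in> configurations" and i: "i \<in> {1, 2}"
  shows "(i, first_fit_position i A) \<notin> A"
proof
  assume a: "(i, first_fit_position i A) \<in> A"
  then have "{first_fit_position i A ..< first_fit_position i A + item_size i}
      \<inter> occupied (i, first_fit_position i A) = {}"
    using first_fit_position(2)[OF A i] by blast
  then show False by (auto simp: occupied_def item_size_def split: if_splits)
qed

lemma successors:
  assumes A: "A \<in> configurations"
  shows "finite (successors A)" "successors A \<subseteq> configurations - {A}"
    "\<And>B. B \<notin> successors A \<Longrightarrow> first_fit_rate p r A B = 0"
proof -
  have fin: "finite A" using A unfolding configurations_def by auto
  then show "finite (successors A)" unfolding successors_def by auto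
  have "A - {a} \<in> configurations" for a
    using A unfolding configurations_def by (auto intro: pairwise_subset)
  moreover have "arrival i A \<noteq> A" if "i \<in> {1, 2}" for i
    using arrival_new[OF A that] by (auto simp: arrival_def)
  ultimately show "successors A \<subseteq> configurations - {A}"
    unfolding successors_def using arrival_in_configurations[OF A] by auto
  show "first_fit_rate p r A B = 0" if "B \<notin> successors A" for B
  proof -
    have "B \<noteq> arrival i A" if "i \<in> {1, 2}" for i
      using \<open>B \<notin> _\<close> that unfolding successors_def by auto
    moreover have "B \<noteq> A - {a}" if "a \<in> A" for a
      using \<open>B \<notin> _\<close> that unfolding successors_def by auto
    ultimately show ?thesis unfolding first_fit_rate_def by simp
  qed
qed

text \<open>The rate to \<open>B\<close> adds up over all transitions that lead to \<open>B\<close>,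
  so exchanging the sums turns a sum over target states into a sum over transitions, whether or not
  targets coincide.\<close>

lemma sum_first_fit_rate:
  assumes A: "A \<in> configurations"
  shows "(\<Sum>B\<in>successors A. first_fit_rate p r A B * g B)
    = (\<Sum>i\<in>{1, 2}. p i * r * g (arrival i A)) + (\<Sum>a\<in>A. g (A - {a}))"
proof -
  have "(\<Sum>B\<in>successors A. first_fit_rate p r A B * g B)
    = (\<Sum>B\<in>successors A. \<Sum>i\<in>{1, 2}. if B = arrival i A then p i * r * g B else 0)
     + (\<Sum>B\<in>successors A. \<Sum>a\<in>A. if B = A - {a} then g B else 0)"
    unfolding first_fit_rate_def distrib_right sum_distrib_right sum.distrib[symmetric]
    by (intro sum.cong arg_cong2[where f="(+)"]) auto
  also have "\<dots> = (\<Sum>i\<in>{1, 2}. \<Sum>B\<in>successors A. if B = arrival i A then p i * r * g B else 0)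
     + (\<Sum>a\<in>A. \<Sum>B\<in>successors A. if B = A - {a} then g B else 0)"
    by (intro arg_cong2[where f="(+)"]) (rule sum.swap)+
  also have "\<dots> = (\<Sum>i\<in>{1, 2}. p i * r * g (arrival i A)) + (\<Sum>a\<in>A. g (A - {a}))"
    by (intro arg_cong2[where f="(+)"] sum.cong refl)
      (use successors(1)[OF A] in \<open>auto simp: sum.delta successors_def\<close>)
  finally show ?thesis .
qed

lemma sum_configuration:
  assumes "A \<in> configurations"
  shows "(\<Sum>a\<in>A. g a) = (\<Sum>k\<in>starts 1 A. g (1, real k)) + (\<Sum>k\<in>starts 2 A. g (2, real k))"
proof -
  have "(\<Sum>a\<in>A. g a) = (\<Sum>a\<in>(\<lambda>k. (1, real k)) ` starts 1 A. g a) + (\<Sum>a\<in>(\<lambda>k. (2, real k)) ` starts 2 A. g a)"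
    using finite_starts[OF assms]
    by (subst configuration_eq_starts[OF assms], subst sum.union_disjoint) auto
  then show ?thesis by (simp add: sum.reindex inj_on_def)
qed

lemma sum_rate_generator:
  assumes A: "A \<in> configurations"
  shows "(\<Sum>B\<in>successors A. first_fit_rate p r A B *
      (F (starts 1 B) (starts 2 B) - F (starts 1 A) (starts 2 A)))
    = generator (p 1 * r) (p 2 * r) F (starts 1 A) (starts 2 A)"
proof -
  have s: "starts 1 (A - {(1, real k)}) = starts 1 A - {k}" "starts 2 (A - {(1, real k)}) = starts 2 A"
     "starts 2 (A - {(2, real k)}) = starts 2 A - {k}" "starts 1 (A - {(2, real k)}) = starts 1 A" for k
    by (auto simp: starts_def)
  show ?thesis
    unfolding sum_first_fit_rate[OF A] sum_configuration[OF A] generator_def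
    by (simp add: starts_arrival[OF A] s[simplified])
qed

definition cell_pmf :: "item set pmf \<Rightarrow> (nat set \<times> nat set) pmf" where
  "cell_pmf \<mu> = map_pmf (\<lambda>A. (starts 1 A, starts 2 A)) \<mu>"

section \<open>Finite mean number of items and transfer to cells\<close>

context
  fixes p :: "nat \<Rightarrow> real" and r :: real and P :: "real \<Rightarrow> item set \<Rightarrow> item set pmf"
    and \<mu> :: "item set pmf"
  assumes mtf: "markov_transition_function configurations (first_fit_rate p r) P"
    and stat: "stationary_distribution configurations P \<mu>"
    and nonneg: "0 \<le> p 1 * r" "0 \<le> p 2 * r"
begin

lemma set_pmf_configurations: "A \<in> set_pmf \<mu> \<Longrightarrow> A \<in> configurations"
  using stat unfolding stationary_distribution_def by auto

lemma sum_rates: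
  assumes A: "A \<in> configurations"
  shows "(\<Sum>B\<in>successors A. first_fit_rate p r A B) = p 1 * r + p 2 * r + real (card A)"
  using sum_first_fit_rate[OF A, of p r "\<lambda>_. 1"] by simp

text \<open>The test function is \<open>n - card A\<close>, cut off at 0. On \<open>D\<close> every
  departure raises it by exactly one and an arrival lowers it by at most one, so its drift there is
  at least \<open>card A\<close> minus the total arrival rate. The resulting bound does not depend
  on \<open>n\<close>.\<close>

lemma expectation_card_truncated:
  "measure_pmf.expectation \<mu> (\<lambda>A. indicator {A. card A \<le> n} A * real (card A)) \<le> p 1 * r + p 2 * r"
proof -
  define D where "D = {A :: item set. card A \<le> n}"
  define f where "f A = (if card A \<le> n then real (n - card A) else 0)" for A :: "item set"
  define G where "G A = (\<Sum>B\<in>successors A. first_fit_rate p r A B * (f B - f A))" for A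
  have bd: "\<bar>f A\<bar> \<le> real n" for A by (simp add: f_def)
  have int: "integrable \<mu> (\<lambda>A. indicator D A * (\<Sum>B\<in>successors A. first_fit_rate p r A B))"
  proof (rule integrable_pmf_bounded[where c="p 1 * r + p 2 * r + n"])
    fix A assume "A \<in> set_pmf \<mu>"
    note A = set_pmf_configurations[OF this]
    show "\<bar>indicator D A * (\<Sum>B\<in>successors A. first_fit_rate p r A B)\<bar> \<le> p 1 * r + p 2 * r + n"
      unfolding sum_rates[OF A] using nonneg by (auto simp: D_def split: split_indicator)
  qed
  have s: "\<And>x. x \<in> configurations \<Longrightarrow> finite (successors x)"
    "\<And>x. x \<in> configurations \<Longrightarrow> successors x \<subseteq> configurations - {x}"
    "\<And>x y. x \<in> configurations \<Longrightarrow> y \<in> configurations - {x} - successors x \<Longrightarrow> first_fit_rate p r x y = 0"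
    using successors by blast+
  have gen1: "integrable \<mu> (\<lambda>A. indicator D A * G A)"
    unfolding G_def
    by (rule stationary_generator_indicator_le(1)[OF mtf stat s bd int]) (simp_all add: f_def D_def)
  have gen2: "measure_pmf.expectation \<mu> (\<lambda>A. indicator D A * G A) \<le> 0"
    unfolding G_def
    by (rule stationary_generator_indicator_le(2)[OF mtf stat s bd int]) (simp_all add: f_def D_def)
  have le: "real (card A) - (p 1 * r + p 2 * r) \<le> G A" if A: "A \<in> configurations" "A \<in> D" for A
  proof -
    have fin: "finite A" using A unfolding configurations_def by auto
    have n: "card A \<le> n" using A by (simp add: D_def)
    have "card (arrival i A) = Suc (card A)" if "i \<in> {1, 2}" for i
      using arrival_new[OF A(1) that] fin by (simp add: arrival_def)
    then have "-1 \<le> f (arrival i A) - f A" if "i \<in> {1, 2}" for i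
      using n that by (auto simp: f_def)
    then have a: "- (p 1 * r) \<le> p 1 * r * (f (arrival 1 A) - f A)"
       "- (p 2 * r) \<le> p 2 * r * (f (arrival 2 A) - f A)"
      using mult_left_mono[OF _ nonneg(1), of "-1"] mult_left_mono[OF _ nonneg(2), of "-1"] by auto
    have "f (A - {a}) - f A = 1" if "a \<in> A" for a
    proof -
      have "card (A - {a}) = card A - 1" "0 < card A" using that fin by (auto simp: card_gt_0_iff)
      then show ?thesis using n by (simp add: f_def)
    qed
    then have "(\<Sum>a\<in>A. f (A - {a}) - f A) = real (card A)" by simp
    with a show ?thesis unfolding G_def sum_first_fit_rate[OF A(1)] by simp
  qed
  have "measure_pmf.expectation \<mu> (\<lambda>A. indicator D A * (real (card A) - (p 1 * r + p 2 * r)))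
      \<le> measure_pmf.expectation \<mu> (\<lambda>A. indicator D A * G A)"
  proof (intro integral_mono_AE gen1 AE_pmfI integrable_pmf_bounded[where c="n + p 1 * r + p 2 * r"])
    fix A assume "A \<in> set_pmf \<mu>"
    then show "indicator D A * (real (card A) - (p 1 * r + p 2 * r)) \<le> indicator D A * G A"
      using le set_pmf_configurations by (auto split: split_indicator)
    show "\<bar>indicator D A * (real (card A) - (p 1 * r + p 2 * r))\<bar> \<le> n + p 1 * r + p 2 * r"
      using nonneg by (auto simp: D_def split: split_indicator)
  qed
  also have "\<dots> \<le> 0" by (rule gen2)
  finally have le0: "measure_pmf.expectation \<mu> (\<lambda>A. indicator D A * (real (card A) - (p 1 * r + p 2 * r))) \<le> 0" .
  have i: "integrable \<mu> (\<lambda>A. indicator D A * (real (card A) - (p 1 * r + p 2 * r)))"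
    by (rule integrable_pmf_bounded[where c="n + p 1 * r + p 2 * r"])
      (use nonneg in \<open>auto simp: D_def split: split_indicator\<close>)
  have i': "integrable \<mu> (\<lambda>A. indicator D A * real (card A))"
    by (rule integrable_pmf_bounded[where c=n]) (auto simp: D_def split: split_indicator)
  have "measure_pmf.expectation \<mu> (\<lambda>A. indicator D A * real (card A)) \<le>
    measure_pmf.expectation \<mu> (\<lambda>A. indicator D A * (real (card A) - (p 1 * r + p 2 * r)) + (p 1 * r + p 2 * r))"
    using nonneg
    by (intro integral_mono i' Bochner_Integration.integrable_add i integrable_const)
      (auto split: split_indicator)
  also have "\<dots> \<le> p 1 * r + p 2 * r" using i le0 by (subst Bochner_Integration.integral_add) auto
  finally show ?thesis unfolding D_def .
qed

text \<open>Monotone convergence, since the truncated expectations are bounded uniformly in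
  \<open>n\<close>.\<close>

lemma integrable_card: "integrable \<mu> (\<lambda>A. real (card A))"
proof -
  define f where "f n A = indicator {A. card A \<le> n} A * real (card A)" for n and A :: "item set"
  have i: "integrable \<mu> (f n)" for n
    by (rule integrable_pmf_bounded[where c=n]) (auto simp: f_def split: split_indicator)
  have m: "f i A \<le> f j A" if "i \<le> j" for i j A using that by (auto simp: f_def split: split_indicator)
  have "convergent (\<lambda>n. measure_pmf.expectation \<mu> (f n))"
  proof (rule Bseq_monoseq_convergent)
    show "Bseq (\<lambda>n. measure_pmf.expectation \<mu> (f n))"
    proof (rule BseqI')
      fix n
      have "0 \<le> measure_pmf.expectation \<mu> (f n)" by (rule Bochner_Integration.integral_nonneg) (auto simp: f_def)
      then show "norm (measure_pmf.expectation \<mu> (f n)) \<le> p 1 * r + p 2 * r"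
        using expectation_card_truncated[of n] by (simp add: f_def[abs_def])
    qed
    show "monoseq (\<lambda>n. measure_pmf.expectation \<mu> (f n))"
      unfolding monoseq_def using m i by (intro disjI1 allI impI integral_mono) auto
  qed
  then obtain L where L: "(\<lambda>n. measure_pmf.expectation \<mu> (f n)) \<longlonglongrightarrow> L"
    unfolding convergent_def by auto
  show ?thesis
  proof (rule integral_monotone_convergence_nonneg(1)[OF i _ _ _ L])
    show "AE A in \<mu>. (\<lambda>n. f n A) \<longlonglongrightarrow> real (card A)"
    proof (intro AE_pmfI tendsto_eventually)
      fix A show "\<forall>\<^sub>F n in sequentially. f n A = real (card A)"
        using eventually_ge_at_top[of "card A"] by eventually_elim (simp add: f_def)
    qed
  qed (use m in \<open>auto simp: mono_def f_def\<close>)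
qed

lemma cell_pmf_ok: "s \<in> set_pmf (cell_pmf \<mu>) \<Longrightarrow> cells_ok (fst s) (snd s)"
  unfolding cell_pmf_def using cells_ok_starts[OF set_pmf_configurations] by auto

text \<open>The exit rate is the total arrival rate plus \<open>card A\<close>, hence integrable by
  now, and the identity holds for every bounded functional of the cells.\<close>

lemma cell_pmf_generator:
  assumes F: "\<And>S T. \<bar>F S T\<bar> \<le> c"
  shows "integrable (cell_pmf \<mu>) (\<lambda>s. generator (p 1 * r) (p 2 * r) F (fst s) (snd s))"
    "measure_pmf.expectation (cell_pmf \<mu>) (\<lambda>s. generator (p 1 * r) (p 2 * r) F (fst s) (snd s)) = 0"
proof -
  have int: "integrable \<mu> (\<lambda>A. \<Sum>B\<in>successors A. first_fit_rate p r A B)"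
  proof -
    have "integrable \<mu> (\<lambda>A. p 1 * r + p 2 * r + real (card A))" using integrable_card by simp
    then show ?thesis
      by (rule integrable_cong_AE_imp) (auto intro!: AE_pmfI simp: sum_rates set_pmf_configurations)
  qed
  have s: "\<And>x. x \<in> configurations \<Longrightarrow> finite (successors x)"
    "\<And>x. x \<in> configurations \<Longrightarrow> successors x \<subseteq> configurations - {x}"
    "\<And>x y. x \<in> configurations \<Longrightarrow> y \<in> configurations - {x} - successors x \<Longrightarrow> first_fit_rate p r x y = 0"
    using successors by blast+
  define f where "f A = F (starts 1 A) (starts 2 A)" for A
  have f: "\<bar>f A\<bar> \<le> c" for A by (simp add: f_def F)
  define G where "G A = generator (p 1 * r) (p 2 * r) F (starts 1 A) (starts 2 A)" for A
  have eq: "AE A in \<mu>. (\<Sum>B\<in>successors A. first_fit_rate p r A B * (f B - f A)) = G A"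
    by (intro AE_pmfI) (simp add: f_def G_def sum_rate_generator set_pmf_configurations)
  note g = stationary_generator[OF mtf stat s f int]
  have "integrable \<mu> G" by (rule integrable_cong_AE_imp[OF g(1) _ eq]) auto
  then show "integrable (cell_pmf \<mu>) (\<lambda>s. generator (p 1 * r) (p 2 * r) F (fst s) (snd s))"
    unfolding cell_pmf_def G_def by simp
  have "measure_pmf.expectation \<mu> G = 0"
    using integral_cong_AE[OF _ _ eq] g(2) by simp
  then show "measure_pmf.expectation (cell_pmf \<mu>) (\<lambda>s. generator (p 1 * r) (p 2 * r) F (fst s) (snd s)) = 0"
    unfolding cell_pmf_def G_def by simp
qed

end

declare One_nat_def [simp]

section \<open>Items below the level of the 1-items\<close>

lemma first_free:
  assumes "finite C"
  shows "first_free C \<notin> C" "\<And>k. k \<notin> C \<Longrightarrow> first_free C \<le> k"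
proof -
  obtain k where "k \<notin> C" using ex_new_if_finite[OF infinite_UNIV_nat assms] by auto
  then show "first_free C \<notin> C" unfolding first_free_def by (rule LeastI)
  show "\<And>k. k \<notin> C \<Longrightarrow> first_free C \<le> k" unfolding first_free_def by (rule Least_le)
qed

lemma first_free_eqI: "k \<notin> C \<Longrightarrow> (\<And>j. j < k \<Longrightarrow> j \<in> C) \<Longrightarrow> first_free C = k"
  unfolding first_free_def by (rule Least_equality) (auto simp: not_less[symmetric])

lemma first_pair:
  assumes "finite C"
  shows "first_pair C \<notin> C" "Suc (first_pair C) \<notin> C"
    "\<And>k. k \<notin> C \<Longrightarrow> Suc k \<notin> C \<Longrightarrow> first_pair C \<le> k"
proof -
  have "finite (C \<union> {k. Suc k \<in> C})"
    using assms finite_vimageI[OF assms, of Suc] by (simp add: vimage_def)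
  then obtain k where "k \<notin> C \<union> {k. Suc k \<in> C}" using ex_new_if_finite[OF infinite_UNIV_nat] by blast
  then have k: "k \<notin> C \<and> Suc k \<notin> C" by auto
  show "first_pair C \<notin> C" "Suc (first_pair C) \<notin> C"
    using LeastI[of "\<lambda>k. k \<notin> C \<and> Suc k \<notin> C", OF k] unfolding first_pair_def by auto
  show "\<And>k. k \<notin> C \<Longrightarrow> Suc k \<notin> C \<Longrightarrow> first_pair C \<le> k"
    unfolding first_pair_def by (rule Least_le) auto
qed

lemma first_pair_left:
  assumes "finite C" and "first_pair C = Suc k"
  shows "k \<in> C"
  using first_pair[OF assms(1)] assms(2) by (metis Suc_n_not_le_n)

definition vacant :: "nat \<Rightarrow> nat \<Rightarrow> nat set \<Rightarrow> real" where
  "vacant J K C = real (card ({J..<K} - C))"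

lemma vacant_bounds: "0 \<le> vacant J K C" "vacant J K C \<le> real (K - J)"
  unfolding vacant_def using card_mono[of "{J..<K}" "{J..<K} - C"] by auto

lemma vacant_insert:
  assumes "x \<notin> C"
  shows "vacant J K (insert x C) = vacant J K C - of_bool (J \<le> x \<and> x < K)"
proof (cases "J \<le> x \<and> x < K")
  case True
  have *: "{J..<K} - insert x C = ({J..<K} - C) - {x}" by auto
  have "x \<in> {J..<K} - C" using True assms by auto
  then have "Suc (card (({J..<K} - C) - {x})) = card ({J..<K} - C)"
    by (intro card_Suc_Diff1) auto
  then show ?thesis unfolding vacant_def * using True by (simp flip: of_nat_Suc)
next
  case False
  then have "{J..<K} - insert x C = {J..<K} - C" by auto
  then show ?thesis using False unfolding vacant_def by simp
qed

lemma vacant_remove: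
  assumes "x \<in> C"
  shows "vacant J K (C - {x}) = vacant J K C + of_bool (J \<le> x \<and> x < K)"
  using vacant_insert[of x "C - {x}" J K] assms by (simp add: insert_absorb)

lemma occ_insert: "occ (insert x S) T = insert x (occ S T)"
  "occ S (insert x T) = insert x (insert (Suc x) (occ S T))"
  by (auto simp: occ_def)

lemma finite_occ: "cells_ok S T \<Longrightarrow> finite (occ S T)"
  by (auto simp: cells_ok_def occ_def)

lemma occ_remove:
  assumes "cells_ok S T"
  shows "k \<in> S \<Longrightarrow> occ (S - {k}) T = occ S T - {k}"
    "k \<in> T \<Longrightarrow> occ S (T - {k}) = occ S T - {k} - {Suc k}"
  using assms unfolding cells_ok_def occ_def by auto

lemma mem_occ: "k \<in> S \<Longrightarrow> k \<in> occ S T" "k \<in> T \<Longrightarrow> k \<in> occ S T" "k \<in> T \<Longrightarrow> Suc k \<in> occ S T"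
  by (auto simp: occ_def)

text \<open>Items leave at rate 1, so the left side is the total rate at which departures free cells
  of \<open>{J..<K}\<close>. This form is what the departure terms of a drift bound sum up
  to.\<close>

lemma sum_occupied_cells:
  assumes "cells_ok S T" and "J \<le> K"
  shows "(\<Sum>k\<in>S. of_bool (J \<le> k \<and> k < K)) +
      (\<Sum>k\<in>T. of_bool (J \<le> k \<and> k < K) + of_bool (J \<le> Suc k \<and> Suc k < K))
    = real (K - J) - vacant J K (occ S T)"
proof -
  have fin: "finite S" "finite T" using assms unfolding cells_ok_def by auto
  let ?I = "{J..<K}"
  have "card (Suc ` T \<inter> ?I) = card (T \<inter> {k. J \<le> Suc k \<and> Suc k < K})"
  proof -
    have "Suc ` T \<inter> ?I = Suc ` (T \<inter> {k. J \<le> Suc k \<and> Suc k < K})" by auto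
    then show ?thesis by (simp add: card_image)
  qed
  moreover have "S \<inter> {k. J \<le> k \<and> k < K} = S \<inter> ?I" "T \<inter> {k. J \<le> k \<and> k < K} = T \<inter> ?I" by auto
  moreover have "card (occ S T \<inter> ?I) = card (S \<inter> ?I) + card (T \<inter> ?I) + card (Suc ` T \<inter> ?I)"
  proof -
    have "occ S T \<inter> ?I = (S \<inter> ?I) \<union> (T \<inter> ?I) \<union> (Suc ` T \<inter> ?I)" by (auto simp: occ_def)
    moreover have "(S \<inter> ?I) \<inter> (T \<inter> ?I) = {}" "((S \<inter> ?I) \<union> (T \<inter> ?I)) \<inter> (Suc ` T \<inter> ?I) = {}"
      using assms unfolding cells_ok_def by auto
    ultimately show ?thesis using fin by (simp add: card_Un_disjoint)
  qed
  moreover have "real (card (occ S T \<inter> ?I)) = real (K - J) - vacant J K (occ S T)"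
  proof -
    have "card ?I = card (?I - occ S T) + card (occ S T \<inter> ?I)"
      using card_Int_Diff[of ?I "occ S T"] by (simp add: Int_commute)
    then show ?thesis by (simp add: vacant_def)
  qed
  ultimately show ?thesis
    using fin by (simp add: sum.distrib sum_of_bool_eq)
qed

lemma generator_le:
  assumes "cells_ok S T" "0 \<le> a" "0 \<le> b"
    and "F (insert (first_free (occ S T)) S) T - F S T \<le> d1"
    and "F S (insert (first_pair (occ S T)) T) - F S T \<le> d2"
    and "\<And>k. k \<in> S \<Longrightarrow> F (S - {k}) T - F S T \<le> e1 k"
    and "\<And>k. k \<in> T \<Longrightarrow> F S (T - {k}) - F S T \<le> e2 k"
  shows "generator a b F S T \<le> a * d1 + b * d2 + sum e1 S + sum e2 T"
  unfolding generator_def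
  by (intro add_mono mult_left_mono sum_mono assms)

section \<open>Bounded functionals\<close>

definition bdd :: "(nat set \<Rightarrow> nat set \<Rightarrow> real) \<Rightarrow> bool" where
  "bdd G \<longleftrightarrow> (\<exists>c. \<forall>S T. \<bar>G S T\<bar> \<le> c)"

lemma bddI: "(\<And>S T. \<bar>G S T\<bar> \<le> c) \<Longrightarrow> bdd G"
  unfolding bdd_def by auto

lemma bdd_const [intro, simp]: "bdd (\<lambda>S T. c)"
  unfolding bdd_def by auto

lemma bdd_add [intro]: "bdd F \<Longrightarrow> bdd G \<Longrightarrow> bdd (\<lambda>S T. F S T + G S T)"
  unfolding bdd_def by (meson abs_triangle_ineq add_mono order_trans)

lemma bdd_uminus [intro]: "bdd F \<Longrightarrow> bdd (\<lambda>S T. - F S T)"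
  unfolding bdd_def by auto

lemma bdd_diff [intro]: "bdd F \<Longrightarrow> bdd G \<Longrightarrow> bdd (\<lambda>S T. F S T - G S T)"
  unfolding bdd_def by (meson abs_triangle_ineq4 add_mono order_trans)

lemma bdd_mult [intro]: "bdd F \<Longrightarrow> bdd G \<Longrightarrow> bdd (\<lambda>S T. F S T * G S T)"
  unfolding bdd_def abs_mult by (meson abs_ge_zero mult_mono order_trans)

lemma bdd_power [intro]: "bdd F \<Longrightarrow> bdd (\<lambda>S T. F S T ^ n)"
  by (induction n) auto

lemma bdd_of_bool [intro, simp]: "bdd (\<lambda>S T. of_bool (Q S T))"
  by (rule bddI[where c=1]) auto

lemma bdd_sum [intro]: "(\<And>i. i \<in> I \<Longrightarrow> bdd (F i)) \<Longrightarrow> bdd (\<lambda>S T. \<Sum>i\<in>I. F i S T)"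
  by (induction I rule: infinite_finite_induct) auto

lemma bdd_vacant [intro]: "bdd (\<lambda>S T. vacant J K (f S T))"
  by (rule bddI[where c="real (K - J)"]) (use vacant_bounds in auto)

lemmas bdd_intros = bdd_add bdd_diff bdd_uminus bdd_mult bdd_power bdd_sum bdd_vacant bdd_of_bool bdd_const

section \<open>Vacant cells and vacant pairs below a level\<close>

abbreviation V :: "nat \<Rightarrow> nat set \<Rightarrow> nat set \<Rightarrow> real" where
  "V K S T \<equiv> vacant 0 K (occ S T)"

definition pairs_within :: "nat \<Rightarrow> nat set \<Rightarrow> real" where
  "pairs_within K T = real (card {k \<in> T. Suc k < K})"

definition vacant_pairs :: "nat \<Rightarrow> nat set \<Rightarrow> real" where
  "vacant_pairs K C = real (card {y. Suc y < K \<and> y \<notin> C \<and> Suc y \<notin> C})"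

definition wide_first_gap :: "nat \<Rightarrow> nat set \<Rightarrow> bool" where
  "wide_first_gap K C \<longleftrightarrow> Suc (first_free C) < K \<and> Suc (first_free C) \<notin> C"

lemma pairs_within_bounds: "0 \<le> pairs_within K T" "pairs_within K T \<le> real K"
proof -
  have "card {k \<in> T. Suc k < K} \<le> card {..<K}" by (rule card_mono) auto
  then show "0 \<le> pairs_within K T" "pairs_within K T \<le> real K" by (auto simp: pairs_within_def)
qed

lemma vacant_pairs_bounds: "0 \<le> vacant_pairs K C" "vacant_pairs K C \<le> real K"
proof -
  have "card {y. Suc y < K \<and> y \<notin> C \<and> Suc y \<notin> C} \<le> card {..<K}" by (rule card_mono) auto
  then show "0 \<le> vacant_pairs K C" "vacant_pairs K C \<le> real K" by (auto simp: vacant_pairs_def)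
qed

lemma bdd_pairs_within [intro]: "bdd (\<lambda>S T. pairs_within K (f S T))"
  by (rule bddI[where c="real K"]) (use pairs_within_bounds in auto)

lemma bdd_vacant_pairs [intro]: "bdd (\<lambda>S T. vacant_pairs K (f S T))"
  by (rule bddI[where c="real K"]) (use vacant_pairs_bounds in auto)

lemmas bdds = bdd_intros bdd_pairs_within bdd_vacant_pairs

lemma pairs_within_insert:
  assumes "x \<notin> T"
  shows "pairs_within K (insert x T) = pairs_within K T + of_bool (Suc x < K)"
proof (cases "Suc x < K")
  case True
  then have "{k \<in> insert x T. Suc k < K} = insert x {k \<in> T. Suc k < K}" by auto
  moreover have "finite {k \<in> T. Suc k < K}" by (rule finite_subset[of _ "{..<K}"]) auto
  ultimately show ?thesis using True assms by (simp add: pairs_within_def)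
next
  case False
  then have "{k \<in> insert x T. Suc k < K} = {k \<in> T. Suc k < K}" by auto
  then show ?thesis using False by (simp add: pairs_within_def)
qed

lemma pairs_within_remove:
  "x \<in> T \<Longrightarrow> pairs_within K (T - {x}) = pairs_within K T - of_bool (Suc x < K)"
  using pairs_within_insert[of x "T - {x}" K] by (simp add: insert_absorb)

lemma vacant_first_free:
  assumes "finite C"
  shows "vacant 0 K C = 0 \<longleftrightarrow> \<not> first_free C < K"
proof
  assume "vacant 0 K C = 0"
  then have "{0..<K} - C = {}" unfolding vacant_def by simp
  then show "\<not> first_free C < K" using first_free(1)[OF assms] by auto
next
  assume "\<not> first_free C < K"
  then have "{0..<K} - C = {}" using first_free(2)[OF assms] by (auto; fastforce)
  then show "vacant 0 K C = 0" unfolding vacant_def by simp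
qed

lemma vacant_pairs_insert_le: "vacant_pairs K (insert x C) \<le> vacant_pairs K C"
  unfolding vacant_pairs_def of_nat_le_iff
  by (rule card_mono) (auto intro: finite_subset[of _ "{..<K}"])

lemma vacant_pairs_insert:
  assumes "Suc x < K" "x \<notin> C" "Suc x \<notin> C"
  shows "vacant_pairs K (insert x C) \<le> vacant_pairs K C - 1"
proof -
  have fin: "finite {y. Suc y < K \<and> y \<notin> C \<and> Suc y \<notin> C}"
    by (rule finite_subset[of _ "{..<K}"]) auto
  have "card {y. Suc y < K \<and> y \<notin> insert x C \<and> Suc y \<notin> insert x C}
      < card {y. Suc y < K \<and> y \<notin> C \<and> Suc y \<notin> C}"
    by (rule psubset_card_mono[OF fin]) (use assms in auto)
  then show ?thesis unfolding vacant_pairs_def by linarith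
qed

lemma vacant_pairs_remove:
  "vacant_pairs K (C - {x}) \<le> vacant_pairs K C + of_bool (0 < x \<and> x - 1 \<notin> C \<and> x < K)
    + of_bool (Suc x < K \<and> Suc x \<notin> C)"
proof -
  let ?B = "{y. Suc y < K \<and> y \<notin> C \<and> Suc y \<notin> C}"
  let ?L = "if 0 < x \<and> x - 1 \<notin> C \<and> x < K then {x - 1} else {}"
  let ?R = "if Suc x < K \<and> Suc x \<notin> C then {x} else {}"
  have fin: "finite ?B" by (rule finite_subset[of _ "{..<K}"]) auto
  have "{y. Suc y < K \<and> y \<notin> C - {x} \<and> Suc y \<notin> C - {x}} \<subseteq> ?B \<union> ?L \<union> ?R" by auto
  then have "card {y. Suc y < K \<and> y \<notin> C - {x} \<and> Suc y \<notin> C - {x}} \<le> card (?B \<union> ?L \<union> ?R)"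
    using fin by (intro card_mono) auto
  also have "\<dots> \<le> card ?B + card ?L + card ?R"
    by (intro order_trans[OF card_Un_le] add_right_mono card_Un_le)
  also have "real (card ?B + card ?L + card ?R) = vacant_pairs K C
      + of_bool (0 < x \<and> x - 1 \<notin> C \<and> x < K) + of_bool (Suc x < K \<and> Suc x \<notin> C)"
    by (simp add: vacant_pairs_def)
  finally show ?thesis by (simp add: vacant_pairs_def)
qed

text \<open>A vacant cell has at most one item that starts just after it and at most one that ends
  just before it.\<close>

lemma sum_vacant_neighbours_le:
  assumes ok: "cells_ok S T"
  shows "(\<Sum>k\<in>S. of_bool (0 < k \<and> k - 1 \<notin> occ S T \<and> k < K))
    + (\<Sum>k\<in>T. of_bool (0 < k \<and> k - 1 \<notin> occ S T \<and> k < K)) \<le> V K S T"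
    and "(\<Sum>k\<in>S. of_bool (Suc k < K \<and> Suc k \<notin> occ S T))
    + (\<Sum>k\<in>T. of_bool (Suc (Suc k) < K \<and> Suc (Suc k) \<notin> occ S T)) \<le> V K S T"
proof -
  have fin: "finite S" "finite T" "S \<inter> T = {}" "S \<inter> Suc ` T = {}"
    using ok unfolding cells_ok_def by auto
  have "(\<Sum>k\<in>S. of_bool (0 < k \<and> k - 1 \<notin> occ S T \<and> k < K))
    + (\<Sum>k\<in>T. of_bool (0 < k \<and> k - 1 \<notin> occ S T \<and> k < K))
    = (\<Sum>k\<in>S \<union> T. of_bool (0 < k \<and> k - 1 \<notin> occ S T \<and> k < K) :: real)"
    by (rule sum.union_disjoint[symmetric]) (use fin in auto)
  also have "\<dots> = real (card ((S \<union> T) \<inter> {k. 0 < k \<and> k - 1 \<notin> occ S T \<and> k < K}))"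
    using fin by (simp add: sum_of_bool_eq)
  also have "\<dots> \<le> V K S T"
    unfolding vacant_def of_nat_le_iff
    by (rule card_inj_on_le[where f="\<lambda>k. k - 1"]) (auto simp: inj_on_def)
  finally show "(\<Sum>k\<in>S. of_bool (0 < k \<and> k - 1 \<notin> occ S T \<and> k < K))
    + (\<Sum>k\<in>T. of_bool (0 < k \<and> k - 1 \<notin> occ S T \<and> k < K)) \<le> V K S T" .
  have "(\<Sum>k\<in>S. of_bool (Suc k < K \<and> Suc k \<notin> occ S T))
    + (\<Sum>k\<in>T. of_bool (Suc (Suc k) < K \<and> Suc (Suc k) \<notin> occ S T))
    = (\<Sum>k\<in>S. of_bool (Suc k < K \<and> Suc k \<notin> occ S T))
    + (\<Sum>k\<in>Suc ` T. of_bool (Suc k < K \<and> Suc k \<notin> occ S T) :: real)"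
    by (simp add: sum.reindex)
  also have "\<dots> = (\<Sum>k\<in>S \<union> Suc ` T. of_bool (Suc k < K \<and> Suc k \<notin> occ S T))"
    by (rule sum.union_disjoint[symmetric]) (use fin in auto)
  also have "\<dots> = real (card ((S \<union> Suc ` T) \<inter> {k. Suc k < K \<and> Suc k \<notin> occ S T}))"
    using fin by (simp add: sum_of_bool_eq)
  also have "\<dots> \<le> V K S T"
    unfolding vacant_def of_nat_le_iff
    by (rule card_inj_on_le[where f=Suc]) auto
  finally show "(\<Sum>k\<in>S. of_bool (Suc k < K \<and> Suc k \<notin> occ S T))
    + (\<Sum>k\<in>T. of_bool (Suc (Suc k) < K \<and> Suc (Suc k) \<notin> occ S T)) \<le> V K S T" .
qed

lemma wide_first_gap_remove:
  assumes "finite C" "wide_first_gap K C" "K \<le> k"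
  shows "wide_first_gap K (C - {k})"
proof -
  have "first_free (C - {k}) = first_free C"
    by (rule first_free_eqI)
      (use assms first_free[OF assms(1)] in \<open>auto simp: wide_first_gap_def not_le[symmetric]\<close>)
  then show ?thesis using assms unfolding wide_first_gap_def by auto
qed

section \<open>Equilibrium expectations and the low region\<close>

locale stationary_cells =
  fixes a b :: real and \<nu> :: "(nat set \<times> nat set) pmf"
  assumes a_pos: "0 < a" and b_pos: "0 < b"
    and cells_ok: "\<And>s. s \<in> set_pmf \<nu> \<Longrightarrow> cells_ok (fst s) (snd s)"
    and integrable_generator: "\<And>F c. (\<And>S T. \<bar>F S T\<bar> \<le> c) \<Longrightarrow>
      integrable \<nu> (\<lambda>s. generator a b F (fst s) (snd s))"
    and expectation_generator: "\<And>F c. (\<And>S T. \<bar>F S T\<bar> \<le> c) \<Longrightarrow>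
      measure_pmf.expectation \<nu> (\<lambda>s. generator a b F (fst s) (snd s)) = 0"
begin

definition Ex :: "(nat set \<Rightarrow> nat set \<Rightarrow> real) \<Rightarrow> real" where
  "Ex G = measure_pmf.expectation \<nu> (\<lambda>s. G (fst s) (snd s))"

lemma bdd_integrable: "bdd G \<Longrightarrow> integrable \<nu> (\<lambda>s. G (fst s) (snd s))"
  unfolding bdd_def by (auto intro: integrable_pmf_bounded)

text \<open>Stationarity in the one-sided form used from here on: an upper bound on the drift of a
  well-chosen \<open>F\<close> becomes an inequality between expectations.\<close>

lemma drift:
  assumes F: "bdd F" and G: "bdd G"
    and le: "\<And>S T. cells_ok S T \<Longrightarrow> generator a b F S T \<le> G S T"
  shows "0 \<le> Ex G"
proof -
  obtain c where c: "\<And>S T. \<bar>F S T\<bar> \<le> c" using F unfolding bdd_def by auto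
  have "0 = measure_pmf.expectation \<nu> (\<lambda>s. generator a b F (fst s) (snd s))"
    using expectation_generator[OF c] by simp
  also have "\<dots> \<le> Ex G" unfolding Ex_def
    by (intro integral_mono_AE integrable_generator[OF c] bdd_integrable G AE_pmfI le cells_ok)
  finally show ?thesis .
qed

lemma Ex_mono:
  assumes "bdd F" "bdd G" "\<And>S T. cells_ok S T \<Longrightarrow> F S T \<le> G S T"
  shows "Ex F \<le> Ex G"
  unfolding Ex_def
  by (intro integral_mono_AE bdd_integrable assms AE_pmfI cells_ok)

lemma Ex_nonneg: "(\<And>S T. cells_ok S T \<Longrightarrow> 0 \<le> F S T) \<Longrightarrow> 0 \<le> Ex F"
  unfolding Ex_def by (intro integral_nonneg_AE AE_pmfI) (auto dest: cells_ok)

lemma Ex_add: "bdd F \<Longrightarrow> bdd G \<Longrightarrow> Ex (\<lambda>S T. F S T + G S T) = Ex F + Ex G"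
  unfolding Ex_def by (intro Bochner_Integration.integral_add bdd_integrable)

lemma Ex_diff: "bdd F \<Longrightarrow> bdd G \<Longrightarrow> Ex (\<lambda>S T. F S T - G S T) = Ex F - Ex G"
  unfolding Ex_def by (intro Bochner_Integration.integral_diff bdd_integrable)

lemma Ex_cmult [simp]: "Ex (\<lambda>S T. c * F S T) = c * Ex F"
  unfolding Ex_def by simp

lemma Ex_const [simp]: "Ex (\<lambda>S T. c) = c"
  unfolding Ex_def by simp

lemma Ex_sum: "(\<And>i. i \<in> I \<Longrightarrow> bdd (F i)) \<Longrightarrow> Ex (\<lambda>S T. \<Sum>i\<in>I. F i S T) = (\<Sum>i\<in>I. Ex (F i))"
  by (induction I rule: infinite_finite_induct) (auto simp: Ex_add bdd_sum)

lemma Ex_square_le: "bdd F \<Longrightarrow> (Ex F)\<^sup>2 \<le> Ex (\<lambda>S T. (F S T)\<^sup>2)"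
proof -
  assume F: "bdd F"
  have "0 \<le> Ex (\<lambda>S T. (F S T - Ex F)\<^sup>2)" by (rule Ex_nonneg) simp
  also have "(\<lambda>S T. (F S T - Ex F)\<^sup>2) = (\<lambda>S T. (F S T)\<^sup>2 - 2 * Ex F * F S T + (Ex F)\<^sup>2)"
    by (simp add: power2_diff fun_eq_iff)
  also have "Ex (\<lambda>S T. (F S T)\<^sup>2 - 2 * Ex F * F S T + (Ex F)\<^sup>2)
      = Ex (\<lambda>S T. (F S T)\<^sup>2) - 2 * Ex F * Ex F + (Ex F)\<^sup>2"
    by ((subst Ex_diff Ex_add; (intro bdds F)?)+) (simp only: Ex_cmult Ex_const)
  finally show ?thesis by (simp add: power2_eq_square)
qed

text \<open>As long as a cell below \<open>K\<close> is vacant, every arriving 1-item fills one, at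
  rate \<open>a\<close>, whereas departures free cells below \<open>K\<close> at rate at most
  \<open>K\<close>. For \<open>K < a\<close> the vacancy is thus pushed back to 0, and the square of
  \<open>V\<close> detects this.\<close>

lemma expectation_vacant:
  "2 * (a - real K) * Ex (V K) \<le> a + 2 * real K"
proof -
  have "0 \<le> Ex (\<lambda>S T. - (2 * (a - real K)) * V K S T + (a + 2 * real K))"
  proof (rule drift[where F="\<lambda>S T. (V K S T)\<^sup>2"])
    fix S T assume ok: "cells_ok S T"
    define v where "v = V K S T"
    note fin = finite_occ[OF ok]
    have v0: "0 \<le> v" "v \<le> real K" using vacant_bounds[of 0 K "occ S T"] by (auto simp: v_def)
    \<comment> \<open>The factor \<open>2 * v + 2\<close> per freed cell serves both kinds of
      departure: \<open>(v + 1)^2 - v^2 = 2 * v + 1\<close> for one cell and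
      \<open>(v + 2)^2 - v^2 = 2 * (2 * v + 2)\<close> for two.\<close>
    have "generator a b (\<lambda>S T. (V K S T)\<^sup>2) S T \<le> a * (1 - 2 * v) + b * 0
        + (\<Sum>k\<in>S. (2 * v + 2) * of_bool (0 \<le> k \<and> k < K))
        + (\<Sum>k\<in>T. (2 * v + 2) * (of_bool (0 \<le> k \<and> k < K) + of_bool (0 \<le> Suc k \<and> Suc k < K)))"
    proof (rule generator_le[OF ok])
      have eq: "V K (insert (first_free (occ S T)) S) T = v - of_bool (v \<noteq> 0)"
        using vacant_first_free[OF fin, of K] first_free(1)[OF fin]
        by (simp add: occ_insert vacant_insert v_def del: of_bool_eq_iff)
      show "(V K (insert (first_free (occ S T)) S) T)\<^sup>2 - (V K S T)\<^sup>2 \<le> 1 - 2 * v"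
        unfolding eq v_def[symmetric] by (cases "v = 0") (simp_all add: power2_eq_square algebra_simps)
      have "V K S (insert (first_pair (occ S T)) T) \<le> v"
        unfolding occ_insert v_def vacant_def by (auto intro!: card_mono)
      then show "(V K S (insert (first_pair (occ S T)) T))\<^sup>2 - (V K S T)\<^sup>2 \<le> 0"
        unfolding v_def[symmetric] using vacant_bounds(1) by (simp add: power_mono)
    next
      fix k assume k: "k \<in> S"
      show "(V K (S - {k}) T)\<^sup>2 - (V K S T)\<^sup>2 \<le> (2 * v + 2) * of_bool (0 \<le> k \<and> k < K)"
        using mem_occ(1)[OF k, of T] unfolding occ_remove(1)[OF ok k]
        by (simp add: vacant_remove v_def power2_eq_square algebra_simps)
    next
      fix k assume k: "k \<in> T"
      show "(V K S (T - {k}))\<^sup>2 - (V K S T)\<^sup>2 \<le>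
          (2 * v + 2) * (of_bool (0 \<le> k \<and> k < K) + of_bool (0 \<le> Suc k \<and> Suc k < K))"
        using mem_occ(2,3)[OF k, of S] unfolding occ_remove(2)[OF ok k]
        by (simp add: vacant_remove v_def power2_eq_square algebra_simps)
    qed (use a_pos b_pos in auto)
    also have "\<dots> = a * (1 - 2 * v) + (2 * v + 2) * (real K - v)"
      using sum_occupied_cells[OF ok, of 0 K]
      by (simp add: sum_distrib_left[symmetric] distrib_left[symmetric] v_def)
    also have "\<dots> \<le> - (2 * (a - real K)) * v + (a + 2 * real K)"
      using v0 mult_nonneg_nonneg[of v v] by (simp add: algebra_simps)
    finally show "generator a b (\<lambda>S T. (V K S T)\<^sup>2) S T
      \<le> - (2 * (a - real K)) * V K S T + (a + 2 * real K)" unfolding v_def .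
  qed (intro bdds)+
  also have "\<dots> = - (2 * (a - real K)) * Ex (V K) + (a + 2 * real K)"
    by (subst Ex_add; (intro bdds)?) (simp only: Ex_cmult Ex_const)
  finally show ?thesis by (simp add: algebra_simps)
qed

text \<open>A 2-item below \<open>K\<close> and the vacant pair that it leaves behind count alike in
  \<open>F\<close>, so arrivals of 2-items do not raise \<open>F\<close>, and departures raise it
  only through vacant cells adjacent to the freed ones, at total rate at most \<open>2 * V\<close>.
  A 1-item that enters a wide first gap destroys a vacant pair, which lowers \<open>F\<close> at
  rate \<open>a\<close>.\<close>

lemma expectation_wide_first_gap:
  "a * Ex (\<lambda>S T. of_bool (wide_first_gap K (occ S T))) \<le> 2 * Ex (V K)"
proof -
  have "0 \<le> Ex (\<lambda>S T. - a * of_bool (wide_first_gap K (occ S T)) + 2 * V K S T)"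
  proof (rule drift[where F="\<lambda>S T. pairs_within K T + vacant_pairs K (occ S T)"])
    fix S T assume ok: "cells_ok S T"
    note fin = finite_occ[OF ok]
    let ?l = "\<lambda>k. of_bool (0 < k \<and> k - 1 \<notin> occ S T \<and> k < K) :: real"
    let ?r = "\<lambda>k. of_bool (k < K \<and> k \<notin> occ S T) :: real"
    have "generator a b (\<lambda>S T. pairs_within K T + vacant_pairs K (occ S T)) S T
      \<le> a * (- of_bool (wide_first_gap K (occ S T))) + b * 0 +
        (\<Sum>k\<in>S. ?l k + ?r (Suc k)) + (\<Sum>k\<in>T. ?l k + ?r (Suc (Suc k)))"
    proof (rule generator_le[OF ok])
      have "vacant_pairs K (insert (first_free (occ S T)) (occ S T))
          \<le> vacant_pairs K (occ S T) - of_bool (wide_first_gap K (occ S T))"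
        using vacant_pairs_insert[of "first_free (occ S T)" K "occ S T"] first_free(1)[OF fin]
          vacant_pairs_insert_le[of K "first_free (occ S T)" "occ S T"]
        by (cases "wide_first_gap K (occ S T)") (auto simp: wide_first_gap_def)
      then show "pairs_within K T + vacant_pairs K (occ (insert (first_free (occ S T)) S) T)
          - (pairs_within K T + vacant_pairs K (occ S T)) \<le> - of_bool (wide_first_gap K (occ S T))"
        by (simp add: occ_insert)
    next
      let ?x = "first_pair (occ S T)"
      have "?x \<notin> T" using first_pair(1)[OF fin] mem_occ(2) by blast
      moreover have "vacant_pairs K (insert ?x (insert (Suc ?x) (occ S T)))
          \<le> vacant_pairs K (occ S T) - of_bool (Suc ?x < K)"
        using vacant_pairs_insert[of ?x K "occ S T"] first_pair(1,2)[OF fin]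
          vacant_pairs_insert_le[of K "Suc ?x" "insert ?x (occ S T)"]
          vacant_pairs_insert_le[of K "?x" "occ S T"]
        unfolding insert_commute[of ?x]
        by (cases "Suc ?x < K") simp_all
      ultimately show "pairs_within K (insert ?x T) + vacant_pairs K (occ S (insert ?x T))
          - (pairs_within K T + vacant_pairs K (occ S T)) \<le> 0"
        by (simp add: occ_insert pairs_within_insert)
    next
      fix k assume k: "k \<in> S"
      show "pairs_within K T + vacant_pairs K (occ (S - {k}) T)
          - (pairs_within K T + vacant_pairs K (occ S T)) \<le> ?l k + ?r (Suc k)"
        using vacant_pairs_remove[of K "occ S T" k] by (simp add: occ_remove[OF ok] k)
    next
      fix k assume k: "k \<in> T"
      \<comment> \<open>The summand \<open>of_bool (Suc k < K)\<close> is the pair formed by the two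
        freed cells; the decrease of \<open>pairs_within\<close> compensates it.\<close>
      have "vacant_pairs K (occ S T - {k} - {Suc k}) \<le> vacant_pairs K (occ S T)
          + of_bool (Suc k < K) + ?l k + ?r (Suc (Suc k))"
        using vacant_pairs_remove[of K "occ S T" k] vacant_pairs_remove[of K "occ S T - {k}" "Suc k"]
          mem_occ(3)[OF k, of S] by (auto split: if_splits simp: of_bool_def)
      then show "pairs_within K (T - {k}) + vacant_pairs K (occ S (T - {k}))
          - (pairs_within K T + vacant_pairs K (occ S T)) \<le> ?l k + ?r (Suc (Suc k))"
        by (simp add: occ_remove[OF ok] k pairs_within_remove)
    qed (use a_pos b_pos in auto)
    also have "\<dots> \<le> - a * of_bool (wide_first_gap K (occ S T)) + 2 * V K S T"
      using sum_vacant_neighbours_le[OF ok, of K] by (simp add: sum.distrib)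
    finally show "generator a b (\<lambda>S T. pairs_within K T + vacant_pairs K (occ S T)) S T
      \<le> - a * of_bool (wide_first_gap K (occ S T)) + 2 * V K S T" .
  qed (intro bdds)+
  also have "\<dots> = - a * Ex (\<lambda>S T. of_bool (wide_first_gap K (occ S T))) + 2 * Ex (V K)"
    by (subst Ex_add; (intro bdds)?) (simp only: Ex_cmult Ex_const)
  finally show ?thesis by simp
qed

text \<open>Balance for the event that the first gap is wide. If no cell below \<open>K\<close> is
  vacant, the departure of any 2-item below \<open>K\<close> creates the event; it ends only through
  an arrival or through a departure that frees a cell below \<open>K\<close>, at total rate at most
  \<open>a + b + K\<close>.\<close>

lemma expectation_pairs_full:
  "Ex (\<lambda>S T. pairs_within K T * of_bool (V K S T = 0))
    \<le> (a + b + real K) * Ex (\<lambda>S T. of_bool (wide_first_gap K (occ S T)))"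
proof -
  let ?w = "\<lambda>S T. of_bool (wide_first_gap K (occ S T)) :: real"
  have "0 \<le> Ex (\<lambda>S T. (a + b + real K) * ?w S T - pairs_within K T * of_bool (V K S T = 0))"
  proof (rule drift[where F="\<lambda>S T. - ?w S T"])
    fix S T assume ok: "cells_ok S T"
    note fin = finite_occ[OF ok]
    define z :: real where "z = of_bool (V K S T = 0)"
    have "generator a b (\<lambda>S T. - ?w S T) S T
      \<le> a * ?w S T + b * ?w S T + (\<Sum>k\<in>S. ?w S T * of_bool (0 \<le> k \<and> k < K))
        + (\<Sum>k\<in>T. ?w S T * (of_bool (0 \<le> k \<and> k < K) + of_bool (0 \<le> Suc k \<and> Suc k < K))
             - z * of_bool (Suc k < K))"
    proof (rule generator_le[OF ok])
      fix k assume k: "k \<in> S"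
      show "- ?w (S - {k}) T - - ?w S T \<le> ?w S T * of_bool (0 \<le> k \<and> k < K)"
        using wide_first_gap_remove[OF fin, of K k] by (auto simp: occ_remove[OF ok] k)
    next
      fix k assume k: "k \<in> T"
      show "- ?w S (T - {k}) - - ?w S T \<le>
        ?w S T * (of_bool (0 \<le> k \<and> k < K) + of_bool (0 \<le> Suc k \<and> Suc k < K)) - z * of_bool (Suc k < K)"
      proof (cases "V K S T = 0 \<and> Suc k < K")
        case True
        then have "K \<le> first_free (occ S T)" using vacant_first_free[OF fin] by auto
        then have full: "j \<in> occ S T" if "j < K" for j using first_free(2)[OF fin] that by force
        then have "first_free (occ S (T - {k})) = k"
          using True by (intro first_free_eqI) (auto simp: occ_remove[OF ok] k)
        then have "wide_first_gap K (occ S (T - {k}))"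
          using True by (simp add: wide_first_gap_def occ_remove[OF ok] k)
        moreover have "\<not> wide_first_gap K (occ S T)"
          using \<open>K \<le> first_free (occ S T)\<close> by (simp add: wide_first_gap_def)
        ultimately show ?thesis using True by (simp add: z_def)
      next
        case False
        have "wide_first_gap K (occ S T) \<Longrightarrow> K \<le> k \<Longrightarrow> wide_first_gap K (occ S (T - {k}))"
          using wide_first_gap_remove[of "occ S T - {k}" K "Suc k"] wide_first_gap_remove[OF fin, of K k] fin
          by (simp add: occ_remove[OF ok] k)
        then show ?thesis using False by (auto simp: z_def)
      qed
    qed (use a_pos b_pos in auto)
    also have "\<dots> = a * ?w S T + b * ?w S T + ?w S T * (real K - V K S T) - z * pairs_within K T"
    proof -
      have "finite T" using ok by (simp add: cells_ok_def)
      then have "(\<Sum>k\<in>T. of_bool (Suc k < K)) = pairs_within K T"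
        by (simp add: pairs_within_def sum_of_bool_eq Collect_conj_eq)
      then show ?thesis
        using sum_occupied_cells[OF ok, of 0 K]
        by (simp add: sum_distrib_left[symmetric] distrib_left[symmetric] sum_subtractf)
    qed
    also have "\<dots> \<le> (a + b + real K) * ?w S T - pairs_within K T * of_bool (V K S T = 0)"
      using vacant_bounds(1)[of 0 K "occ S T"] by (simp add: z_def algebra_simps)
    finally show "generator a b (\<lambda>S T. - ?w S T) S T
      \<le> (a + b + real K) * ?w S T - pairs_within K T * of_bool (V K S T = 0)" .
  qed (intro bdds)+
  also have "\<dots> = (a + b + real K) * Ex ?w - Ex (\<lambda>S T. pairs_within K T * of_bool (V K S T = 0))"
    by (subst Ex_diff; (intro bdds)?) (simp only: Ex_cmult Ex_const)
  finally show ?thesis by simp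
qed

text \<open>The product of the number of 2-items and the vacancy removes the restriction to
  \<open>V = 0\<close>. A 1-item lowers the product by the number of 2-items except when
  \<open>V = 0\<close>, and departures raise it at rate at most \<open>K\<close> times that
  number.\<close>

lemma expectation_pairs_within:
  "(a - real K) * Ex (\<lambda>S T. pairs_within K T)
    \<le> a * Ex (\<lambda>S T. pairs_within K T * of_bool (V K S T = 0)) + b * Ex (V K)"
proof -
  have "0 \<le> Ex (\<lambda>S T. - (a - real K) * pairs_within K T
      + (a * (pairs_within K T * of_bool (V K S T = 0)) + b * V K S T))"
  proof (rule drift[where F="\<lambda>S T. pairs_within K T * V K S T"])
    fix S T assume ok: "cells_ok S T"
    note fin = finite_occ[OF ok]
    define N where "N = pairs_within K T"
    define v where "v = V K S T"
    have v0: "0 \<le> v" unfolding v_def by (rule vacant_bounds)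
    have N0: "0 \<le> N" unfolding N_def by (rule pairs_within_bounds)
    have "generator a b (\<lambda>S T. pairs_within K T * V K S T) S T
      \<le> a * (- N + N * of_bool (v = 0)) + b * v + (\<Sum>k\<in>S. N * of_bool (0 \<le> k \<and> k < K))
        + (\<Sum>k\<in>T. N * (of_bool (0 \<le> k \<and> k < K) + of_bool (0 \<le> Suc k \<and> Suc k < K)))"
    proof (rule generator_le[OF ok])
      have eq: "V K (insert (first_free (occ S T)) S) T = v - of_bool (v \<noteq> 0)"
        using vacant_first_free[OF fin, of K] first_free(1)[OF fin]
        by (simp add: occ_insert vacant_insert v_def del: of_bool_eq_iff)
      show "pairs_within K T * V K (insert (first_free (occ S T)) S) T
          - pairs_within K T * V K S T \<le> - N + N * of_bool (v = 0)"
        unfolding eq N_def[symmetric] v_def[symmetric] by (cases "v = 0") (simp_all add: algebra_simps)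
    next
      let ?x = "first_pair (occ S T)"
      have x: "?x \<notin> T" using first_pair(1)[OF fin] mem_occ(2) by blast
      have eq: "V K S (insert ?x T) = v - of_bool (?x < K) - of_bool (Suc ?x < K)"
        using first_pair(1,2)[OF fin] by (simp add: vacant_insert v_def occ_insert)
      show "pairs_within K (insert ?x T) * V K S (insert ?x T)
          - pairs_within K T * V K S T \<le> v"
        unfolding eq pairs_within_insert[OF x] N_def[symmetric] v_def[symmetric] using v0 N0
        by (cases "Suc ?x < K"; cases "?x < K") (simp_all add: algebra_simps)
    next
      fix k assume k: "k \<in> S"
      show "pairs_within K T * V K (S - {k}) T - pairs_within K T * V K S T
          \<le> N * of_bool (0 \<le> k \<and> k < K)"
        using mem_occ(1)[OF k, of T]
        by (simp add: occ_remove[OF ok] k vacant_remove N_def algebra_simps)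
    next
      fix k assume k: "k \<in> T"
      have "V K S (T - {k}) = v + of_bool (k < K) + of_bool (Suc k < K)"
        using mem_occ(2,3)[OF k, of S] by (simp add: occ_remove[OF ok] k vacant_remove v_def)
      then show "pairs_within K (T - {k}) * V K S (T - {k}) - pairs_within K T * V K S T
          \<le> N * (of_bool (0 \<le> k \<and> k < K) + of_bool (0 \<le> Suc k \<and> Suc k < K))"
        unfolding N_def[symmetric] v_def[symmetric] using v0 N0
        by (cases "Suc k < K"; cases "k < K")
          (simp_all add: k pairs_within_remove N_def[symmetric] algebra_simps)
    qed (use a_pos b_pos in auto)
    also have "\<dots> = a * (- N + N * of_bool (v = 0)) + b * v + N * (real K - v)"
      using sum_occupied_cells[OF ok, of 0 K]
      by (simp add: sum_distrib_left[symmetric] distrib_left[symmetric] v_def)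
    also have "\<dots> \<le> - (a - real K) * N + (a * (N * of_bool (v = 0)) + b * v)"
      using mult_nonneg_nonneg[OF N0 v0] by (simp add: algebra_simps)
    finally show "generator a b (\<lambda>S T. pairs_within K T * V K S T) S T
      \<le> - (a - real K) * pairs_within K T
        + (a * (pairs_within K T * of_bool (V K S T = 0)) + b * V K S T)"
      unfolding N_def v_def .
  qed (intro bdds)+
  also have "\<dots> = - (a - real K) * Ex (\<lambda>S T. pairs_within K T)
      + (a * Ex (\<lambda>S T. pairs_within K T * of_bool (V K S T = 0)) + b * Ex (V K))"
    by (subst Ex_add; (intro bdds)?)+ (simp only: Ex_cmult Ex_const)
  finally show ?thesis by (simp add: algebra_simps)
qed

text \<open>If \<open>a - K\<close> is of order \<open>a + b\<close>, this converts a bounded mean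
  vacancy into a bounded mean number of 2-items.\<close>

lemma expectation_pairs_within_le:
  "(a - real K) * Ex (\<lambda>S T. pairs_within K T) \<le> (2 * (a + b + real K) + b) * Ex (V K)"
proof -
  have "a * Ex (\<lambda>S T. pairs_within K T * of_bool (V K S T = 0))
     \<le> a * ((a + b + real K) * Ex (\<lambda>S T. of_bool (wide_first_gap K (occ S T))))"
    using expectation_pairs_full a_pos by (intro mult_left_mono) auto
  also have "\<dots> \<le> (a + b + real K) * (2 * Ex (V K))"
    using mult_left_mono[OF expectation_wide_first_gap, of "a + b + real K" K] a_pos b_pos
    by (simp add: mult_ac)
  finally show ?thesis
    using expectation_pairs_within[of K] by (simp add: algebra_simps)
qed

end

section \<open>Marks\<close>

text \<open>\<open>odd_gap J C y\<close> holds if the run of vacant cells that ends just before \<open>y\<close>, cut off at \<open>J\<close>, has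
  odd length.\<close>

primrec odd_gap :: "nat \<Rightarrow> nat set \<Rightarrow> nat \<Rightarrow> bool" where
  "odd_gap J C 0 = False"
| "odd_gap J C (Suc y) = (J \<le> y \<and> y \<notin> C \<and> \<not> odd_gap J C y)"

definition marks :: "nat \<Rightarrow> nat \<Rightarrow> nat set \<Rightarrow> nat set" where
  "marks J K C = {y \<in> {J..<K}. y \<in> C \<and> odd_gap J C y}"

text \<open>A set with at most one element, empty if no occupied cell follows; moving a mark and
  cancelling it then become one symmetric difference.\<close>

definition next_cell :: "nat set \<Rightarrow> nat \<Rightarrow> nat set" where
  "next_cell C k = {y \<in> C. k \<le> y \<and> (\<forall>z\<in>C. k \<le> z \<longrightarrow> y \<le> z)}"

lemma next_cell_unique: "y \<in> next_cell C k \<Longrightarrow> z \<in> next_cell C k \<Longrightarrow> y = z"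
  by (auto simp: next_cell_def intro: antisym)

lemma card_next_cell: "finite (next_cell C k)" "card (next_cell C k) \<le> 1"
proof -
  have "next_cell C k = {} \<or> (\<exists>y. next_cell C k = {y})" using next_cell_unique[of _ C k] by blast
  then show "finite (next_cell C k)" "card (next_cell C k) \<le> 1" by auto
qed

lemma next_cell_eq: "k \<in> C \<Longrightarrow> next_cell C k = {k}"
  by (auto simp: next_cell_def intro: antisym)

lemma finite_marks [simp, intro]: "finite (marks J K C)"
  by (simp add: marks_def)

lemma odd_gap_after: "y \<in> C \<Longrightarrow> \<not> odd_gap J C (Suc y)"
  by simp

lemma odd_gap_cong: "(\<And>z. J \<le> z \<Longrightarrow> z < y \<Longrightarrow> z \<in> C \<longleftrightarrow> z \<in> D) \<Longrightarrow> odd_gap J C y = odd_gap J D y"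
  by (induction y) auto

lemma marks_cong: "(\<And>z. J \<le> z \<Longrightarrow> z < K \<Longrightarrow> z \<in> C \<longleftrightarrow> z \<in> D) \<Longrightarrow> marks J K C = marks J K D"
  using odd_gap_cong[of J _ C D] by (auto simp: marks_def)

lemma odd_gap_insert_eq:
  assumes "z \<in> C" "x < z" "z < y"
  shows "odd_gap J (insert x C) y = odd_gap J C y"
  using assms(3)
proof (induction y)
  case (Suc y)
  then show ?case using assms(1,2) by (cases "z = y") auto
qed simp

text \<open>Gap parity restarts at every occupied cell, so the effect of the new cell ends at the
  next occupied one.\<close>

lemma marks_insert_diff:
  shows "sym_diff (marks J K (insert x C)) (marks J K C) \<subseteq> insert x (next_cell C (Suc x))"
proof
  fix y assume y: "y \<in> sym_diff (marks J K (insert x C)) (marks J K C)"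
  show "y \<in> insert x (next_cell C (Suc x))"
  proof (cases "y = x")
    case False
    then have "odd_gap J (insert x C) y \<noteq> odd_gap J C y" and C: "y \<in> C"
      using y by (auto simp: marks_def)
    then have "\<not> z < y" if "z \<in> C" "x < z" for z using odd_gap_insert_eq[of z C x y J] that by auto
    moreover have "x < y"
      using \<open>odd_gap J (insert x C) y \<noteq> odd_gap J C y\<close> odd_gap_cong[of J y "insert x C" C] by fastforce
    ultimately show ?thesis using C by (auto simp: next_cell_def Suc_le_eq not_less)
  qed simp
qed

lemma card_marks_insert_diff:
  "card (sym_diff (marks J K (insert x C)) (marks J K C)) \<le> 2 * of_bool (J \<le> x \<and> x < K)"
proof (cases "J \<le> x \<and> x < K")
  case True
  have "card (sym_diff (marks J K (insert x C)) (marks J K C)) \<le> card (insert x (next_cell C (Suc x)))"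
    by (rule card_mono[OF _ marks_insert_diff]) (simp add: card_next_cell)
  also have "\<dots> \<le> 2"
    using card_next_cell[of C "Suc x"] by (simp add: card_insert_if)
  finally show ?thesis using True by simp
next
  case False
  then have "marks J K (insert x C) = marks J K C" by (intro marks_cong) auto
  with False show ?thesis by auto
qed

lemma odd_gap_insert_pair:
  assumes "J \<le> x" "x \<notin> C" "Suc x \<notin> C" "\<not> odd_gap J C x" "Suc (Suc x) \<le> y"
  shows "odd_gap J (insert x (insert (Suc x) C)) y = odd_gap J C y"
  using assms(5)
proof (induction y rule: dec_induct)
  case base
  show ?case using assms by simp
qed auto

text \<open>The part of the gap in front of the new item is even, so the item receives no mark; the
  part behind it is shorter than the old gap by an even number and keeps its parity.\<close>

lemma marks_insert_pair:
  assumes "J \<le> x" "x \<notin> C" "Suc x \<notin> C" "\<not> odd_gap J C x"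
  shows "marks J K (insert x (insert (Suc x) C)) = marks J K C"
proof -
  let ?D = "insert x (insert (Suc x) C)"
  have "odd_gap J ?D y = odd_gap J C y" if "y \<in> C" for y
  proof (cases "y < x")
    case True
    then show ?thesis by (intro odd_gap_cong) auto
  next
    case False
    with assms that have "Suc (Suc x) \<le> y" by (metis Suc_leI le_neq_implies_less not_le)
    then show ?thesis by (rule odd_gap_insert_pair[OF assms])
  qed
  moreover have "\<not> odd_gap J ?D x" using assms(4) odd_gap_cong[of J x ?D C] by auto
  ultimately show ?thesis by (auto simp: marks_def)
qed

text \<open>The new gap consists of the odd one in front, the two freed cells and the one behind.
  Hence the parity flips from \<open>k + 2\<close> on, up to and including the next occupied cell,
  where the count starts afresh.\<close>

lemma odd_gap_remove_pair:
  assumes "J \<le> k" "k \<in> C" "Suc k \<in> C" "odd_gap J C k" "Suc (Suc k) \<le> y"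
  shows "odd_gap J (C - {k} - {Suc k}) y \<longleftrightarrow>
    (odd_gap J C y \<noteq> (\<forall>z\<in>C. Suc (Suc k) \<le> z \<longrightarrow> y \<le> z))"
  using assms(5)
proof (induction y rule: dec_induct)
  case base
  have "odd_gap J (C - {k} - {Suc k}) k" using assms(4) odd_gap_cong[of J k "C - {k} - {Suc k}" C] by auto
  then show ?case using assms by simp
next
  case (step y)
  have "(\<forall>z\<in>C. Suc (Suc k) \<le> z \<longrightarrow> Suc y \<le> z) \<longleftrightarrow> (\<forall>z\<in>C. Suc (Suc k) \<le> z \<longrightarrow> y \<le> z) \<and> y \<notin> C"
    using step(1) by (auto simp: Suc_le_eq le_neq_implies_less intro: le_neq_implies_less)
  moreover have "y \<noteq> k" "y \<noteq> Suc k" "J \<le> y" using step(1) assms(1) by auto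
  ultimately show ?case using step(3) by auto
qed

text \<open>Only the next occupied cell sees the flipped parity: it receives the mark of
  \<open>k\<close>, or loses its own. A mark that would move beyond \<open>K\<close>
  disappears.\<close>

lemma marks_remove_pair:
  assumes "J \<le> k" "k \<in> C" "Suc k \<in> C" "odd_gap J C k"
  shows "marks J K (C - {k} - {Suc k})
    = sym_diff (marks J K C - {k}) (next_cell C (Suc (Suc k)) \<inter> {..<K})"
proof -
  let ?D = "C - {k} - {Suc k}"
  have lt: "odd_gap J ?D y = odd_gap J C y" if "y < k" for y
    using that by (intro odd_gap_cong) auto
  show ?thesis
  proof (intro equalityI subsetI)
    fix y assume y: "y \<in> marks J K ?D"
    then have "y < k \<or> Suc (Suc k) \<le> y" by (auto simp: marks_def)
    then show "y \<in> sym_diff (marks J K C - {k}) (next_cell C (Suc (Suc k)) \<inter> {..<K})"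
    proof
      assume "y < k"
      with y lt show ?thesis by (auto simp: marks_def next_cell_def)
    next
      assume "Suc (Suc k) \<le> y"
      with y odd_gap_remove_pair[OF assms this] show ?thesis by (auto simp: marks_def next_cell_def)
    qed
  next
    fix y assume y: "y \<in> sym_diff (marks J K C - {k}) (next_cell C (Suc (Suc k)) \<inter> {..<K})"
    then have "y \<noteq> k" by (auto simp: next_cell_def)
    moreover have "y \<noteq> Suc k" using y assms(2) by (auto simp: next_cell_def marks_def)
    ultimately have "y < k \<or> Suc (Suc k) \<le> y" by linarith
    then show "y \<in> marks J K ?D"
    proof
      assume "y < k"
      with y lt show ?thesis by (auto simp: marks_def next_cell_def)
    next
      assume "Suc (Suc k) \<le> y"
      with y odd_gap_remove_pair[OF assms this] assms(1) show ?thesis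
        by (auto simp: marks_def next_cell_def)
    qed
  qed
qed

lemma marks_remove_pair_even:
  assumes "J \<le> k" "k \<in> C" "Suc k \<in> C" "\<not> odd_gap J C k"
  shows "marks J K (C - {k} - {Suc k}) = marks J K C"
proof -
  have "\<not> odd_gap J (C - {k} - {Suc k}) k"
    using assms(4) odd_gap_cong[of J k "C - {k} - {Suc k}" C] by auto
  from marks_insert_pair[OF assms(1) _ _ this, of K] show ?thesis
    using assms(2,3) by (auto simp: insert_absorb insert_Diff_if insert_commute)
qed

lemma not_odd_gap_first_pair:
  assumes "finite C"
  shows "\<not> odd_gap J C (first_pair C)"
  using first_pair_left[OF assms] by (cases "first_pair C") auto

lemma card_sym_diff_bound:
  assumes "finite A" "finite B"
  shows "\<bar>real (card A) - real (card B)\<bar> \<le> real (card (sym_diff A B))"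
proof -
  have "card A \<le> card (B \<union> sym_diff A B)" "card B \<le> card (A \<union> sym_diff A B)"
    using assms by (auto intro!: card_mono)
  moreover have "card (B \<union> sym_diff A B) \<le> card B + card (sym_diff A B)"
     "card (A \<union> sym_diff A B) \<le> card A + card (sym_diff A B)"
    by (rule card_Un_le)+
  ultimately show ?thesis by linarith
qed

lemma card_marks_remove_pair:
  assumes "J \<le> k" "k < K" "k \<in> C" "Suc k \<in> C"
  shows "card (marks J K (C - {k} - {Suc k})) \<le> card (marks J K C)"
    and "card (marks J K C) \<le> card (marks J K (C - {k} - {Suc k})) + 2"
proof -
  have "card (marks J K (C - {k} - {Suc k})) \<le> card (marks J K C)
    \<and> card (marks J K C) \<le> card (marks J K (C - {k} - {Suc k})) + 2"
  proof (cases "odd_gap J C k")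
    case True
    define M N where "M = marks J K C" and "N = next_cell C (Suc (Suc k)) \<inter> {..<K}"
    have k: "k \<in> M" using True assms by (simp add: M_def marks_def)
    have N: "finite N" "card N \<le> 1"
      using card_next_cell[of C "Suc (Suc k)"] card_mono[of "next_cell C (Suc (Suc k))" N]
      by (auto simp: N_def)
    have M: "finite M" by (simp add: M_def)
    have cM: "card M = Suc (card (M - {k}))" by (rule card.remove[OF M k])
    have "card (sym_diff (M - {k}) N) \<le> card (M - {k} \<union> N)" "card (M - {k}) \<le> card (sym_diff (M - {k}) N \<union> N)"
      using M N by (auto intro!: card_mono)
    then have "card (sym_diff (M - {k}) N) \<le> card (M - {k}) + card N"
      "card (M - {k}) \<le> card (sym_diff (M - {k}) N) + card N"
      using card_Un_le order_trans by blast+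
    then show ?thesis
      unfolding marks_remove_pair[OF assms(1,3,4) True] M_def[symmetric] N_def[symmetric]
      using cM N by linarith
  next
    case False
    then show ?thesis using marks_remove_pair_even[OF assms(1,3,4)] by simp
  qed
  then show "card (marks J K (C - {k} - {Suc k})) \<le> card (marks J K C)"
    and "card (marks J K C) \<le> card (marks J K (C - {k} - {Suc k})) + 2" by auto
qed

text \<open>The gap behind the departing item is the single cell \<open>k + 2\<close>, and the item
  at \<open>k + 3\<close> is marked because of it; the arriving mark cancels that one.\<close>

lemma card_marks_annihilate:
  assumes "J \<le> k" "k < K" "k \<in> C" "Suc k \<in> C" "odd_gap J C k"
    and "Suc (Suc k) \<notin> C" "Suc (Suc (Suc k)) \<in> marks J K C"
  shows "card (marks J K (C - {k} - {Suc k})) < card (marks J K C)"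
proof -
  have "next_cell C (Suc (Suc k)) = {Suc (Suc (Suc k))}"
  proof (intro equalityI subsetI)
    fix y assume "y \<in> next_cell C (Suc (Suc k))"
    then have "Suc (Suc k) \<le> y" "y \<in> C" "y \<le> Suc (Suc (Suc k))"
      using assms(7) by (auto simp: next_cell_def marks_def)
    then show "y \<in> {Suc (Suc (Suc k))}" using assms(6) by (auto simp: le_Suc_eq)
  next
    have "z \<noteq> Suc (Suc k)" if "z \<in> C" for z using assms(6) that by auto
    then show "\<And>y. y \<in> {Suc (Suc (Suc k))} \<Longrightarrow> y \<in> next_cell C (Suc (Suc k))"
      using assms(7) by (auto simp: next_cell_def marks_def Suc_le_eq intro: le_neq_implies_less)
  qed
  then have "marks J K (C - {k} - {Suc k})
      = sym_diff (marks J K C - {k}) ({Suc (Suc (Suc k))} \<inter> {..<K})"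
    using marks_remove_pair[OF assms(1,3-5), of K] by (simp only:)
  moreover have "sym_diff (M - {k}) ({Suc (Suc (Suc k))} \<inter> I) \<subseteq> M - {k}"
    if "Suc (Suc (Suc k)) \<in> M" for M I using that by auto
  ultimately have "marks J K (C - {k} - {Suc k}) \<subseteq> marks J K C - {k}"
    using assms(7) by (simp only:)
  moreover have "k \<in> marks J K C" using assms(1-5) by (simp add: marks_def)
  ultimately have "marks J K (C - {k} - {Suc k}) \<subset> marks J K C" by blast
  then show ?thesis by (rule psubset_card_mono[OF finite_marks])
qed

text \<open>The regular case, a jump of the mark by exactly two cells. Cells directly behind an
  occupied cell carry no mark, which gives the side conditions of
  \<open>close_pairs_shift\<close>.\<close>

lemma marks_shift:
  assumes "J \<le> k" "k \<in> C" "Suc k \<in> C" "odd_gap J C k" "Suc (Suc k) \<in> C" "Suc (Suc k) < K"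
  shows "marks J K (C - {k} - {Suc k}) = insert (Suc (Suc k)) (marks J K C - {k})"
    and "Suc (Suc k) \<notin> marks J K C" "Suc k \<notin> marks J K C"
proof -
  show *: "Suc (Suc k) \<notin> marks J K C" "Suc k \<notin> marks J K C"
    using assms(2,3) by (auto simp: marks_def)
  show "marks J K (C - {k} - {Suc k}) = insert (Suc (Suc k)) (marks J K C - {k})"
    unfolding marks_remove_pair[OF assms(1-4)] next_cell_eq[OF assms(5)]
    using assms(6) * by auto
qed

section \<open>Slack: vacancy not explained by parity\<close>

definition slack :: "nat \<Rightarrow> nat \<Rightarrow> nat set \<Rightarrow> real" where
  "slack J K C = vacant J K C - real (card (marks J K C))"

text \<open>Each mark is preceded by its own vacant cell, the last one of an odd gap. Subtracting
  the marks therefore leaves an even number of cells for each gap that is followed by an occupied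
  cell below \<open>K\<close>, and these cells can hold 2-items.\<close>

lemma slack_eq: "slack J K C = real (card {v \<in> {J..<K} - C. Suc v \<notin> marks J K C})"
proof -
  have "Suc ` {v \<in> {J..<K} - C. Suc v \<in> marks J K C} = marks J K C"
  proof (intro equalityI subsetI)
    fix y assume y: "y \<in> marks J K C"
    then obtain v where v: "y = Suc v" by (cases y) (auto simp: marks_def)
    with y have "v \<in> {J..<K} - C" by (auto simp: marks_def)
    with y v show "y \<in> Suc ` {v \<in> {J..<K} - C. Suc v \<in> marks J K C}" by auto
  qed auto
  then have m: "card {v \<in> {J..<K} - C. Suc v \<in> marks J K C} = card (marks J K C)"
    by (metis card_image inj_Suc inj_on_subset subset_UNIV)
  have "card ({J..<K} - C) = card {v \<in> {J..<K} - C. Suc v \<in> marks J K C}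
      + card {v \<in> {J..<K} - C. Suc v \<notin> marks J K C}"
    by (subst card_Un_disjoint[symmetric]) (auto intro: arg_cong[of _ _ card])
  then show ?thesis unfolding slack_def vacant_def m by simp
qed

lemma slack_bounds: "0 \<le> slack J K C" "slack J K C \<le> vacant J K C" "slack J K C \<le> real K"
proof -
  show "0 \<le> slack J K C" by (simp add: slack_eq)
  show "slack J K C \<le> vacant J K C" by (simp add: slack_def)
  with vacant_bounds(2)[of J K C] show "slack J K C \<le> real K" by linarith
qed

text \<open>If all gaps have length one, then all but possibly the last of them is followed by a mark.\<close>

lemma slack_le_1:
  assumes "finite C" "K \<le> Suc (first_pair C)"
  shows "slack J K C \<le> 1"
proof -
  have "{v \<in> {J..<K} - C. Suc v \<notin> marks J K C} \<subseteq> {K - 1}"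
  proof
    fix v assume v: "v \<in> {v \<in> {J..<K} - C. Suc v \<notin> marks J K C}"
    have no: "Suc y \<in> C" if "y \<notin> C" "Suc y < K" for y
      using first_pair(3)[OF assms(1) that(1)] that assms(2) by fastforce
    show "v \<in> {K - 1}"
    proof (rule ccontr)
      assume "v \<notin> {K - 1}"
      then have vK: "Suc v < K" using v by auto
      then have "Suc v \<in> C" using v no by auto
      moreover have "\<not> odd_gap J C v"
      proof (cases v)
        case (Suc u)
        show ?thesis
        proof
          assume "odd_gap J C v"
          then have "u \<notin> C" using Suc by simp
          from no[OF this] Suc vK v show False by auto
        qed
      qed simp
      ultimately have "Suc v \<in> marks J K C" using v vK by (auto simp: marks_def)
      with v show False by auto
    qed
  qed
  then have "card {v \<in> {J..<K} - C. Suc v \<notin> marks J K C} \<le> card {K - 1}"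
    by (intro card_mono) auto
  then show ?thesis by (simp add: slack_eq)
qed

section \<open>Pairs of marks at a given or bounded distance\<close>

definition pair_count :: "nat \<Rightarrow> nat set \<Rightarrow> real" where
  "pair_count j M = (\<Sum>y\<in>M. of_bool (y + j \<in> M))"

definition close_pairs :: "nat \<Rightarrow> nat set \<Rightarrow> real" where
  "close_pairs d M = (\<Sum>j<d. pair_count (Suc j) M)"

definition neighbours :: "nat \<Rightarrow> nat \<Rightarrow> nat set \<Rightarrow> real" where
  "neighbours d x M = (\<Sum>j<d. of_bool (x + Suc j \<in> M) + of_bool (Suc j \<le> x \<and> x - Suc j \<in> M))"

text \<open>Counting by the right instead of the left element. Both forms occur, as a mark that
  moves right gains pairs on its right and loses pairs on its left.\<close>

lemma pair_count_eq:
  assumes "finite M"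
  shows "pair_count j M = (\<Sum>y\<in>M. of_bool (j \<le> y \<and> y - j \<in> M))"
proof -
  have "card (M \<inter> {y. y + j \<in> M}) = card (M \<inter> {y. j \<le> y \<and> y - j \<in> M})"
    by (rule bij_betw_same_card[where f="\<lambda>y. y + j"], rule bij_betwI[where g="\<lambda>y. y - j"]) auto
  then show ?thesis using assms by (simp add: pair_count_def sum_of_bool_eq)
qed

lemma pair_count_insert:
  assumes "finite M" "x \<notin> M"
  shows "pair_count (Suc j) (insert x M) = pair_count (Suc j) M
    + of_bool (x + Suc j \<in> M) + of_bool (Suc j \<le> x \<and> x - Suc j \<in> M)"
proof -
  have "pair_count (Suc j) (insert x M) =
      of_bool (x + Suc j \<in> M) + (\<Sum>y\<in>M. of_bool (y + Suc j \<in> insert x M))"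
    unfolding pair_count_def using assms by simp
  also have "(\<Sum>y\<in>M. of_bool (y + Suc j \<in> insert x M) :: real)
      = (\<Sum>y\<in>M. of_bool (y + Suc j \<in> M) + (if y = x - Suc j then of_bool (Suc j \<le> x) else 0))"
    by (rule sum.cong) (use assms in auto)
  also have "\<dots> = pair_count (Suc j) M + of_bool (Suc j \<le> x \<and> x - Suc j \<in> M)"
    using assms by (simp add: sum.distrib sum.delta pair_count_def)
  finally show ?thesis by simp
qed

lemma close_pairs_insert:
  assumes "finite M" "x \<notin> M"
  shows "close_pairs d (insert x M) = close_pairs d M + neighbours d x M"
  by (simp add: close_pairs_def neighbours_def pair_count_insert[OF assms] sum.distrib[symmetric] add_ac)

lemma neighbours_bounds: "0 \<le> neighbours d x M" "neighbours d x M \<le> 2 * real d"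
proof -
  have "neighbours d x M \<le> (\<Sum>j<d. 2)" unfolding neighbours_def by (rule sum_mono) auto
  then show "neighbours d x M \<le> 2 * real d" by simp
qed (simp add: neighbours_def sum_nonneg)

lemma close_pairs_mono:
  assumes "finite N" "M \<subseteq> N"
  shows "close_pairs d M \<le> close_pairs d N"
  unfolding close_pairs_def pair_count_def
  by (intro sum_mono order_trans[OF sum_mono sum_mono2]) (use assms in auto)

lemma close_pairs_Un_le:
  assumes "finite A" "finite M"
  shows "close_pairs d (M \<union> A) \<le> close_pairs d M + 2 * real d * real (card A)"
  using assms(1)
proof (induction A rule: finite_induct)
  case (insert x A)
  have "close_pairs d (M \<union> insert x A) \<le> close_pairs d (M \<union> A) + 2 * real d"
  proof (cases "x \<in> M \<union> A")
    case True
    then have "M \<union> insert x A = M \<union> A" by auto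
    then show ?thesis by simp
  next
    case False
    then have "close_pairs d (insert x (M \<union> A)) \<le> close_pairs d (M \<union> A) + 2 * real d"
      using close_pairs_insert[of "M \<union> A" x d] neighbours_bounds(2)[of d x "M \<union> A"] insert assms by simp
    then show ?thesis by simp
  qed
  with insert show ?case by (simp add: algebra_simps)
qed simp

text \<open>Each added or deleted mark takes part in at most \<open>2 * d\<close> close
  pairs.\<close>

lemma close_pairs_le_sym_diff:
  assumes "finite M" "finite N"
  shows "close_pairs d M \<le> close_pairs d N + 2 * real d * real (card (sym_diff M N))"
proof -
  have "close_pairs d M \<le> close_pairs d (N \<union> sym_diff M N)"
    by (rule close_pairs_mono) (use assms in auto)
  also have "\<dots> \<le> close_pairs d N + 2 * real d * real (card (sym_diff M N))"
    by (rule close_pairs_Un_le) (use assms in auto)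
  finally show ?thesis .
qed

text \<open>The window of radius \<open>e + 2\<close> around the mark moves by two cells. It gains
  the cells \<open>k + (e + 3)\<close> and \<open>k + (e + 4)\<close>, loses
  \<open>k - (e + 1)\<close> and \<open>k - (e + 2)\<close>, and the cells \<open>k + 1\<close> and
  \<open>k + 2\<close> that the mark passes or reaches are unmarked beforehand.\<close>

lemma close_pairs_shift:
  assumes "finite M" "k \<in> M" "Suc k \<notin> M" "Suc (Suc k) \<notin> M"
  shows "close_pairs (Suc (Suc e)) (insert (Suc (Suc k)) (M - {k})) = close_pairs (Suc (Suc e)) M
    + of_bool (k + (e + 3) \<in> M) + of_bool (k + (e + 4) \<in> M)
    - of_bool (e + 1 \<le> k \<and> k - (e + 1) \<in> M) - of_bool (e + 2 \<le> k \<and> k - (e + 2) \<in> M)"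
proof -
  let ?d = "Suc (Suc e)" and ?N = "M - {k}"
  define h :: "nat \<Rightarrow> real" where "h j = of_bool (k + Suc j \<in> M)" for j
  define l :: "nat \<Rightarrow> real" where "l j = of_bool (Suc j \<le> k \<and> k - Suc j \<in> M)" for j
  have M: "M = insert k ?N" using assms by auto
  have "close_pairs ?d M = close_pairs ?d ?N + neighbours ?d k ?N"
    using close_pairs_insert[of ?N k ?d] assms by (simp add: insert_absorb)
  moreover have "close_pairs ?d (insert (Suc (Suc k)) ?N) = close_pairs ?d ?N + neighbours ?d (Suc (Suc k)) ?N"
    by (rule close_pairs_insert) (use assms in auto)
  moreover have "neighbours ?d k ?N = (\<Sum>j<?d. h j) + (\<Sum>j<?d. l j)"
    unfolding neighbours_def h_def l_def sum.distrib[symmetric]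
    by (intro sum.cong refl arg_cong2[where f="(+)"]) auto
  moreover have "neighbours ?d (Suc (Suc k)) ?N = (\<Sum>j<?d. h (Suc (Suc j))) + (\<Sum>j<e. l j)"
  proof -
    have "neighbours ?d (Suc (Suc k)) ?N = (\<Sum>j<?d. of_bool (Suc (Suc k) + Suc j \<in> ?N))
       + (\<Sum>j<?d. of_bool (Suc j \<le> Suc (Suc k) \<and> Suc (Suc k) - Suc j \<in> ?N))"
      unfolding neighbours_def sum.distrib ..
    also have "(\<Sum>j<?d. of_bool (Suc (Suc k) + Suc j \<in> ?N)) = (\<Sum>j<?d. h (Suc (Suc j)))"
      unfolding h_def by (intro sum.cong refl) auto
    also have "(\<Sum>j<?d. of_bool (Suc j \<le> Suc (Suc k) \<and> Suc (Suc k) - Suc j \<in> ?N) :: real) = (\<Sum>j<e. l j)"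
    proof -
      define g :: "nat \<Rightarrow> real"
        where "g j = of_bool (Suc j \<le> Suc (Suc k) \<and> Suc (Suc k) - Suc j \<in> ?N)" for j
      have "g 0 = 0" "g (Suc 0) = 0" using assms by (auto simp: g_def)
      moreover have "g (Suc (Suc j)) = l j" for j unfolding g_def l_def by (rule arg_cong[of _ _ of_bool]) auto
      ultimately show ?thesis unfolding g_def[symmetric] sum.lessThan_Suc_shift by simp
    qed
    finally show ?thesis .
  qed
  moreover have "(\<Sum>j<?d. h j) = (\<Sum>j<e. h (Suc (Suc j)))"
  proof -
    have "h 0 = 0" "h (Suc 0) = 0" using assms by (auto simp: h_def)
    then show ?thesis unfolding sum.lessThan_Suc_shift by simp
  qed
  moreover have "(\<Sum>j<?d. h (Suc (Suc j))) = (\<Sum>j<e. h (Suc (Suc j))) + h (e + 2) + h (e + 3)"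
    by (simp add: numeral_eq_Suc)
  moreover have "(\<Sum>j<?d. l j) = (\<Sum>j<e. l j) + l e + l (Suc e)" by simp
  moreover have "h (e + 2) = of_bool (k + (e + 3) \<in> M)" "h (e + 3) = of_bool (k + (e + 4) \<in> M)"
    "l e = of_bool (e + 1 \<le> k \<and> k - (e + 1) \<in> M)" "l (Suc e) = of_bool (e + 2 \<le> k \<and> k - (e + 2) \<in> M)"
    by (simp_all add: h_def l_def numeral_eq_Suc)
  ultimately show ?thesis by linarith
qed

text \<open>A mark with another one at most \<open>d\<close> cells to its right is the left element
  of a close pair. Two marks without such a neighbour cannot share a block of \<open>d\<close>
  consecutive cells.\<close>

lemma card_le_close_pairs:
  assumes M: "M \<subseteq> {..<K}" and d: "0 < d"
  shows "real (card M) \<le> close_pairs d M + real K / real d + 1"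
proof -
  have fin: "finite M" using M finite_subset by blast
  define L where "L = {y \<in> M. \<exists>j<d. y + Suc j \<in> M}"
  have "real (card L) = (\<Sum>y\<in>L. 1)" by simp
  also have "\<dots> \<le> (\<Sum>y\<in>L. \<Sum>j<d. of_bool (y + Suc j \<in> M))"
  proof (rule sum_mono)
    fix y assume "y \<in> L"
    then obtain j where "j < d" "y + Suc j \<in> M" by (auto simp: L_def)
    then show "(1::real) \<le> (\<Sum>j<d. of_bool (y + Suc j \<in> M))"
      using member_le_sum[of j "{..<d}" "\<lambda>j. of_bool (y + Suc j \<in> M) :: real"] by simp
  qed
  also have "\<dots> \<le> (\<Sum>y\<in>M. \<Sum>j<d. of_bool (y + Suc j \<in> M))"
    by (rule sum_mono2) (use fin in \<open>auto simp: L_def intro: sum_nonneg\<close>)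
  also have "\<dots> = close_pairs d M"
    unfolding close_pairs_def pair_count_def by (rule sum.swap)
  finally have L: "real (card L) \<le> close_pairs d M" .
  have "card (M - L) \<le> card {..K div d}"
  proof (rule card_inj_on_le[where f="\<lambda>y. y div d"])
    have "False" if y: "y \<in> M - L" and z: "z \<in> M - L" and e: "y div d = z div d" "y < z" for y z
    proof -
      have "z - y < d"
        using e d by (metis div_mult_mod_eq add_diff_cancel_left diff_le_self le_less_trans mod_less_divisor)
      then have "z - y - 1 < d" "y + Suc (z - y - 1) \<in> M" using e(2) z by auto
      then show False using y by (auto simp: L_def)
    qed
    then show "inj_on (\<lambda>y. y div d) (M - L)"
      unfolding inj_on_def by (metis linorder_neqE_nat)
    show "(\<lambda>y. y div d) ` (M - L) \<subseteq> {..K div d}"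
      using M by (auto intro!: div_le_mono)
  qed simp
  then have "real (card (M - L)) \<le> real (K div d) + 1" by simp
  also have "real (K div d) \<le> real K / real d" by (rule of_nat_div_le_of_nat)
  finally have "real (card (M - L)) \<le> real K / real d + 1" by simp
  moreover have "card M = card L + card (M - L)"
    using card_Diff_subset[of L M] fin card_mono[of M L] finite_subset[of L M] by (auto simp: L_def)
  ultimately show ?thesis using L by simp
qed

section \<open>Drift of the marks\<close>

lemma card_marks_le: "card (marks J K C) \<le> K"
proof -
  have "card (marks J K C) \<le> card {..<K}" by (rule card_mono) (auto simp: marks_def)
  then show ?thesis by simp
qed

definition mark_dist :: "nat \<Rightarrow> nat \<Rightarrow> nat set \<Rightarrow> nat set \<Rightarrow> real" where
  "mark_dist J K C D = real (card (sym_diff (marks J K C) (marks J K D)))"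

lemma mark_dist_card:
  "\<bar>real (card (marks J K C)) - real (card (marks J K D))\<bar> \<le> mark_dist J K C D"
  unfolding mark_dist_def by (rule card_sym_diff_bound) auto

lemma mark_dist_close_pairs:
  "close_pairs d (marks J K D) - close_pairs d (marks J K C) \<le> 2 * real d * mark_dist J K C D"
  using close_pairs_le_sym_diff[of "marks J K D" "marks J K C" d]
  unfolding mark_dist_def by (simp add: Un_commute)

lemma mark_dist_insert: "mark_dist J K (insert x C) C \<le> 2 * of_bool (J \<le> x \<and> x < K)"
  using card_marks_insert_diff[of J K x C] unfolding mark_dist_def
  by (cases "J \<le> x \<and> x < K") auto

lemma mark_dist_remove:
  assumes "x \<in> C"
  shows "mark_dist J K (C - {x}) C \<le> 2 * of_bool (J \<le> x \<and> x < K)"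
  using mark_dist_insert[of J K x "C - {x}"] assms
  by (simp add: insert_absorb mark_dist_def Un_commute)

lemma mark_dist_cong:
  assumes "\<And>z. J \<le> z \<Longrightarrow> z < K \<Longrightarrow> z \<in> C \<longleftrightarrow> z \<in> C'"
  shows "mark_dist J K C D = mark_dist J K C' D"
proof -
  have "marks J K C = marks J K C'" by (rule marks_cong) (rule assms)
  then show ?thesis by (simp add: mark_dist_def)
qed

lemma mark_dist_self [simp]: "mark_dist J K C C = 0"
  by (simp add: mark_dist_def)

text \<open>First fit protects the marks: an item placed at or beyond \<open>J\<close> has an even
  gap in front of it. An item placed before \<open>J\<close> matters only if it straddles
  \<open>J\<close>, since then it occupies the cell \<open>J\<close>.\<close>

lemma mark_dist_first_pair:
  assumes "finite C"
  defines "x \<equiv> first_pair C"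
  shows "mark_dist J K (insert x (insert (Suc x) C)) C \<le> 2 * of_bool (x < J)"
proof (cases "x < J")
  case True
  have "mark_dist J K (insert x (insert (Suc x) C)) C = mark_dist J K (insert (Suc x) C) C"
    by (rule mark_dist_cong) (use True in auto)
  also have "\<dots> \<le> 2 * of_bool (J \<le> Suc x \<and> Suc x < K)" by (rule mark_dist_insert)
  also have "\<dots> \<le> 2 * of_bool (x < J)" using True by simp
  finally show ?thesis .
next
  case False
  then have "marks J K (insert x (insert (Suc x) C)) = marks J K C"
    using first_pair[OF assms(1)] not_odd_gap_first_pair[OF assms(1), of J]
    unfolding x_def by (intro marks_insert_pair) auto
  with False show ?thesis by (simp add: mark_dist_def)
qed

lemma mark_dist_remove_pair:
  assumes "k \<in> C" "Suc k \<in> C" "\<not> (J \<le> k \<and> k < K)"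
  shows "mark_dist J K (C - {k} - {Suc k}) C \<le> 2 * of_bool (Suc k = J)"
proof (cases "Suc k = J")
  case True
  have "mark_dist J K (C - {k} - {Suc k}) C = mark_dist J K (C - {Suc k}) C"
    by (rule mark_dist_cong) (use True in auto)
  also have "\<dots> \<le> 2 * of_bool (J \<le> Suc k \<and> Suc k < K)" by (rule mark_dist_remove) fact
  also have "\<dots> \<le> 2 * of_bool (Suc k = J)" using True by simp
  finally show ?thesis .
next
  case False
  have "mark_dist J K (C - {k} - {Suc k}) C = mark_dist J K C C"
    by (rule mark_dist_cong) (use False assms(3) in auto)
  then show ?thesis by simp
qed

lemma sum_restrict_interval:
  fixes J K :: nat
  assumes "finite T"
  shows "(\<Sum>k\<in>T. of_bool (J \<le> k \<and> k < K) * g k) = (\<Sum>k\<in>{J..<K}. of_bool (k \<in> T) * g k :: real)"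
proof -
  have "(\<Sum>k\<in>T. of_bool (J \<le> k \<and> k < K) * g k) = (\<Sum>k\<in>T \<inter> {J..<K}. g k)"
    by (rule sum.mono_neutral_cong_right) (use assms in auto)
  also have "\<dots> = (\<Sum>k\<in>{J..<K}. of_bool (k \<in> T) * g k)"
    by (rule sum.mono_neutral_cong_left) auto
  finally show ?thesis .
qed

lemma sum_of_bool_eq_le_1: "finite T \<Longrightarrow> (\<Sum>k\<in>T. of_bool (Suc k = J)) \<le> (1::real)"
proof -
  assume fin: "finite T"
  have "card (T \<inter> {k. Suc k = J}) \<le> card {J - 1}" by (rule card_mono) auto
  then show ?thesis using fin by (simp add: sum_of_bool_eq)
qed

text \<open>Meant for the slack \<open>t\<close>: a disturbance changes the vacancy by at most one
  cell and the number of marks by at most two, whence 3, and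
  \<open>(t + 3)^2 - t^2 = 6 * t + 9\<close>.\<close>

lemma square_change_le:
  fixes t t' :: real
  assumes "0 \<le> t" "0 \<le> t'" "t' - t \<le> 3 * of_bool Q"
  shows "t'\<^sup>2 - t\<^sup>2 \<le> of_bool Q * (6 * t + 9)"
proof (cases Q)
  case True
  then have "t'\<^sup>2 \<le> (t + 3)\<^sup>2" using assms by (intro power_mono) auto
  with True show ?thesis by (simp add: power2_eq_square algebra_simps)
next
  case False
  then have "t'\<^sup>2 \<le> t\<^sup>2" using assms by (intro power_mono) auto
  with False show ?thesis by simp
qed

definition ones_between :: "nat \<Rightarrow> nat \<Rightarrow> nat set \<Rightarrow> real" where
  "ones_between J K S = real (card (S \<inter> {J..<K}))"

definition pairs_below :: "nat \<Rightarrow> nat set \<Rightarrow> real" where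
  "pairs_below J T = real (card (T \<inter> {..<J}))"

definition mark_loss :: "nat \<Rightarrow> nat \<Rightarrow> nat set \<Rightarrow> nat set \<Rightarrow> nat \<Rightarrow> real" where
  "mark_loss J K S T k =
    real (card (marks J K (occ S T))) - real (card (marks J K (occ S (T - {k}))))"

text \<open>The rate at which departures of 2-items that start in \<open>{J..<K}\<close> destroy
  marks. Summing over a fixed interval rather than over \<open>T\<close> makes boundedness
  immediate.\<close>

definition total_loss :: "nat \<Rightarrow> nat \<Rightarrow> nat set \<Rightarrow> nat set \<Rightarrow> real" where
  "total_loss J K S T = (\<Sum>k\<in>{J..<K}. of_bool (k \<in> T) * mark_loss J K S T k)"

lemma ones_between_bounds: "0 \<le> ones_between J K S" "ones_between J K S \<le> real K"
proof -
  have "card (S \<inter> {J..<K}) \<le> card {..<K}" by (rule card_mono) auto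
  then show "0 \<le> ones_between J K S" "ones_between J K S \<le> real K" by (auto simp: ones_between_def)
qed

lemma pairs_below_bounds: "0 \<le> pairs_below J T" "pairs_below J T \<le> real J"
proof -
  have "card (T \<inter> {..<J}) \<le> card {..<J}" by (rule card_mono) auto
  then show "0 \<le> pairs_below J T" "pairs_below J T \<le> real J" by (auto simp: pairs_below_def)
qed

lemma bdd_card_marks: "bdd (\<lambda>S T. real (card (marks J K (f S T))))"
  by (rule bddI[where c="real K"]) (use card_marks_le in auto)

lemma bdd_ones_between: "bdd (\<lambda>S T. ones_between J K (f S T))"
  by (rule bddI[where c="real K"]) (use ones_between_bounds in auto)

lemma bdd_pairs_below: "bdd (\<lambda>S T. pairs_below J (f S T))"
  by (rule bddI[where c="real J"]) (use pairs_below_bounds in auto)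

lemma bdd_slack: "bdd (\<lambda>S T. slack J K (f S T))"
  by (rule bddI[where c="real K"]) (use slack_bounds in auto)

lemma bdd_total_loss: "bdd (\<lambda>S T. total_loss J K S T)"
  unfolding total_loss_def mark_loss_def by (intro bdd_intros bdd_card_marks)

lemmas functional_bdds = bdds bdd_card_marks bdd_ones_between bdd_pairs_below bdd_slack bdd_total_loss

lemma mark_loss_bounds:
  assumes "cells_ok S T" "k \<in> T" "J \<le> k" "k < K"
  shows "0 \<le> mark_loss J K S T k" "mark_loss J K S T k \<le> 2"
  using card_marks_remove_pair[OF assms(3,4) mem_occ(2,3)[OF assms(2)], of S]
  unfolding mark_loss_def occ_remove(2)[OF assms(1,2)] by auto

lemma total_loss_nonneg: "cells_ok S T \<Longrightarrow> 0 \<le> total_loss J K S T"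
  unfolding total_loss_def
  by (rule sum_nonneg) (use mark_loss_bounds in \<open>auto simp: of_bool_def\<close>)

lemma total_loss_eq:
  assumes "cells_ok S T"
  shows "total_loss J K S T = (\<Sum>k\<in>T. of_bool (J \<le> k \<and> k < K) * mark_loss J K S T k)"
  unfolding total_loss_def
  by (rule sum_restrict_interval[symmetric]) (use assms in \<open>simp add: cells_ok_def\<close>)

lemma sum_ones_between: "cells_ok S T \<Longrightarrow> (\<Sum>k\<in>S. of_bool (J \<le> k \<and> k < K)) = ones_between J K S"
proof -
  assume "cells_ok S T"
  moreover have "S \<inter> {k. J \<le> k \<and> k < K} = S \<inter> {J..<K}" by auto
  ultimately show ?thesis by (simp add: cells_ok_def sum_of_bool_eq ones_between_def)
qed

lemma ones_between_insert:
  "x \<notin> S \<Longrightarrow> finite S \<Longrightarrow> ones_between J K (insert x S) = ones_between J K S + of_bool (J \<le> x \<and> x < K)"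
  by (simp add: ones_between_def Int_insert_left)

lemma ones_between_remove:
  assumes "x \<in> S" "finite S"
  shows "ones_between J K (S - {x}) = ones_between J K S - of_bool (J \<le> x \<and> x < K)"
  using ones_between_insert[of x "S - {x}" J K] assms by (simp add: insert_absorb)

lemma pairs_below_insert:
  "x \<notin> T \<Longrightarrow> finite T \<Longrightarrow> pairs_below J (insert x T) = pairs_below J T + of_bool (x < J)"
  by (simp add: pairs_below_def Int_insert_left)

lemma pairs_below_remove:
  assumes "x \<in> T" "finite T"
  shows "pairs_below J (T - {x}) = pairs_below J T - of_bool (x < J)"
  using pairs_below_insert[of x "T - {x}" J] assms by (simp add: insert_absorb)

lemma first_free_notin: "cells_ok S T \<Longrightarrow> first_free (occ S T) \<notin> S"
  using first_free(1)[OF finite_occ] mem_occ(1) by blast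

lemma first_pair_notin: "cells_ok S T \<Longrightarrow> first_pair (occ S T) \<notin> T"
  using first_pair(1)[OF finite_occ] mem_occ(2) by blast

abbreviation free_between :: "nat \<Rightarrow> nat \<Rightarrow> nat set \<Rightarrow> nat set \<Rightarrow> real" where
  "free_between J K S T \<equiv> of_bool (J \<le> first_free (occ S T) \<and> first_free (occ S T) < K)"

abbreviation free_pair_below :: "nat \<Rightarrow> nat set \<Rightarrow> nat set \<Rightarrow> real" where
  "free_pair_below J S T \<equiv> of_bool (first_pair (occ S T) < J)"

lemma mark_dist_transitions:
  assumes ok: "cells_ok S T"
  shows "mark_dist J K (occ (insert (first_free (occ S T)) S) T) (occ S T) \<le> 2 * free_between J K S T"
    "mark_dist J K (occ S (insert (first_pair (occ S T)) T)) (occ S T) \<le> 2 * free_pair_below J S T"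
    "k \<in> S \<Longrightarrow> mark_dist J K (occ (S - {k}) T) (occ S T) \<le> 2 * of_bool (J \<le> k \<and> k < K)"
    "k \<in> T \<Longrightarrow> \<not> (J \<le> k \<and> k < K) \<Longrightarrow>
      mark_dist J K (occ S (T - {k})) (occ S T) \<le> 2 * of_bool (Suc k = J)"
  using mark_dist_insert mark_dist_first_pair[OF finite_occ[OF ok]] mark_dist_remove
    mark_dist_remove_pair mem_occ
  by (simp_all add: occ_insert occ_remove[OF ok])

lemma card_marks_minus_pairs: "card (marks J K (occ S T) - T) \<le> card (S \<inter> {J..<K})" if "finite S"
proof (rule card_mono)
  show "marks J K (occ S T) - T \<subseteq> S \<inter> {J..<K}"
    using odd_gap_after[OF mem_occ(2)] by (fastforce simp: marks_def occ_def simp del: odd_gap.simps)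
qed (use that in simp)

lemma pair_count_marks_1: "pair_count 1 (marks J K C) = 0"
  unfolding pair_count_def by (rule sum.neutral) (auto simp: marks_def)

text \<open>If a 2-item starts at \<open>y\<close>, then \<open>y + 1\<close> is occupied and
  \<open>y + 2\<close> has no gap in front of it. Hence the left mark of such a pair belongs to a
  1-item.\<close>

lemma pair_count_marks_2:
  assumes "finite S"
  shows "pair_count 2 (marks J K (occ S T)) \<le> ones_between J K S"
proof -
  have "pair_count 2 (marks J K (occ S T))
      = real (card (marks J K (occ S T) \<inter> {y. y + 2 \<in> marks J K (occ S T)}))"
    unfolding pair_count_def by (simp add: sum_of_bool_eq)
  also have "card (marks J K (occ S T) \<inter> {y. y + 2 \<in> marks J K (occ S T)})
      \<le> card (marks J K (occ S T) - T)"
  proof (rule card_mono)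
    show "marks J K (occ S T) \<inter> {y. y + 2 \<in> marks J K (occ S T)} \<subseteq> marks J K (occ S T) - T"
      using mem_occ(3)[of _ T S] by (auto simp: marks_def numeral_eq_Suc)
  qed simp
  also have "card (marks J K (occ S T) - T) \<le> card (S \<inter> {J..<K})"
    by (rule card_marks_minus_pairs[OF assms])
  finally show ?thesis by (simp add: ones_between_def)
qed

lemma mark_dist_remove_marked:
  assumes "J \<le> k" "k \<in> C" "Suc k \<in> C" "odd_gap J C k"
  shows "mark_dist J K (C - {k} - {Suc k}) C \<le> 2"
proof -
  let ?N = "next_cell C (Suc (Suc k))"
  have "card (sym_diff (marks J K (C - {k} - {Suc k})) (marks J K C)) \<le> card (insert k ?N)"
    unfolding marks_remove_pair[OF assms] by (rule card_mono) (auto simp: card_next_cell)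
  also have "\<dots> \<le> 2" using card_next_cell[of C "Suc (Suc k)"] by (simp add: card_insert_if)
  finally show ?thesis by (simp add: mark_dist_def)
qed

text \<open>A marked 2-item that is not followed immediately by another item either ends near \<open>K\<close>, or
  its departure loses a mark, or the cell behind it counts towards the slack.\<close>

lemma irregular_marks_le:
  assumes ok: "cells_ok S T"
  shows "(\<Sum>k\<in>T \<inter> marks J K (occ S T).
      of_bool (\<not> (Suc (Suc k) \<in> occ S T \<and> Suc (Suc k) < K)))
    \<le> 2 + total_loss J K S T + slack J K (occ S T)"
proof -
  define C where "C = occ S T"
  define M where "M = marks J K C"
  have fin: "finite (T \<inter> M)" by (simp add: M_def)
  define Y where "Y = {k \<in> T \<inter> M. Suc (Suc k) < K \<and> Suc (Suc k) \<notin> C}"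
  define Ya where "Ya = {k \<in> Y. Suc (Suc (Suc k)) \<in> M}"
  define Yb where "Yb = {k \<in> Y. Suc (Suc (Suc k)) \<notin> M}"
  have finY: "finite Ya" "finite Yb"
    by (rule finite_subset[OF _ fin], auto simp: Y_def Ya_def Yb_def)+
  have "(T \<inter> M) \<inter> {k. \<not> (Suc (Suc k) \<in> C \<and> Suc (Suc k) < K)} \<subseteq> {K - 1, K - 2} \<union> Ya \<union> Yb"
    by (auto simp: Y_def Ya_def Yb_def M_def marks_def)
  then have "card ((T \<inter> M) \<inter> {k. \<not> (Suc (Suc k) \<in> C \<and> Suc (Suc k) < K)})
      \<le> card ({K - 1, K - 2} \<union> Ya \<union> Yb)" using finY by (intro card_mono) auto
  also have "\<dots> \<le> card {K - 1, K - 2} + card Ya + card Yb"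
    by (intro order_trans[OF card_Un_le] add_right_mono card_Un_le)
  also have "\<dots> \<le> 2 + card Ya + card Yb" by (simp add: card_insert_if)
  finally have 1: "real (card ((T \<inter> M) \<inter> {k. \<not> (Suc (Suc k) \<in> C \<and> Suc (Suc k) < K)}))
      \<le> 2 + real (card Ya) + real (card Yb)" by linarith
  have "real (card Ya) = (\<Sum>k\<in>Ya. 1)" by simp
  also have "\<dots> \<le> (\<Sum>k\<in>Ya. of_bool (k \<in> T) * mark_loss J K S T k)"
  proof (rule sum_mono)
    fix k assume k: "k \<in> Ya"
    then have kT: "k \<in> T" "k \<in> C" "Suc k \<in> C" "J \<le> k" "k < K" "odd_gap J C k"
      using mem_occ[of k T S] by (auto simp: Ya_def Y_def M_def C_def marks_def simp del: odd_gap.simps)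
    have "card (marks J K (C - {k} - {Suc k})) < card (marks J K C)"
      by (rule card_marks_annihilate) (use k kT in \<open>auto simp: Ya_def Y_def M_def\<close>)
    then show "1 \<le> of_bool (k \<in> T) * mark_loss J K S T k"
      using kT unfolding mark_loss_def occ_remove(2)[OF ok kT(1)] C_def by simp
  qed
  also have "\<dots> \<le> total_loss J K S T" unfolding total_loss_def
    by (rule sum_mono2)
      (use mark_loss_bounds(1)[OF ok] in \<open>auto simp: Ya_def Y_def M_def marks_def\<close>)
  finally have 2: "real (card Ya) \<le> total_loss J K S T" .
  have "card Yb \<le> card {v \<in> {J..<K} - C. Suc v \<notin> M}"
    by (rule card_inj_on_le[where f="\<lambda>k. Suc (Suc k)"])
      (auto simp: Yb_def Y_def M_def marks_def inj_on_def simp del: odd_gap.simps)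
  then have 3: "real (card Yb) \<le> slack J K C" by (simp add: slack_eq M_def)
  show ?thesis using 1 2 3 fin unfolding C_def[symmetric] M_def[symmetric] by simp
qed

lemma bdd_pair_count: "bdd (\<lambda>S T. pair_count j (marks J K (f S T)))"
proof (rule bddI[where c="real K"])
  fix S T
  have "pair_count j (marks J K (f S T)) \<le> (\<Sum>y\<in>marks J K (f S T). 1)"
    unfolding pair_count_def by (rule sum_mono) auto
  then show "\<bar>pair_count j (marks J K (f S T))\<bar> \<le> real K"
    using card_marks_le[of J K "f S T"] by (simp add: pair_count_def sum_nonneg)
qed

lemma bdd_close_pairs: "bdd (\<lambda>S T. close_pairs d (marks J K (f S T)))"
  unfolding close_pairs_def by (intro bdd_sum bdd_pair_count)

section \<open>Drift estimates between \<open>J\<close> and \<open>K\<close>\<close>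

context stationary_cells
begin

lemma expectation_ones_between_le: "Ex (\<lambda>S T. ones_between J K S) \<le> a"
proof -
  have "0 \<le> Ex (\<lambda>S T. a - ones_between J K S)"
  proof (rule drift[where F="\<lambda>S T. ones_between J K S"])
    fix S T assume ok: "cells_ok S T"
    then have fin: "finite S" by (simp add: cells_ok_def)
    have "generator a b (\<lambda>S T. ones_between J K S) S T \<le> a * 1 + b * 0
        + (\<Sum>k\<in>S. - of_bool (J \<le> k \<and> k < K)) + (\<Sum>k\<in>T. 0)"
      by (rule generator_le[OF ok])
        (use a_pos b_pos fin first_free_notin[OF ok] in \<open>auto simp: ones_between_insert ones_between_remove\<close>)
    then show "generator a b (\<lambda>S T. ones_between J K S) S T \<le> a - ones_between J K S"
      using sum_ones_between[OF ok] by (simp add: sum_negf)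
  qed (intro functional_bdds)+
  also have "\<dots> = a - Ex (\<lambda>S T. ones_between J K S)" by (subst Ex_diff; (intro functional_bdds)?) simp
  finally show ?thesis by simp
qed

text \<open>A 1-item that arrives while the first free cell is in \<open>{J..<K}\<close> stays there
  until it departs. Thus the rate of such disturbing arrivals is controlled by the mean number of
  1-items in the window.\<close>

lemma expectation_first_free_le:
  "a * Ex (\<lambda>S T. of_bool (J \<le> first_free (occ S T) \<and> first_free (occ S T) < K))
    \<le> Ex (\<lambda>S T. ones_between J K S)"
proof -
  let ?i = "\<lambda>S T. of_bool (J \<le> first_free (occ S T) \<and> first_free (occ S T) < K) :: real"
  have "0 \<le> Ex (\<lambda>S T. ones_between J K S - a * ?i S T)"
  proof (rule drift[where F="\<lambda>S T. - ones_between J K S"])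
    fix S T assume ok: "cells_ok S T"
    then have fin: "finite S" by (simp add: cells_ok_def)
    have "generator a b (\<lambda>S T. - ones_between J K S) S T \<le> a * (- ?i S T) + b * 0
        + (\<Sum>k\<in>S. of_bool (J \<le> k \<and> k < K)) + (\<Sum>k\<in>T. 0)"
      by (rule generator_le[OF ok])
        (use a_pos b_pos fin first_free_notin[OF ok] in \<open>auto simp: ones_between_insert ones_between_remove\<close>)
    then show "generator a b (\<lambda>S T. - ones_between J K S) S T \<le> ones_between J K S - a * ?i S T"
      using sum_ones_between[OF ok] by simp
  qed (intro functional_bdds)+
  also have "\<dots> = Ex (\<lambda>S T. ones_between J K S) - a * Ex ?i"
    by (subst Ex_diff; (intro functional_bdds)?) (simp only: Ex_cmult)
  finally show ?thesis by simp
qed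

lemma expectation_first_pair_le:
  "b * Ex (\<lambda>S T. of_bool (first_pair (occ S T) < J)) \<le> Ex (\<lambda>S T. pairs_below J T)"
proof -
  let ?i = "\<lambda>S T. of_bool (first_pair (occ S T) < J) :: real"
  have "0 \<le> Ex (\<lambda>S T. pairs_below J T - b * ?i S T)"
  proof (rule drift[where F="\<lambda>S T. - pairs_below J T"])
    fix S T assume ok: "cells_ok S T"
    then have fin: "finite T" by (simp add: cells_ok_def)
    have "generator a b (\<lambda>S T. - pairs_below J T) S T \<le> a * 0 + b * (- ?i S T)
        + (\<Sum>k\<in>S. 0) + (\<Sum>k\<in>T. of_bool (k < J))"
      by (rule generator_le[OF ok])
        (use a_pos b_pos fin first_pair_notin[OF ok] in \<open>auto simp: pairs_below_insert pairs_below_remove\<close>)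
    moreover have "T \<inter> {k. k < J} = T \<inter> {..<J}" by auto
    ultimately show "generator a b (\<lambda>S T. - pairs_below J T) S T \<le> pairs_below J T - b * ?i S T"
      using fin by (simp add: sum_of_bool_eq pairs_below_def)
  qed (intro functional_bdds)+
  also have "\<dots> = Ex (\<lambda>S T. pairs_below J T) - b * Ex ?i"
    by (subst Ex_diff; (intro functional_bdds)?) (simp only: Ex_cmult)
  finally show ?thesis by simp
qed

text \<open>In equilibrium marks are lost no faster than they are created. Each disturbance creates
  at most two: 1-items entering and leaving the window give \<open>4\<close> times their mean
  number, 2-items placed before \<open>J\<close> give \<open>2\<close> times
  \<open>pairs_below\<close>, and the final \<open>2\<close> is for the at most one 2-item that
  straddles \<open>J\<close>.\<close>

lemma expectation_total_loss:
  "Ex (total_loss J K) \<le> 4 * Ex (\<lambda>S T. ones_between J K S) + 2 * Ex (\<lambda>S T. pairs_below J T) + 2"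
proof -
  let ?m = "\<lambda>S T. real (card (marks J K (occ S T)))"
  have "0 \<le> Ex (\<lambda>S T. 2 * (a * free_between J K S T) + 2 * (b * free_pair_below J S T) + 2 * ones_between J K S + 2 - total_loss J K S T)"
  proof (rule drift[where F="?m"])
    fix S T assume ok: "cells_ok S T"
    then have fin: "finite S" "finite T" by (auto simp: cells_ok_def)
    note d = mark_dist_transitions[OF ok]
    have m: "?m S' T' - ?m S T \<le> c" if "mark_dist J K (occ S' T') (occ S T) \<le> c" for S' T' c
      using mark_dist_card[of J K "occ S' T'" "occ S T"] that by linarith
    have "generator a b ?m S T \<le> a * (2 * free_between J K S T) + b * (2 * free_pair_below J S T)
        + (\<Sum>k\<in>S. 2 * of_bool (J \<le> k \<and> k < K))
        + (\<Sum>k\<in>T. 2 * of_bool (Suc k = J) - of_bool (J \<le> k \<and> k < K) * mark_loss J K S T k)"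
    proof (rule generator_le[OF ok _ _ m[OF d(1)] m[OF d(2)] m[OF d(3)]])
      fix k assume k: "k \<in> T"
      show "?m S (T - {k}) - ?m S T \<le> 2 * of_bool (Suc k = J) - of_bool (J \<le> k \<and> k < K) * mark_loss J K S T k"
      proof (cases "J \<le> k \<and> k < K")
        case True
        then show ?thesis by (simp add: mark_loss_def)
      next
        case False
        then show ?thesis using m[OF d(4)[OF k False]] by auto
      qed
    qed (use a_pos b_pos in auto)
    also have "\<dots> = 2 * (a * free_between J K S T) + 2 * (b * free_pair_below J S T) + 2 * ones_between J K S
        + 2 * (\<Sum>k\<in>T. of_bool (Suc k = J)) - total_loss J K S T"
      by (simp add: sum_subtractf sum_distrib_left[symmetric] sum_ones_between[OF ok] total_loss_eq[OF ok] del: sum_of_bool_eq)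
    also have "\<dots> \<le> 2 * (a * free_between J K S T) + 2 * (b * free_pair_below J S T) + 2 * ones_between J K S + 2 - total_loss J K S T"
      using sum_of_bool_eq_le_1[OF fin(2), of J] by simp
    finally show "generator a b ?m S T
      \<le> 2 * (a * free_between J K S T) + 2 * (b * free_pair_below J S T) + 2 * ones_between J K S + 2 - total_loss J K S T" .
  qed (intro functional_bdds)+
  also have "\<dots> = 2 * (a * Ex (free_between J K)) + 2 * (b * Ex (free_pair_below J)) + 2 * Ex (\<lambda>S T. ones_between J K S) + 2
      - Ex (total_loss J K)"
    by ((subst Ex_diff Ex_add; (intro functional_bdds)?)+) (simp only: Ex_cmult Ex_const)
  finally show ?thesis using expectation_first_free_le[of J K] expectation_first_pair_le[of J] by linarith
qed

text \<open>At this critical length arrivals and departures of 2-items balance to first order, so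
  there is no linear restoring drift. The restoring force is the vacancy itself: 2-items occupy at
  most \<open>K - J - t\<close> of the cells when the slack is \<open>t\<close>, and the term
  \<open>- t\<close> produces \<open>- 2 * t^2\<close>.\<close>

lemma expectation_slack:
  assumes JK: "J \<le> K" "real K - real J \<le> 2 * b + 1"
  shows "2 * Ex (\<lambda>S T. (slack J K (occ S T))\<^sup>2)
    \<le> (6 * real K + 9) * (2 * Ex (\<lambda>S T. ones_between J K S) + 1) + (10 * real K + 9) * Ex (\<lambda>S T. pairs_below J T)
      + 2 * real K * Ex (total_loss J K) + (4 * b + 18 * real K)"
proof -
  let ?t = "\<lambda>S T. slack J K (occ S T)"
  let ?A = "6 * real K + 9" and ?B = "10 * real K + 9"
  let ?G = "\<lambda>S T. ?A * (a * free_between J K S T + ones_between J K S + 1) + ?B * (b * free_pair_below J S T)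
      + 2 * real K * total_loss J K S T + (4 * b + 18 * real K) - 2 * (?t S T)\<^sup>2"
  have "0 \<le> Ex ?G"
  proof (rule drift[where F="\<lambda>S T. (?t S T)\<^sup>2"])
    fix S T assume ok: "cells_ok S T"
    then have fin: "finite S" "finite T" by (auto simp: cells_ok_def)
    note finC = finite_occ[OF ok]
    note d = mark_dist_transitions[OF ok]
    define t where "t = ?t S T"
    have t: "0 \<le> t" "t \<le> real K" "t \<le> vacant J K (occ S T)"
      unfolding t_def by (rule slack_bounds)+
    have m: "?t S' T' - ?t S T \<le> vacant J K (occ S' T') - vacant J K (occ S T) + c"
      if "mark_dist J K (occ S' T') (occ S T) \<le> c" for S' T' c
      using mark_dist_card[of J K "occ S' T'" "occ S T"] that unfolding slack_def by linarith
    let ?in = "\<lambda>k. of_bool (J \<le> k \<and> k < K) :: real"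
    \<comment> \<open>An arriving 2-item that fits below \<open>K\<close> gives
      \<open>(t - 2)^2 - t^2 = - 4 * t + 4\<close>. If it does not fit, then
      \<open>t \<le> 1\<close> and this bound is nonnegative. If it is placed before
      \<open>J\<close>, the disturbance bound \<open>6 * t + 9\<close> applies, and
      \<open>10 * t + 9\<close> also offsets the \<open>- 4 * t\<close>. A departing 2-item raises
      \<open>t\<close> by \<open>u \<le> 4\<close>, at most two freed cells and two lost marks;
      hence \<open>16\<close>.\<close>
    have "generator a b (\<lambda>S T. (?t S T)\<^sup>2) S T
      \<le> a * (free_between J K S T * (6 * t + 9)) + b * (- 4 * t + 4 + free_pair_below J S T * (10 * t + 9))
        + (\<Sum>k\<in>S. ?in k * (6 * t + 9))
        + (\<Sum>k\<in>T. of_bool (Suc k = J) * (6 * t + 9)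
            + ?in k * (2 * t * (1 + of_bool (Suc k < K) + mark_loss J K S T k) + 16))"
    proof (rule generator_le[OF ok])
      have "?t (insert (first_free (occ S T)) S) T - ?t S T \<le> 3 * free_between J K S T"
        using m[OF d(1)] first_free(1)[OF finC] unfolding occ_insert
        by (subst (asm) vacant_insert) (auto simp: of_bool_def split: if_splits)
      then show "(?t (insert (first_free (occ S T)) S) T)\<^sup>2 - (?t S T)\<^sup>2 \<le> free_between J K S T * (6 * t + 9)"
        unfolding t_def by (intro square_change_le slack_bounds)
    next
      let ?x = "first_pair (occ S T)"
      define t' where "t' = ?t S (insert ?x T)"
      have t': "0 \<le> t'" unfolding t'_def by (rule slack_bounds)
      have eq: "vacant J K (occ S (insert ?x T)) = vacant J K (occ S T) - ?in ?x - ?in (Suc ?x)"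
        using first_pair(1,2)[OF finC] by (simp add: vacant_insert occ_insert)
      have le: "t' - t \<le> - ?in ?x - ?in (Suc ?x) + 2 * free_pair_below J S T"
        using m[OF d(2)] unfolding t'_def t_def eq by linarith
      show "(?t S (insert ?x T))\<^sup>2 - (?t S T)\<^sup>2 \<le> - 4 * t + 4 + free_pair_below J S T * (10 * t + 9)"
      proof (cases "?x < J")
        case True
        have "t'\<^sup>2 - t\<^sup>2 \<le> of_bool True * (6 * t + 9)"
          by (rule square_change_le) (use le t t' in \<open>auto simp: of_bool_def split: if_splits\<close>)
        then show ?thesis using True by (simp add: t_def t'_def)
      next
        case False
        show ?thesis
        proof (cases "Suc ?x < K")
          case True
          then have "t' \<le> t - 2" using le False by simp
          then have "t'\<^sup>2 \<le> (t - 2)\<^sup>2" using t' by (intro power_mono) auto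
          then show ?thesis using False by (simp add: t_def t'_def power2_eq_square algebra_simps)
        next
          case 2: False
          then have "t \<le> 1" unfolding t_def by (intro slack_le_1 finC) auto
          have "t'\<^sup>2 - t\<^sup>2 \<le> of_bool False * (6 * t + 9)"
            by (rule square_change_le) (use le t t' False in \<open>auto simp: of_bool_def split: if_splits\<close>)
          then have "t'\<^sup>2 - t\<^sup>2 \<le> 0" by simp
          then show ?thesis using False \<open>t \<le> 1\<close> by (simp add: t_def t'_def)
        qed
      qed
    next
      fix k assume k: "k \<in> S"
      have "?t (S - {k}) T - ?t S T \<le> 3 * ?in k"
        using m[OF d(3)[OF k]] mem_occ(1)[OF k, of T] unfolding occ_remove(1)[OF ok k]
        by (subst (asm) vacant_remove) (auto simp: of_bool_def split: if_splits)
      then show "(?t (S - {k}) T)\<^sup>2 - (?t S T)\<^sup>2 \<le> ?in k * (6 * t + 9)"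
        unfolding t_def by (intro square_change_le slack_bounds)
    next
      fix k assume k: "k \<in> T"
      have eq: "vacant J K (occ S (T - {k})) = vacant J K (occ S T) + ?in k + ?in (Suc k)"
        using mem_occ(2,3)[OF k, of S] by (simp add: vacant_remove occ_remove[OF ok] k)
      show "(?t S (T - {k}))\<^sup>2 - (?t S T)\<^sup>2 \<le> of_bool (Suc k = J) * (6 * t + 9)
          + ?in k * (2 * t * (1 + of_bool (Suc k < K) + mark_loss J K S T k) + 16)"
      proof (cases "J \<le> k \<and> k < K")
        case True
        define u where "u = 1 + of_bool (Suc k < K) + mark_loss J K S T k"
        have u: "0 \<le> u" "u \<le> 4"
          using mark_loss_bounds[OF ok k, of J K] True by (auto simp: u_def of_bool_def)
        have "?t S (T - {k}) = t + u"
          unfolding slack_def eq t_def u_def mark_loss_def using True by simp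
        then have "(?t S (T - {k}))\<^sup>2 - (?t S T)\<^sup>2 = 2 * t * u + u\<^sup>2"
          unfolding t_def[symmetric] by (simp add: power2_eq_square algebra_simps)
        also have "u\<^sup>2 \<le> 16" using power_mono[of u 4 2] u by simp
        finally show ?thesis using True unfolding u_def[symmetric] by auto
      next
        case False
        have "?t S (T - {k}) - ?t S T \<le> 3 * of_bool (Suc k = J)"
          using m[OF d(4)[OF k False]] False unfolding eq by (auto simp: of_bool_def split: if_splits)
        then have "(?t S (T - {k}))\<^sup>2 - (?t S T)\<^sup>2 \<le> of_bool (Suc k = J) * (6 * t + 9)"
          unfolding t_def by (intro square_change_le slack_bounds)
        moreover have "?in k = 0" using False by simp
        ultimately show ?thesis by (simp only: mult_zero_left add_0_right)
      qed
    qed (use a_pos b_pos in auto)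
    also have "(\<Sum>k\<in>S. ?in k * (6 * t + 9)) = (6 * t + 9) * ones_between J K S"
      by (simp add: sum_distrib_right[symmetric] sum_ones_between[OF ok] del: sum_of_bool_eq)
    also have "(\<Sum>k\<in>T. of_bool (Suc k = J) * (6 * t + 9)
            + ?in k * (2 * t * (1 + of_bool (Suc k < K) + mark_loss J K S T k) + 16))
        = (6 * t + 9) * (\<Sum>k\<in>T. of_bool (Suc k = J)) + 2 * t * (\<Sum>k\<in>T. ?in k * (1 + of_bool (Suc k < K)))
          + 2 * t * total_loss J K S T + 16 * (\<Sum>k\<in>T. ?in k)"
      unfolding total_loss_eq[OF ok] sum_distrib_left sum.distrib[symmetric]
      by (intro sum.cong refl) (simp add: algebra_simps)
    also have "a * (free_between J K S T * (6 * t + 9)) + b * (- 4 * t + 4 + free_pair_below J S T * (10 * t + 9))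
        + (6 * t + 9) * ones_between J K S
        + ((6 * t + 9) * (\<Sum>k\<in>T. of_bool (Suc k = J)) + 2 * t * (\<Sum>k\<in>T. ?in k * (1 + of_bool (Suc k < K)))
          + 2 * t * total_loss J K S T + 16 * (\<Sum>k\<in>T. ?in k)) \<le> ?G S T"
    proof -
      have s1: "(6 * t + 9) * (\<Sum>k\<in>T. of_bool (Suc k = J)) \<le> ?A * 1"
        using t sum_of_bool_eq_le_1[OF fin(2)] by (intro mult_mono) (auto intro: sum_nonneg)
      have "(\<Sum>k\<in>T. ?in k * (1 + of_bool (Suc k < K)))
          \<le> (\<Sum>k\<in>T. of_bool (J \<le> k \<and> k < K) + of_bool (J \<le> Suc k \<and> Suc k < K))"
        by (rule sum_mono) auto
      \<comment> \<open>The vacancy is at least the slack.\<close>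
      also have "\<dots> \<le> real K - real J - t"
        using sum_occupied_cells[OF ok JK(1)] sum_ones_between[OF ok, of J K] ones_between_bounds(1)[of J K S] t JK(1)
        by (simp add: of_nat_diff)
      also have "\<dots> \<le> 2 * b + 1 - t" using JK by simp
      finally have "2 * t * (\<Sum>k\<in>T. ?in k * (1 + of_bool (Suc k < K))) \<le> 2 * t * (2 * b + 1 - t)"
        using t by (intro mult_left_mono) auto
      also have "\<dots> = 4 * b * t + 2 * t - 2 * t\<^sup>2" by (simp add: power2_eq_square algebra_simps)
      finally have s2: "2 * t * (\<Sum>k\<in>T. ?in k * (1 + of_bool (Suc k < K)))
        \<le> 4 * b * t + 2 * real K - 2 * t\<^sup>2" using t by linarith
      have s3: "2 * t * total_loss J K S T \<le> 2 * real K * total_loss J K S T"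
        using t total_loss_nonneg[OF ok] by (intro mult_right_mono) auto
      have "(\<Sum>k\<in>T. ?in k) = real (card (T \<inter> {k. J \<le> k \<and> k < K}))" using fin by simp
      also have "card (T \<inter> {k. J \<le> k \<and> k < K}) \<le> card {..<K}" by (rule card_mono) auto
      finally have s4: "(\<Sum>k\<in>T. ?in k) \<le> real K" by simp
      have s5: "(6 * t + 9) * ones_between J K S \<le> ?A * ones_between J K S"
        using t ones_between_bounds(1) by (intro mult_right_mono) auto
      have s6: "a * (free_between J K S T * (6 * t + 9)) \<le> ?A * (a * free_between J K S T)"
        using t a_pos by (simp add: of_bool_def)
      have s7: "b * (free_pair_below J S T * (10 * t + 9)) \<le> ?B * (b * free_pair_below J S T)"
        using t b_pos by (simp add: of_bool_def)
      have "b * (- 4 * t + 4 + free_pair_below J S T * (10 * t + 9))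
        = - (4 * b * t) + 4 * b + b * (free_pair_below J S T * (10 * t + 9))" by (simp add: algebra_simps)
      then show ?thesis using s1 s2 s3 s4 s5 s6 s7 unfolding t_def[symmetric] distrib_left by linarith
    qed
    finally show "generator a b (\<lambda>S T. (?t S T)\<^sup>2) S T \<le> ?G S T" .
  qed (intro functional_bdds)+
  also have "\<dots> = ?A * (a * Ex (free_between J K) + Ex (\<lambda>S T. ones_between J K S) + 1) + ?B * (b * Ex (free_pair_below J))
      + 2 * real K * Ex (total_loss J K) + (4 * b + 18 * real K) - 2 * Ex (\<lambda>S T. (?t S T)\<^sup>2)"
    by ((subst Ex_diff Ex_add Ex_cmult Ex_const; (intro functional_bdds)?)+) simp
  also have "\<dots> \<le> ?A * (2 * Ex (\<lambda>S T. ones_between J K S) + 1) + ?B * Ex (\<lambda>S T. pairs_below J T)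
      + 2 * real K * Ex (total_loss J K) + (4 * b + 18 * real K) - 2 * Ex (\<lambda>S T. (?t S T)\<^sup>2)"
    using expectation_first_free_le[of J K] expectation_first_pair_le[of J]
    by (intro diff_right_mono add_right_mono add_mono mult_left_mono) auto
  finally show ?thesis by simp
qed

text \<open>Balance for the pairs of marks at distance at most \<open>d = e + 2\<close>. A regular
  shift gains the pairs formed with marks at distance \<open>e + 3\<close> or \<open>e + 4\<close>
  on the right and loses those at distance \<open>e + 1\<close> or \<open>e + 2\<close> on the left;
  in equilibrium gains exceed losses at most by the disturbances. A disturbance touches at most two
  marks and so at most \<open>4 * d\<close> pairs.\<close>

lemma expectation_pair_count:
  fixes J K e :: nat
  defines "d \<equiv> Suc (Suc e)"
  defines "p \<equiv> (\<lambda>j. Ex (\<lambda>S T. pair_count j (marks J K (occ S T))))"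
  shows "p (e + 3) + p (e + 4) \<le> p (e + 1) + p (e + 2)
    + 4 * real d * (2 * Ex (\<lambda>S T. ones_between J K S) + Ex (\<lambda>S T. pairs_below J T) + 1) + 2 * Ex (\<lambda>S T. ones_between J K S)
    + (4 * real d + 2) * (2 + Ex (total_loss J K) + Ex (\<lambda>S T. slack J K (occ S T)))"
proof -
  let ?M = "\<lambda>S T. marks J K (occ S T)"
  let ?q = "\<lambda>j S T. pair_count j (?M S T)"
  let ?C = "\<lambda>S T. close_pairs d (?M S T)"
  let ?G = "\<lambda>S T. 4 * real d * (a * free_between J K S T + b * free_pair_below J S T + ones_between J K S + 1)
    + 2 * ones_between J K S + (4 * real d + 2) * (2 + total_loss J K S T + slack J K (occ S T))
    + (?q (e + 1) S T + ?q (e + 2) S T) - (?q (e + 3) S T + ?q (e + 4) S T)"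
  have "0 \<le> Ex ?G"
  proof (rule drift[where F="\<lambda>S T. - ?C S T"])
    fix S T assume ok: "cells_ok S T"
    then have fin: "finite S" "finite T" by (auto simp: cells_ok_def)
    note dist = mark_dist_transitions[OF ok]
    define M where "M = ?M S T"
    have finM: "finite M" by (simp add: M_def)
    have m: "- ?C S' T' - - ?C S T \<le> 4 * real d * c"
      if "mark_dist J K (occ S' T') (occ S T) \<le> 2 * c" for S' T' c
    proof -
      have "2 * real d * mark_dist J K (occ S' T') (occ S T) \<le> 2 * real d * (2 * c)"
        by (rule mult_left_mono[OF that]) simp
      moreover have "2 * real d * (2 * c) = 4 * real d * c" by simp
      ultimately show ?thesis
        using mark_dist_close_pairs[of d J K "occ S T" "occ S' T'"] by linarith
    qed
    define g :: "nat \<Rightarrow> real" where "g k = of_bool (k + (e + 3) \<in> M) + of_bool (k + (e + 4) \<in> M)" for k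
    define l :: "nat \<Rightarrow> real" where "l k = of_bool (e + 1 \<le> k \<and> k - (e + 1) \<in> M) + of_bool (e + 2 \<le> k \<and> k - (e + 2) \<in> M)" for k
    define w :: "nat \<Rightarrow> real" where "w k = of_bool (\<not> (Suc (Suc k) \<in> occ S T \<and> Suc (Suc k) < K))" for k
    have g: "0 \<le> g k" "g k \<le> 2" and l: "0 \<le> l k" for k
      by (auto simp: g_def l_def)
    \<comment> \<open>Here \<open>g\<close> and \<open>l\<close> are the gains and losses of a
      regular shift and \<open>w\<close> flags irregular departures. The coefficient
      \<open>4 * d + 2\<close> covers the at most \<open>4 * d\<close> changed pairs of an irregular
      departure together with the at most two gains in \<open>g\<close> that are subtracted although
      no shift occurs.\<close>
    have "generator a b (\<lambda>S T. - ?C S T) S T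
      \<le> a * (4 * real d * free_between J K S T) + b * (4 * real d * free_pair_below J S T)
        + (\<Sum>k\<in>S. 4 * real d * of_bool (J \<le> k \<and> k < K))
        + (\<Sum>k\<in>T. 4 * real d * of_bool (Suc k = J)
            + of_bool (k \<in> M) * (l k - g k + (4 * real d + 2) * w k))"
    proof (rule generator_le[OF ok _ _ m[OF dist(1)] m[OF dist(2)] m[OF dist(3)]])
      fix k assume k: "k \<in> T"
      note kC = mem_occ(2,3)[OF k, of S]
      show "- ?C S (T - {k}) - - ?C S T \<le> 4 * real d * of_bool (Suc k = J)
          + of_bool (k \<in> M) * (l k - g k + (4 * real d + 2) * w k)"
      proof (cases "J \<le> k \<and> k < K")
        case in_range: True
        show ?thesis
        proof (cases "odd_gap J (occ S T) k")
          case True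
          then have kM: "k \<in> M" using in_range kC by (simp add: M_def marks_def)
          show ?thesis
          proof (cases "Suc (Suc k) \<in> occ S T \<and> Suc (Suc k) < K")
            case 2: True
            note sh = marks_shift[OF _ kC True, of K]
            have eq: "?M S (T - {k}) = insert (Suc (Suc k)) (M - {k})"
              and "Suc (Suc k) \<notin> M" "Suc k \<notin> M"
              using sh 2 in_range unfolding M_def occ_remove(2)[OF ok k] by auto
            then have "?C S (T - {k}) = ?C S T + g k - l k"
              using close_pairs_shift[OF finM kM, of e] unfolding eq d_def M_def[symmetric] g_def l_def
              by simp
            then show ?thesis using kM by (simp add: w_def 2)
          next
            case 3: False
            have "mark_dist J K (occ S (T - {k})) (occ S T) \<le> 2 * 1"
              using mark_dist_remove_marked[OF _ kC True, of K] in_range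
              by (simp add: occ_remove(2)[OF ok k])
            from m[OF this] show ?thesis using kM 3 g[of k] l[of k] by (simp add: w_def)
          qed
        next
          case False
          then have "k \<notin> M" by (simp add: M_def marks_def)
          moreover have "?M S (T - {k}) = ?M S T"
            using marks_remove_pair_even[OF _ kC False] in_range by (simp add: occ_remove(2)[OF ok k])
          ultimately show ?thesis by simp
        qed
      next
        case False
        then have "k \<notin> M" by (auto simp: M_def marks_def)
        then show ?thesis using m[OF dist(4)[OF k False]] by simp
      qed
    qed (use a_pos b_pos in auto)
    also have "(\<Sum>k\<in>S. 4 * real d * of_bool (J \<le> k \<and> k < K)) = 4 * real d * ones_between J K S"
      by (simp add: sum_distrib_left[symmetric] sum_ones_between[OF ok] del: sum_of_bool_eq)
    also have "(\<Sum>k\<in>T. 4 * real d * of_bool (Suc k = J)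
            + of_bool (k \<in> M) * (l k - g k + (4 * real d + 2) * w k))
        = 4 * real d * (\<Sum>k\<in>T. of_bool (Suc k = J)) + (\<Sum>k\<in>T \<inter> M. l k) - (\<Sum>k\<in>T \<inter> M. g k)
          + (4 * real d + 2) * (\<Sum>k\<in>T \<inter> M. w k)"
    proof -
      have "(\<Sum>k\<in>T. of_bool (k \<in> M) * (l k - g k + (4 * real d + 2) * w k))
        = (\<Sum>k\<in>T \<inter> M. l k - g k + (4 * real d + 2) * w k)"
        by (rule sum.mono_neutral_cong_right) (use fin in auto)
      then show ?thesis
        by (simp add: sum.distrib sum_subtractf sum_distrib_left del: sum_of_bool_eq)
    qed
    also have "a * (4 * real d * free_between J K S T) + b * (4 * real d * free_pair_below J S T)
        + 4 * real d * ones_between J K S + (4 * real d * (\<Sum>k\<in>T. of_bool (Suc k = J))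
          + (\<Sum>k\<in>T \<inter> M. l k) - (\<Sum>k\<in>T \<inter> M. g k)
          + (4 * real d + 2) * (\<Sum>k\<in>T \<inter> M. w k)) \<le> ?G S T"
    proof -
      have s1: "4 * real d * (\<Sum>k\<in>T. of_bool (Suc k = J)) \<le> 4 * real d * 1"
        using sum_of_bool_eq_le_1[OF fin(2)] by (intro mult_left_mono) auto
      have "(\<Sum>k\<in>T \<inter> M. l k) \<le> (\<Sum>k\<in>M. l k)" using l finM by (intro sum_mono2) auto
      also have "\<dots> = ?q (e + 1) S T + ?q (e + 2) S T"
        unfolding l_def sum.distrib M_def pair_count_eq[OF finite_marks] ..
      finally have s2: "(\<Sum>k\<in>T \<inter> M. l k) \<le> ?q (e + 1) S T + ?q (e + 2) S T" .
      \<comment> \<open>Every mark contributes to the pair counts but only marks on 2-items shift; a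
        mark on a 1-item accounts for at most two pairs, hence
        \<open>2 * ones_between\<close>.\<close>
      have "?q (e + 3) S T + ?q (e + 4) S T = (\<Sum>k\<in>M. g k)"
        unfolding g_def sum.distrib M_def pair_count_def ..
      also have "\<dots> = (\<Sum>k\<in>M \<inter> T. g k) + (\<Sum>k\<in>M - T. g k)"
        by (rule sum.Int_Diff[OF finM])
      also have "(\<Sum>k\<in>M - T. g k) \<le> (\<Sum>k\<in>M - T. 2)" by (rule sum_mono) (rule g)
      also have "\<dots> \<le> 2 * ones_between J K S"
        using card_marks_minus_pairs[OF fin(1), of J K T] by (simp add: M_def ones_between_def)
      finally have s3: "?q (e + 3) S T + ?q (e + 4) S T \<le> (\<Sum>k\<in>T \<inter> M. g k) + 2 * ones_between J K S"
        by (simp add: Int_commute)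
      have "(\<Sum>k\<in>T \<inter> M. w k) \<le> 2 + total_loss J K S T + slack J K (occ S T)"
        unfolding w_def M_def by (rule irregular_marks_le[OF ok])
      then have s4: "(4 * real d + 2) * (\<Sum>k\<in>T \<inter> M. w k)
          \<le> (4 * real d + 2) * (2 + total_loss J K S T + slack J K (occ S T))"
        by (intro mult_left_mono) auto
      have "a * (4 * real d * free_between J K S T) = 4 * real d * (a * free_between J K S T)"
        "b * (4 * real d * free_pair_below J S T) = 4 * real d * (b * free_pair_below J S T)" by simp_all
      then show ?thesis using s1 s2 s3 s4 unfolding distrib_left[of "4 * real d"] by linarith
    qed
    finally show "generator a b (\<lambda>S T. - ?C S T) S T \<le> ?G S T" .
  qed (intro functional_bdds bdd_pair_count bdd_close_pairs)+
  also have "\<dots> = 4 * real d * (a * Ex (free_between J K) + b * Ex (free_pair_below J) + Ex (\<lambda>S T. ones_between J K S) + 1)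
    + 2 * Ex (\<lambda>S T. ones_between J K S) + (4 * real d + 2) * (2 + Ex (total_loss J K) + Ex (\<lambda>S T. slack J K (occ S T)))
    + (p (e + 1) + p (e + 2)) - (p (e + 3) + p (e + 4))"
    unfolding p_def
    by ((subst Ex_diff Ex_add Ex_cmult Ex_const; (intro functional_bdds bdd_pair_count)?)+) simp
  also have "\<dots> \<le> 4 * real d * (2 * Ex (\<lambda>S T. ones_between J K S) + Ex (\<lambda>S T. pairs_below J T) + 1)
    + 2 * Ex (\<lambda>S T. ones_between J K S) + (4 * real d + 2) * (2 + Ex (total_loss J K) + Ex (\<lambda>S T. slack J K (occ S T)))
    + (p (e + 1) + p (e + 2)) - (p (e + 3) + p (e + 4))"
    using expectation_first_free_le[of J K] expectation_first_pair_le[of J]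
    by (intro diff_right_mono add_right_mono mult_left_mono) auto
  finally show ?thesis by simp
qed

lemma expectation_card_marks:
  assumes "0 < d"
  shows "Ex (\<lambda>S T. real (card (marks J K (occ S T))))
    \<le> (\<Sum>j<d. Ex (\<lambda>S T. pair_count (Suc j) (marks J K (occ S T)))) + (real K / real d + 1)"
proof -
  have "Ex (\<lambda>S T. real (card (marks J K (occ S T))))
      \<le> Ex (\<lambda>S T. close_pairs d (marks J K (occ S T)) + (real K / real d + 1))"
  proof (rule Ex_mono)
    show "real (card (marks J K (occ S T))) \<le> close_pairs d (marks J K (occ S T)) + (real K / real d + 1)" for S T
    proof -
      have "marks J K (occ S T) \<subseteq> {..<K}" by (auto simp: marks_def)
      from card_le_close_pairs[OF this assms] show ?thesis by simp
    qed
  qed (intro functional_bdds bdd_close_pairs)+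
  also have "\<dots> = Ex (\<lambda>S T. close_pairs d (marks J K (occ S T))) + (real K / real d + 1)"
    by (subst Ex_add; (intro functional_bdds bdd_close_pairs)?) (simp only: Ex_const)
  also have "Ex (\<lambda>S T. close_pairs d (marks J K (occ S T)))
      = (\<Sum>j<d. Ex (\<lambda>S T. pair_count (Suc j) (marks J K (occ S T))))"
    unfolding close_pairs_def by (rule Ex_sum) (rule bdd_pair_count)
  finally show ?thesis .
qed

end

section \<open>Comparing cell and item counts\<close>

lemma pairs_below_le_pairs_within:
  assumes "K \<le> J"
  shows "pairs_below J T \<le> pairs_within K T + (real J - real K + 1)"
proof -
  have "T \<inter> {..<J} \<subseteq> {k \<in> T. Suc k < K} \<union> {K - 1..<J}" by auto
  moreover have "finite {k \<in> T. Suc k < K}" by (rule finite_subset[of _ "{..<K}"]) auto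
  ultimately have "card (T \<inter> {..<J}) \<le> card ({k \<in> T. Suc k < K} \<union> {K - 1..<J})"
    by (intro card_mono) auto
  also have "\<dots> \<le> card {k \<in> T. Suc k < K} + card {K - 1..<J}" by (rule card_Un_le)
  also have "card {K - 1..<J} \<le> J - K + 1" by simp
  finally have "card (T \<inter> {..<J}) \<le> card {k \<in> T. Suc k < K} + (J - K + 1)" by simp
  then have "real (card (T \<inter> {..<J})) \<le> real (card {k \<in> T. Suc k < K}) + real (J - K + 1)"
    by (metis of_nat_add of_nat_le_iff)
  with assms show ?thesis by (simp add: pairs_below_def pairs_within_def of_nat_diff)
qed

lemma vacant_le_vacant:
  assumes "K \<le> J"
  shows "vacant 0 J C \<le> vacant 0 K C + (real J - real K)"
proof -
  have "{0..<J} - C \<subseteq> ({0..<K} - C) \<union> {K..<J}" by auto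
  then have "card ({0..<J} - C) \<le> card (({0..<K} - C) \<union> {K..<J})" by (intro card_mono) auto
  also have "\<dots> \<le> card ({0..<K} - C) + card {K..<J}" by (rule card_Un_le)
  finally show ?thesis using assms by (simp add: vacant_def of_nat_diff)
qed

lemma ones_between_split:
  assumes "J \<le> K"
  shows "ones_between 0 K S = ones_between 0 J S + ones_between J K S"
proof -
  have "S \<inter> {0..<K} = (S \<inter> {0..<J}) \<union> (S \<inter> {J..<K})" using assms by auto
  moreover have "card ((S \<inter> {0..<J}) \<union> (S \<inter> {J..<K})) = card (S \<inter> {0..<J}) + card (S \<inter> {J..<K})"
    by (rule card_Un_disjoint) auto
  ultimately show ?thesis by (simp add: ones_between_def)
qed

text \<open>Counting cells in three ways. The \<open>- 1\<close> in the second bound is the cell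
  below \<open>K\<close> of a 2-item that straddles \<open>K\<close>, which
  \<open>pairs_within\<close> does not count.\<close>

lemma packing:
  assumes ok: "cells_ok S T" and JK: "J \<le> K"
  shows "real J - vacant 0 J (occ S T) - 2 * pairs_below J T \<le> ones_between 0 J S"
    and "real K - real J - vacant J K (occ S T) - ones_between J K S - 1 \<le> 2 * pairs_within K T"
    and "2 * pairs_within K T + ones_between 0 K S \<le> real K"
proof -
  have fin: "finite T" using ok by (simp add: cells_ok_def)
  have low: "(\<Sum>k\<in>T. of_bool (k < J)) = pairs_below J T"
  proof -
    have "T \<inter> {k. k < J} = T \<inter> {..<J}" by auto
    with fin show ?thesis by (simp add: sum_of_bool_eq pairs_below_def)
  qed
  have pw: "(\<Sum>k\<in>T. of_bool (Suc k < K)) = pairs_within K T"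
    using fin by (simp add: pairs_within_def sum_of_bool_eq Collect_conj_eq)
  have "(\<Sum>k\<in>T. of_bool (0 \<le> k \<and> k < J) + of_bool (0 \<le> Suc k \<and> Suc k < J)) \<le> (\<Sum>k\<in>T. 2 * of_bool (k < J) :: real)"
    by (rule sum_mono) auto
  also have "\<dots> = 2 * pairs_below J T" by (simp add: sum_distrib_left[symmetric] low del: sum_of_bool_eq)
  finally show "real J - vacant 0 J (occ S T) - 2 * pairs_below J T \<le> ones_between 0 J S"
    using sum_occupied_cells[OF ok, of 0 J] sum_ones_between[OF ok, of 0 J] by simp
  have "(\<Sum>k\<in>T. of_bool (J \<le> k \<and> k < K) + of_bool (J \<le> Suc k \<and> Suc k < K))
      \<le> (\<Sum>k\<in>T. 2 * of_bool (Suc k < K) + of_bool (Suc k = K) :: real)"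
    by (rule sum_mono) auto
  also have "\<dots> \<le> 2 * pairs_within K T + 1"
    using sum_of_bool_eq_le_1[OF fin, of K]
    by (simp add: sum.distrib sum_distrib_left[symmetric] pw del: sum_of_bool_eq)
  finally show "real K - real J - vacant J K (occ S T) - ones_between J K S - 1 \<le> 2 * pairs_within K T"
    using sum_occupied_cells[OF ok JK] sum_ones_between[OF ok, of J K] JK by (simp add: of_nat_diff)
  have "2 * pairs_within K T = (\<Sum>k\<in>T. 2 * of_bool (Suc k < K))"
    by (simp add: sum_distrib_left[symmetric] pw del: sum_of_bool_eq)
  also have "\<dots> \<le> (\<Sum>k\<in>T. of_bool (0 \<le> k \<and> k < K) + of_bool (0 \<le> Suc k \<and> Suc k < K))"
    by (rule sum_mono) auto
  finally show "2 * pairs_within K T + ones_between 0 K S \<le> real K"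
    using sum_occupied_cells[OF ok, of 0 K] sum_ones_between[OF ok, of 0 K] vacant_bounds(1)[of 0 K "occ S T"] by simp
qed

section \<open>Scaling limit\<close>

locale scaled_cells =
  fixes p1 p2 :: real and \<nu> :: "real \<Rightarrow> (nat set \<times> nat set) pmf"
  assumes p1: "0 < p1" and p2: "0 < p2" and sum_1: "p1 + p2 = 1"
    and stationary: "\<And>r. 0 < r \<Longrightarrow> stationary_cells (p1 * r) (p2 * r) (\<nu> r)"
begin

abbreviation E :: "real \<Rightarrow> (nat set \<Rightarrow> nat set \<Rightarrow> real) \<Rightarrow> real" where
  "E r \<equiv> stationary_cells.Ex (\<nu> r)"

definition J :: "real \<Rightarrow> nat" where "J r = nat \<lfloor>p1 * r\<rfloor>"

definition K :: "real \<Rightarrow> nat" where "K r = nat \<lfloor>p1 * r + 2 * p2 * r\<rfloor>"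

definition sublinear :: "(real \<Rightarrow> real) \<Rightarrow> bool" where
  "sublinear f \<longleftrightarrow> ((\<lambda>r. f r / r) \<longlongrightarrow> 0) at_top"

lemma sublinear_const [intro]: "sublinear (\<lambda>r. c)"
  unfolding sublinear_def by (rule tendsto_divide_0[OF tendsto_const]) (simp add: filterlim_at_top_imp_at_infinity filterlim_ident)

lemma sublinear_add [intro]: "sublinear f \<Longrightarrow> sublinear g \<Longrightarrow> sublinear (\<lambda>r. f r + g r)"
  unfolding sublinear_def add_divide_distrib using tendsto_add[of _ 0 _ _ 0] by simp

lemma sublinear_cmult [intro]: "sublinear f \<Longrightarrow> sublinear (\<lambda>r. c * f r)"
  unfolding sublinear_def using tendsto_mult[OF tendsto_const[of c], of "\<lambda>r. f r / r" 0] by simp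

lemma sublinear_sum [intro]: "(\<And>i. i \<in> I \<Longrightarrow> sublinear (f i)) \<Longrightarrow> sublinear (\<lambda>r. \<Sum>i\<in>I. f i r)"
  by (induction I rule: infinite_finite_induct) auto

lemma sublinear_le:
  assumes "sublinear g" "\<And>r. 1 \<le> r \<Longrightarrow> 0 \<le> f r" "\<And>r. 1 \<le> r \<Longrightarrow> f r \<le> g r"
  shows "sublinear f"
  unfolding sublinear_def
proof (rule tendsto_sandwich[OF _ _ tendsto_const])
  show "((\<lambda>r. g r / r) \<longlongrightarrow> 0) at_top" using assms(1) by (simp add: sublinear_def)
  show "\<forall>\<^sub>F r in at_top. 0 \<le> f r / r" "\<forall>\<^sub>F r in at_top. f r / r \<le> g r / r"
    using eventually_ge_at_top[of "1::real"]
    by (eventually_elim, simp add: assms divide_right_mono)+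
qed

lemma sublinearI:
  assumes "\<And>r. 1 \<le> r \<Longrightarrow> 0 \<le> f r"
    and "\<And>\<epsilon>. 0 < \<epsilon> \<Longrightarrow> \<epsilon> < p1 \<Longrightarrow> \<exists>g. sublinear g \<and> (\<forall>r\<ge>1. f r \<le> \<epsilon> * r + g r)"
  shows "sublinear f"
  unfolding sublinear_def
proof (rule tendstoI)
  fix e :: real assume e: "0 < e"
  define \<epsilon> where "\<epsilon> = min (e / 2) (p1 / 2)"
  have \<epsilon>: "0 < \<epsilon>" "\<epsilon> < p1" "\<epsilon> \<le> e / 2" using e p1 by (auto simp: \<epsilon>_def)
  then obtain g where g: "sublinear g" "\<And>r. 1 \<le> r \<Longrightarrow> f r \<le> \<epsilon> * r + g r" using assms(2) by blast
  have "\<forall>\<^sub>F r in at_top. dist (g r / r) 0 < e / 2"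
    using g(1) e unfolding sublinear_def by (intro tendstoD) auto
  then show "\<forall>\<^sub>F r in at_top. dist (f r / r) 0 < e"
    using eventually_ge_at_top[of "1::real"]
  proof eventually_elim
    case (elim r)
    have "f r / r \<le> \<epsilon> + g r / r" using g(2)[OF elim(2)] elim(2) by (simp add: field_simps)
    moreover have "0 \<le> f r / r" using assms(1) elim by simp
    moreover have "g r / r \<le> dist (g r / r) 0" by (simp only: dist_real_def diff_zero abs_ge_self)
    ultimately have "f r / r < e" using elim(1) \<epsilon>(3) by linarith
    with \<open>0 \<le> f r / r\<close> show ?case by (simp only: dist_real_def diff_zero abs_of_nonneg)
  qed
qed

lemma J_bounds:
  assumes "0 < r"
  shows "real (J r) \<le> p1 * r" "p1 * r - 1 \<le> real (J r)"
proof -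
  have "0 \<le> p1 * r" using p1 assms by simp
  then show "real (J r) \<le> p1 * r" "p1 * r - 1 \<le> real (J r)" unfolding J_def by linarith+
qed

lemma K_bounds:
  assumes "0 < r"
  shows "real (K r) \<le> p1 * r + 2 * p2 * r" "p1 * r + 2 * p2 * r - 1 \<le> real (K r)"
    "J r \<le> K r" "real (K r) \<le> 2 * r"
proof -
  have "0 \<le> p1 * r" "0 \<le> p2 * r" using p1 p2 assms by auto
  then show K: "real (K r) \<le> p1 * r + 2 * p2 * r" and "p1 * r + 2 * p2 * r - 1 \<le> real (K r)"
    unfolding K_def by linarith+
  show "J r \<le> K r" unfolding J_def K_def using \<open>0 \<le> p2 * r\<close> by (intro nat_mono floor_mono) simp
  have "p1 * r + 2 * p2 * r = 2 * ((p1 + p2) * r) - p1 * r" by (simp add: algebra_simps)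
  with K \<open>0 \<le> p1 * r\<close> show "real (K r) \<le> 2 * r" unfolding sum_1 by simp
qed

text \<open>The restoring drift vanishes at \<open>J\<close> itself, so the estimates are made at a
  level \<open>L\<close> lower by about \<open>\<epsilon> * r\<close>, where the arrival rate of
  1-items exceeds \<open>L\<close> by at least \<open>\<epsilon> * r\<close>. The cells between
  \<open>L\<close> and \<open>J\<close> cost \<open>\<epsilon> * r\<close> plus rounding. The
  constants come from \<open>p1 * r + 2 * L \<le> 3 * r\<close> and
  \<open>2 * (p1 * r + p2 * r + L) + p2 * r \<le> 5 * r\<close>.\<close>

lemma expectation_below:
  assumes \<epsilon>: "0 < \<epsilon>" "\<epsilon> < p1" and r: "1 \<le> r"
  shows "E r (\<lambda>S T. vacant 0 (J r) (occ S T)) \<le> \<epsilon> * r + (3 / (2 * \<epsilon>) + 1)"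
    and "E r (\<lambda>S T. pairs_below (J r) T) \<le> \<epsilon> * r + (15 / (2 * \<epsilon>\<^sup>2) + 2)"
proof -
  interpret stationary_cells "p1 * r" "p2 * r" "\<nu> r" by (rule stationary) (use r in simp)
  define L where "L = nat \<lfloor>(p1 - \<epsilon>) * r\<rfloor>"
  have pos: "0 \<le> (p1 - \<epsilon>) * r" "0 \<le> \<epsilon> * r" "0 \<le> p2 * r" using \<epsilon> p2 r by auto
  have L: "real L \<le> (p1 - \<epsilon>) * r" "(p1 - \<epsilon>) * r - 1 \<le> real L"
    using pos unfolding L_def by linarith+
  have LJ: "L \<le> J r" unfolding L_def J_def using \<epsilon> r by (intro nat_mono floor_mono mult_right_mono) auto
  have gap: "\<epsilon> * r \<le> p1 * r - real L" using L by (simp add: algebra_simps)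
  have r_eq: "p1 * r + p2 * r = r" using sum_1 by (metis distrib_right mult_1)
  have Ls: "real L \<le> r" "p1 * r \<le> r" "p2 * r \<le> r" using L(1) pos r_eq by (auto simp: algebra_simps)
  have V0: "0 \<le> Ex (V L)" by (rule Ex_nonneg) (rule vacant_bounds)
  have N0: "0 \<le> Ex (\<lambda>S T. pairs_within L T)" by (rule Ex_nonneg) (rule pairs_within_bounds)
  have "2 * (\<epsilon> * r) * Ex (V L) \<le> 2 * (p1 * r - real L) * Ex (V L)"
    using gap V0 by (intro mult_right_mono mult_left_mono) auto
  also have "\<dots> \<le> p1 * r + 2 * real L" by (rule expectation_vacant)
  also have "\<dots> \<le> 3 * r" using Ls by linarith
  finally have VL: "Ex (V L) \<le> 3 / (2 * \<epsilon>)" using \<epsilon> r by (simp add: field_simps)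
  have "(\<epsilon> * r) * Ex (\<lambda>S T. pairs_within L T) \<le> (p1 * r - real L) * Ex (\<lambda>S T. pairs_within L T)"
    using gap N0 by (intro mult_right_mono) auto
  also have "\<dots> \<le> (2 * (p1 * r + p2 * r + real L) + p2 * r) * Ex (V L)"
    by (rule expectation_pairs_within_le)
  also have "\<dots> \<le> (5 * r) * Ex (V L)" using Ls r_eq V0 by (intro mult_right_mono) auto
  also have "\<dots> \<le> (5 * r) * (3 / (2 * \<epsilon>))" using VL r by (intro mult_left_mono) auto
  finally have NL: "Ex (\<lambda>S T. pairs_within L T) \<le> 15 / (2 * \<epsilon>\<^sup>2)"
    using \<epsilon> r by (simp add: field_simps power2_eq_square)
  have JL: "real (J r) - real L \<le> \<epsilon> * r + 1" using J_bounds[of r] L r by (simp add: algebra_simps)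
  have "Ex (V (J r)) \<le> Ex (\<lambda>S T. V L S T + (real (J r) - real L))"
    by (intro Ex_mono bdds vacant_le_vacant LJ)
  also have "\<dots> = Ex (V L) + (real (J r) - real L)"
    by (subst Ex_add; (intro bdds)?) (simp only: Ex_const)
  finally show "Ex (V (J r)) \<le> \<epsilon> * r + (3 / (2 * \<epsilon>) + 1)" using VL JL by linarith
  have "Ex (\<lambda>S T. pairs_below (J r) T) \<le> Ex (\<lambda>S T. pairs_within L T + (real (J r) - real L + 1))"
    by (intro Ex_mono functional_bdds pairs_below_le_pairs_within LJ)
  also have "\<dots> = Ex (\<lambda>S T. pairs_within L T) + (real (J r) - real L + 1)"
    by (subst Ex_add; (intro bdds)?) (simp only: Ex_const)
  finally show "Ex (\<lambda>S T. pairs_below (J r) T) \<le> \<epsilon> * r + (15 / (2 * \<epsilon>\<^sup>2) + 2)" using NL JL by linarith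
qed

lemma E_nonneg:
  assumes "1 \<le> r" "\<And>S T. cells_ok S T \<Longrightarrow> 0 \<le> F S T"
  shows "0 \<le> E r F"
proof -
  interpret stationary_cells "p1 * r" "p2 * r" "\<nu> r" by (rule stationary) (use assms in simp)
  show ?thesis by (rule Ex_nonneg) (rule assms)
qed

lemma sublinear_vacant: "sublinear (\<lambda>r. E r (\<lambda>S T. vacant 0 (J r) (occ S T)))"
proof (rule sublinearI)
  fix \<epsilon> :: real assume "0 < \<epsilon>" "\<epsilon> < p1"
  then show "\<exists>g. sublinear g \<and> (\<forall>r\<ge>1. E r (\<lambda>S T. vacant 0 (J r) (occ S T)) \<le> \<epsilon> * r + g r)"
    using expectation_below(1) by blast
qed (intro E_nonneg vacant_bounds)

lemma sublinear_pairs_below: "sublinear (\<lambda>r. E r (\<lambda>S T. pairs_below (J r) T))"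
proof (rule sublinearI)
  fix \<epsilon> :: real assume "0 < \<epsilon>" "\<epsilon> < p1"
  then show "\<exists>g. sublinear g \<and> (\<forall>r\<ge>1. E r (\<lambda>S T. pairs_below (J r) T) \<le> \<epsilon> * r + g r)"
    using expectation_below(2) by blast
qed (intro E_nonneg pairs_below_bounds)

lemma expectation_ones_between_J:
  assumes r: "1 \<le> r"
  shows "real (J r) - E r (\<lambda>S T. vacant 0 (J r) (occ S T)) - 2 * E r (\<lambda>S T. pairs_below (J r) T)
    \<le> E r (\<lambda>S T. ones_between 0 (J r) S)"
proof -
  interpret stationary_cells "p1 * r" "p2 * r" "\<nu> r" by (rule stationary) (use r in simp)
  have "Ex (\<lambda>S T. real (J r) - V (J r) S T - 2 * pairs_below (J r) T) \<le> Ex (\<lambda>S T. ones_between 0 (J r) S)"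
    by (intro Ex_mono functional_bdds packing(1)) auto
  moreover have "Ex (\<lambda>S T. real (J r) - V (J r) S T - 2 * pairs_below (J r) T)
      = real (J r) - Ex (V (J r)) - 2 * Ex (\<lambda>S T. pairs_below (J r) T)"
    by ((subst Ex_diff; (intro functional_bdds)?)+) (simp only: Ex_cmult Ex_const)
  ultimately show ?thesis by linarith
qed

text \<open>The mean number of all 1-items below \<open>K\<close> is at most \<open>p1 * r\<close>,
  and up to o(r) this many already lie below \<open>J\<close>.\<close>

lemma sublinear_ones_between: "sublinear (\<lambda>r. E r (\<lambda>S T. ones_between (J r) (K r) S))"
proof (rule sublinear_le)
  show "sublinear (\<lambda>r. 1 + E r (\<lambda>S T. vacant 0 (J r) (occ S T)) + 2 * E r (\<lambda>S T. pairs_below (J r) T))"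
    by (intro sublinear_add sublinear_const sublinear_cmult sublinear_vacant sublinear_pairs_below)
  fix r :: real assume r: "1 \<le> r"
  interpret stationary_cells "p1 * r" "p2 * r" "\<nu> r" by (rule stationary) (use r in simp)
  show "0 \<le> Ex (\<lambda>S T. ones_between (J r) (K r) S)" by (intro Ex_nonneg ones_between_bounds)
  have "Ex (\<lambda>S T. ones_between 0 (J r) S) + Ex (\<lambda>S T. ones_between (J r) (K r) S) = Ex (\<lambda>S T. ones_between 0 (K r) S)"
    using ones_between_split[OF K_bounds(3)] r by (subst Ex_add[symmetric]; (intro functional_bdds)?) simp
  also have "\<dots> \<le> p1 * r" by (rule expectation_ones_between_le)
  finally show "Ex (\<lambda>S T. ones_between (J r) (K r) S)
      \<le> 1 + Ex (V (J r)) + 2 * Ex (\<lambda>S T. pairs_below (J r) T)"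
    using expectation_ones_between_J[OF r] J_bounds[of r] r by linarith
qed

lemma sublinear_total_loss: "sublinear (\<lambda>r. E r (total_loss (J r) (K r)))"
proof (rule sublinear_le)
  show "sublinear (\<lambda>r. 4 * E r (\<lambda>S T. ones_between (J r) (K r) S) + 2 * E r (\<lambda>S T. pairs_below (J r) T) + 2)"
    by (intro sublinear_add sublinear_const sublinear_cmult sublinear_ones_between sublinear_pairs_below)
  fix r :: real assume r: "1 \<le> r"
  interpret stationary_cells "p1 * r" "p2 * r" "\<nu> r" by (rule stationary) (use r in simp)
  show "0 \<le> Ex (total_loss (J r) (K r))" by (intro Ex_nonneg total_loss_nonneg)
  show "Ex (total_loss (J r) (K r))
      \<le> 4 * Ex (\<lambda>S T. ones_between (J r) (K r) S) + 2 * Ex (\<lambda>S T. pairs_below (J r) T) + 2"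
    by (rule expectation_total_loss)
qed

text \<open>The mean square of the slack is bounded by \<open>r\<close> times a sublinear function,
  hence is of smaller order than \<open>r * r\<close>; Jensen's inequality gives the mean.\<close>

lemma sublinear_slack: "sublinear (\<lambda>r. E r (\<lambda>S T. slack (J r) (K r) (occ S T)))"
proof -
  let ?n = "\<lambda>r. E r (\<lambda>S T. ones_between (J r) (K r) S)" and ?l = "\<lambda>r. E r (\<lambda>S T. pairs_below (J r) T)"
    and ?x = "\<lambda>r. E r (total_loss (J r) (K r))" and ?t = "\<lambda>r. E r (\<lambda>S T. slack (J r) (K r) (occ S T))"
  \<comment> \<open>The numbers are those of \<open>expectation_slack\<close> after
    \<open>K r \<le> 2 * r\<close> and \<open>1 \<le> r\<close>: \<open>6 * 2 + 9\<close>,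
    \<open>10 * 2 + 9\<close>, \<open>2 * 2\<close> and \<open>4 + 18 * 2\<close>.\<close>
  define g where "g r = 21 * (2 * ?n r + 1) + 29 * ?l r + 4 * ?x r + 40" for r
  have g: "sublinear g" unfolding g_def
    by (intro sublinear_add sublinear_const sublinear_cmult sublinear_ones_between sublinear_pairs_below sublinear_total_loss)
  have le: "(?t r / r)\<^sup>2 \<le> g r / r" if r: "1 \<le> r" for r
  proof -
    interpret stationary_cells "p1 * r" "p2 * r" "\<nu> r" by (rule stationary) (use r in simp)
    have r0: "0 < r" using r by simp
    note K = K_bounds[OF r0] and J = J_bounds[OF r0]
    have pos: "0 \<le> ?n r" "0 \<le> ?l r" "0 \<le> ?x r"
      by (intro E_nonneg r ones_between_bounds pairs_below_bounds total_loss_nonneg; assumption)+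
    have "(?t r)\<^sup>2 \<le> 2 * Ex (\<lambda>S T. (slack (J r) (K r) (occ S T))\<^sup>2)"
      using Ex_square_le[OF bdd_slack, of "J r" "K r" occ] zero_le_power2[of "?t r"] by linarith
    also have "\<dots> \<le> (6 * real (K r) + 9) * (2 * ?n r + 1) + (10 * real (K r) + 9) * ?l r
      + 2 * real (K r) * ?x r + (4 * (p2 * r) + 18 * real (K r))"
      by (rule expectation_slack) (use K J in linarith)+
    also have "\<dots> \<le> (21 * r) * (2 * ?n r + 1) + (29 * r) * ?l r + (4 * r) * ?x r + (40 * r)"
    proof (intro add_mono mult_right_mono)
      have "p2 * r \<le> 1 * r" using sum_1 p1 r0 by (intro mult_right_mono) auto
      then show "4 * (p2 * r) + 18 * real (K r) \<le> 40 * r" using K(4) by simp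
    qed (use K(4) r pos in auto)
    also have "\<dots> = r * g r" by (simp add: g_def algebra_simps)
    finally have "(?t r)\<^sup>2 / r\<^sup>2 \<le> r * g r / r\<^sup>2" by (rule divide_right_mono) simp
    also have "r * g r / r\<^sup>2 = g r / r" using r0 by (simp add: power2_eq_square)
    finally show ?thesis by (simp only: power_divide)
  qed
  have "((\<lambda>r. (?t r / r)\<^sup>2) \<longlongrightarrow> 0) at_top"
  proof (rule tendsto_sandwich[OF _ _ tendsto_const])
    show "((\<lambda>r. g r / r) \<longlongrightarrow> 0) at_top" using g by (simp add: sublinear_def)
    show "\<forall>\<^sub>F r in at_top. (?t r / r)\<^sup>2 \<le> g r / r"
      using eventually_ge_at_top[of "1::real"] by eventually_elim (rule le)
  qed simp
  then show ?thesis unfolding sublinear_def by simp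
qed

text \<open>The balance links two consecutive distances with the next two, so the induction treats
  \<open>2 * i + 1\<close> and \<open>2 * i + 2\<close> together. At distance 1 there are no pairs,
  and at distance 2 at most one for each 1-item in the window.\<close>

lemma sublinear_pair_count:
  assumes "0 < j"
  shows "sublinear (\<lambda>r. E r (\<lambda>S T. pair_count j (marks (J r) (K r) (occ S T))))"
proof -
  let ?p = "\<lambda>j r. E r (\<lambda>S T. pair_count j (marks (J r) (K r) (occ S T)))"
  have p0: "0 \<le> ?p j r" if "1 \<le> r" for j r
    by (intro E_nonneg that) (simp add: pair_count_def sum_nonneg)
  have step: "sublinear (\<lambda>r. ?p (2 * i + 1) r + ?p (2 * i + 2) r)" for i
  proof (induction i)
    case 0
    show ?case
    proof (rule sublinear_le[OF sublinear_ones_between])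
      fix r :: real assume r: "1 \<le> r"
      interpret stationary_cells "p1 * r" "p2 * r" "\<nu> r" by (rule stationary) (use r in simp)
      show "0 \<le> ?p (2 * 0 + 1) r + ?p (2 * 0 + 2) r" using p0[OF r] by (intro add_nonneg_nonneg)
      have "?p 2 r \<le> Ex (\<lambda>S T. ones_between (J r) (K r) S)"
        by (intro Ex_mono bdd_pair_count functional_bdds pair_count_marks_2) (simp add: cells_ok_def)
      moreover have "?p 1 r = 0" by (simp only: pair_count_marks_1 Ex_const)
      ultimately show "?p (2 * 0 + 1) r + ?p (2 * 0 + 2) r \<le> Ex (\<lambda>S T. ones_between (J r) (K r) S)"
        by (simp only: mult_0_right add_0)
    qed
  next
    case (Suc i)
    define d where "d = Suc (Suc (2 * i))"
    show ?case
    proof (rule sublinear_le)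
      show "sublinear (\<lambda>r. (?p (2 * i + 1) r + ?p (2 * i + 2) r)
        + 4 * real d * (2 * E r (\<lambda>S T. ones_between (J r) (K r) S) + E r (\<lambda>S T. pairs_below (J r) T) + 1)
        + 2 * E r (\<lambda>S T. ones_between (J r) (K r) S)
        + (4 * real d + 2) * (2 + E r (total_loss (J r) (K r)) + E r (\<lambda>S T. slack (J r) (K r) (occ S T))))"
        by (intro sublinear_add sublinear_cmult sublinear_const sublinear_ones_between sublinear_pairs_below
            sublinear_total_loss sublinear_slack Suc.IH)
      fix r :: real assume r: "1 \<le> r"
      interpret stationary_cells "p1 * r" "p2 * r" "\<nu> r" by (rule stationary) (use r in simp)
      show "0 \<le> ?p (2 * Suc i + 1) r + ?p (2 * Suc i + 2) r" using p0[OF r] by (intro add_nonneg_nonneg)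
      have "2 * Suc i + 1 = 2 * i + 3" "2 * Suc i + 2 = 2 * i + 4" by simp_all
      then show "?p (2 * Suc i + 1) r + ?p (2 * Suc i + 2) r
        \<le> (?p (2 * i + 1) r + ?p (2 * i + 2) r)
        + 4 * real d * (2 * E r (\<lambda>S T. ones_between (J r) (K r) S) + E r (\<lambda>S T. pairs_below (J r) T) + 1)
        + 2 * E r (\<lambda>S T. ones_between (J r) (K r) S)
        + (4 * real d + 2) * (2 + E r (total_loss (J r) (K r)) + E r (\<lambda>S T. slack (J r) (K r) (occ S T)))"
        using expectation_pair_count[of "2 * i" "J r" "K r"] unfolding d_def by (simp only:)
    qed
  qed
  define i where "i = (j - 1) div 2"
  have j: "j = 2 * i + 1 \<or> j = 2 * i + 2" using assms unfolding i_def by presburger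
  show ?thesis
  proof (rule sublinear_le[OF step[of i]])
    fix r :: real assume r: "1 \<le> r"
    show "0 \<le> ?p j r" by (rule p0[OF r])
    show "?p j r \<le> ?p (2 * i + 1) r + ?p (2 * i + 2) r"
      using j p0[OF r, of "2 * i + 1"] p0[OF r, of "2 * i + 2"] by auto
  qed
qed

lemma sublinear_card_marks: "sublinear (\<lambda>r. E r (\<lambda>S T. real (card (marks (J r) (K r) (occ S T)))))"
proof (rule sublinearI)
  fix \<epsilon> :: real assume \<epsilon>: "0 < \<epsilon>"
  let ?p = "\<lambda>j r. E r (\<lambda>S T. pair_count (Suc j) (marks (J r) (K r) (occ S T)))"
  \<comment> \<open>As \<open>K r \<le> 2 * r\<close>, this makes the contribution
    \<open>K r / d\<close> of isolated marks at most \<open>\<epsilon> * r\<close>.\<close>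
  obtain d :: nat where "2 / \<epsilon> < real d" using reals_Archimedean2 by blast
  moreover have "0 < 2 / \<epsilon>" using \<epsilon> by simp
  ultimately have d: "0 < d" by (metis of_nat_0_less_iff less_trans)
  with \<open>2 / \<epsilon> < real d\<close> \<epsilon> have d2: "2 / real d \<le> \<epsilon>" by (simp add: field_simps)
  have "E r (\<lambda>S T. real (card (marks (J r) (K r) (occ S T)))) \<le> \<epsilon> * r + ((\<Sum>j<d. ?p j r) + 1)"
    if r: "1 \<le> r" for r
  proof -
    interpret stationary_cells "p1 * r" "p2 * r" "\<nu> r" by (rule stationary) (use r in simp)
    have "real (K r) / real d \<le> 2 * r / real d" using K_bounds(4)[of r] r by (intro divide_right_mono) auto
    also have "\<dots> = 2 / real d * r" by simp
    also have "\<dots> \<le> \<epsilon> * r" using d2 r by (intro mult_right_mono) auto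
    finally show ?thesis using expectation_card_marks[OF d, of "J r" "K r"] by linarith
  qed
  moreover have "sublinear (\<lambda>r. (\<Sum>j<d. ?p j r) + 1)"
    by (intro sublinear_add sublinear_sum sublinear_const sublinear_pair_count) simp
  ultimately show "\<exists>g. sublinear g \<and> (\<forall>r\<ge>1. E r (\<lambda>S T. real (card (marks (J r) (K r) (occ S T)))) \<le> \<epsilon> * r + g r)"
    by blast
qed (intro E_nonneg; simp)

text \<open>The distance of the scaled vector of counts to its limit is at most \<open>deviation r / r\<close>.\<close>

definition deviation :: "real \<Rightarrow> nat set \<Rightarrow> nat set \<Rightarrow> real" where
  "deviation r S T = 2 * (p1 * r - ones_between 0 (J r) S) + (p2 * r - pairs_within (K r) T)"

text \<open>The number of 1-items below \<open>J r\<close> never exceeds \<open>p1 * r\<close>, but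
  the number of 2-items may exceed \<open>p2 * r\<close>. Lack of room limits that excess to half
  the shortfall of 1-items, so replacing its absolute value by the signed difference costs one
  further shortfall; hence the factor 2 in \<open>deviation\<close>.\<close>

lemma deviation_bounds:
  assumes "cells_ok S T" "0 < r"
  shows "\<bar>ones_between 0 (J r) S - p1 * r\<bar> + \<bar>pairs_within (K r) T - p2 * r\<bar> \<le> deviation r S T"
proof -
  have "ones_between 0 (J r) S \<le> real (J r)"
    using ones_between_bounds(2) by simp
  then have 1: "ones_between 0 (J r) S \<le> p1 * r" using J_bounds[OF assms(2)] by linarith
  have "2 * pairs_within (K r) T + ones_between 0 (K r) S \<le> real (K r)"
    by (rule packing(3)[OF assms(1) order_refl])
  moreover have "ones_between 0 (J r) S \<le> ones_between 0 (K r) S"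
    using ones_between_split[OF K_bounds(3)[OF assms(2)], of S]
      ones_between_bounds(1)[of "J r" "K r" S] by simp
  ultimately have "2 * pairs_within (K r) T \<le> p1 * r + 2 * p2 * r - ones_between 0 (J r) S"
    using K_bounds(1)[OF assms(2)] by linarith
  with 1 show ?thesis unfolding deviation_def by (auto simp: abs_if)
qed

lemma bdd_deviation: "bdd (deviation r)"
  unfolding deviation_def by (intro functional_bdds)

lemma sublinear_deviation: "sublinear (\<lambda>r. E r (deviation r))"
proof (rule sublinear_le)
  let ?n = "\<lambda>r. E r (\<lambda>S T. ones_between (J r) (K r) S)" and ?l = "\<lambda>r. E r (\<lambda>S T. pairs_below (J r) T)"
    and ?t = "\<lambda>r. E r (\<lambda>S T. slack (J r) (K r) (occ S T))"
    and ?m = "\<lambda>r. E r (\<lambda>S T. real (card (marks (J r) (K r) (occ S T))))"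
    and ?v = "\<lambda>r. E r (\<lambda>S T. vacant 0 (J r) (occ S T))"
  show "sublinear (\<lambda>r. 2 * (1 + ?v r + 2 * ?l r) + (?t r + ?m r + ?n r + 2))"
    by (intro sublinear_add sublinear_cmult sublinear_const sublinear_ones_between sublinear_pairs_below
        sublinear_slack sublinear_card_marks sublinear_vacant)
  fix r :: real assume r: "1 \<le> r"
  then have r0: "0 < r" by simp
  interpret stationary_cells "p1 * r" "p2 * r" "\<nu> r" by (rule stationary) (rule r0)
  show "0 \<le> E r (deviation r)"
  proof (rule E_nonneg[OF r])
    fix S T assume "cells_ok S T"
    from deviation_bounds[OF this r0] show "0 \<le> deviation r S T"
      by (smt (verit) abs_ge_zero)
  qed
  have "Ex (\<lambda>S T. real (K r) - real (J r) - 1 - (slack (J r) (K r) (occ S T)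
        + real (card (marks (J r) (K r) (occ S T)))) - ones_between (J r) (K r) S)
      \<le> Ex (\<lambda>S T. 2 * pairs_within (K r) T)"
  proof (rule Ex_mono)
    fix S T assume "cells_ok S T"
    from packing(2)[OF this K_bounds(3)[OF r0]]
    show "real (K r) - real (J r) - 1 - (slack (J r) (K r) (occ S T)
        + real (card (marks (J r) (K r) (occ S T)))) - ones_between (J r) (K r) S
      \<le> 2 * pairs_within (K r) T" by (simp add: slack_def)
  qed (intro functional_bdds)+
  also have "Ex (\<lambda>S T. real (K r) - real (J r) - 1 - (slack (J r) (K r) (occ S T)
        + real (card (marks (J r) (K r) (occ S T)))) - ones_between (J r) (K r) S)
      = real (K r) - real (J r) - 1 - (?t r + ?m r) - ?n r"
    by ((subst Ex_diff Ex_add; (intro functional_bdds)?)+) (simp only: Ex_const)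
  also have "Ex (\<lambda>S T. 2 * pairs_within (K r) T) = 2 * Ex (\<lambda>S T. pairs_within (K r) T)"
    by (rule Ex_cmult)
  finally have N: "real (K r) - real (J r) - 1 - (?t r + ?m r) - ?n r \<le> 2 * Ex (\<lambda>S T. pairs_within (K r) T)" .
  have n1J: "real (J r) - ?v r - 2 * ?l r \<le> Ex (\<lambda>S T. ones_between 0 (J r) S)" by (rule expectation_ones_between_J[OF r])
  have pos: "0 \<le> ?t r" "0 \<le> ?m r" "0 \<le> ?n r"
    by (intro E_nonneg r slack_bounds ones_between_bounds; simp)+
  have "E r (deviation r) = 2 * (p1 * r - Ex (\<lambda>S T. ones_between 0 (J r) S)) + (p2 * r - Ex (\<lambda>S T. pairs_within (K r) T))"
    unfolding deviation_def
    by ((subst Ex_diff Ex_add Ex_cmult; (intro functional_bdds)?)+) (simp only: Ex_const)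
  also have "\<dots> \<le> 2 * (1 + ?v r + 2 * ?l r) + (?t r + ?m r + ?n r + 2)"
  proof (rule add_mono)
    show "2 * (p1 * r - Ex (\<lambda>S T. ones_between 0 (J r) S)) \<le> 2 * (1 + ?v r + 2 * ?l r)"
    proof (rule mult_left_mono)
      show "p1 * r - Ex (\<lambda>S T. ones_between 0 (J r) S) \<le> 1 + ?v r + 2 * ?l r"
        using n1J J_bounds(2)[OF r0] by linarith
    qed simp
    have "2 * (p2 * r) - 1 \<le> real (K r) - real (J r)"
      using J_bounds[OF r0] K_bounds(1,2)[OF r0] by linarith
    moreover have "x - n \<le> t + m + y + 2"
      if "k - j - 1 - (t + m) - y \<le> 2 * n" "2 * x - 1 \<le> k - j" "0 \<le> t" "0 \<le> m" "0 \<le> y"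
      for x n t m y k j :: real using that by linarith
    ultimately show "p2 * r - Ex (\<lambda>S T. pairs_within (K r) T) \<le> ?t r + ?m r + ?n r + 2"
      using N pos by blast
  qed
  finally show "E r (deviation r) \<le> 2 * (1 + ?v r + 2 * ?l r) + (?t r + ?m r + ?n r + 2)" .
qed

end

lemma items_within_starts:
  assumes A: "A \<in> configurations" and x: "0 \<le> x"
  shows "real (items_within 1 x A) = ones_between 0 (nat \<lfloor>x\<rfloor>) (starts 1 A)"
    "real (items_within 2 x A) = pairs_within (nat \<lfloor>x\<rfloor>) (starts 2 A)"
proof -
  have inj: "inj_on (\<lambda>k. (i, real k)) B" for i :: nat and B by (auto intro: inj_onI)
  have within: "occupied (i, real k) \<subseteq> {0..<x} \<longleftrightarrow> real k + item_size i \<le> x" for i k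
    by (auto simp: occupied_def item_size_def)
  have mem: "(i, y) \<in> A \<Longrightarrow> \<exists>k. y = real k" for i y
    using A by (auto simp: configurations_def Nats_def)
  have eq: "{a \<in> A. fst a = i \<and> occupied a \<subseteq> {0..<x}}
      = (\<lambda>k. (i, real k)) ` {k \<in> starts i A. real k + item_size i \<le> x}" for i
    using mem within by (fastforce simp: starts_def)
  have "{k \<in> starts 1 A. real k + item_size 1 \<le> x} = starts 1 A \<inter> {0..<nat \<lfloor>x\<rfloor>}"
    using x by (auto simp: item_size_def) linarith+
  then show "real (items_within 1 x A) = ones_between 0 (nat \<lfloor>x\<rfloor>) (starts 1 A)"
    unfolding items_within_def eq card_image[OF inj] ones_between_def by simp
  have "{k \<in> starts 2 A. real k + item_size 2 \<le> x} = {k \<in> starts 2 A. Suc k < nat \<lfloor>x\<rfloor>}"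
    using x by (auto simp: item_size_def) linarith+
  then show "real (items_within 2 x A) = pairs_within (nat \<lfloor>x\<rfloor>) (starts 2 A)"
    unfolding items_within_def eq card_image[OF inj] pairs_within_def by simp
qed

theorem theorem2p1:
  fixes p :: "nat \<Rightarrow> real"
    and P :: "real \<Rightarrow> real \<Rightarrow> item set \<Rightarrow> item set pmf"
    and \<mu> :: "real \<Rightarrow> item set pmf"
  assumes "p 1 > 0" and "p 2 > 0" and "p 1 + p 2 = 1"
    and "\<And>r. r > 0 \<Longrightarrow> markov_transition_function configurations (first_fit_rate p r) (P r)"
    and "\<And>r. r > 0 \<Longrightarrow> stationary_distribution configurations (P r) (\<mu> r)"
  shows "converges_in_probability (\<lambda>r. measure_pmf (\<mu> r))
           (\<lambda>r A. (1 / r) *\<^sub>R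
              (real (items_within 1 (p 1 * r) A),
               real (items_within 2 (p 1 * r + 2 * p 2 * r) A)))
           (p 1, p 2) at_top"
proof -
  interpret scaled_cells "p 1" "p 2" "\<lambda>r. cell_pmf (\<mu> r)"
  proof (rule scaled_cells.intro)
    fix r :: real assume r: "0 < r"
    then have nonneg: "0 \<le> p 1 * r" "0 \<le> p 2 * r" using assms(1,2) by auto
    note prems = assms(4)[OF r] assms(5)[OF r] nonneg
    show "stationary_cells (p 1 * r) (p 2 * r) (cell_pmf (\<mu> r))"
    proof (rule stationary_cells.intro)
      show "0 < p 1 * r" "0 < p 2 * r" using r assms(1,2) by auto
    qed (use cell_pmf_ok[OF prems] cell_pmf_generator[OF prems] in blast)+
  qed (use assms in auto)
  show ?thesis
    unfolding converges_in_probability_def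
  proof (intro allI impI)
    fix \<epsilon> :: real assume \<epsilon>: "0 < \<epsilon>"
    let ?X = "\<lambda>r A. (1 / r) *\<^sub>R (real (items_within 1 (p 1 * r) A),
               real (items_within 2 (p 1 * r + 2 * p 2 * r) A))"
    \<comment> \<open>Markov's inequality for the deviation, which dominates the scaled
      distance.\<close>
    have le: "measure (\<mu> r) {A \<in> space (\<mu> r). dist (?X r A) (p 1, p 2) > \<epsilon>} \<le> E r (deviation r) / r / \<epsilon>"
      if r: "1 \<le> r" for r
    proof -
      have r0: "0 < r" using r by simp
      interpret c: stationary_cells "p 1 * r" "p 2 * r" "cell_pmf (\<mu> r)" by (rule stationary[OF r0])
      let ?D = "\<lambda>A. deviation r (starts 1 A) (starts 2 A)"
      have int: "integrable (\<mu> r) ?D"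
        using bdd_deviation[of r] by (auto simp: bdd_def intro: integrable_pmf_bounded)
      have dist: "dist (?X r A) (p 1, p 2) \<le> ?D A / r" if "A \<in> set_pmf (\<mu> r)" for A
      proof -
        have A: "A \<in> configurations"
          using assms(5)[OF r0] that unfolding stationary_distribution_def by auto
        have x: "0 \<le> p 1 * r" "0 \<le> p 1 * r + 2 * p 2 * r" using assms(1,2) r0 by auto
        have "dist (?X r A) (p 1, p 2) \<le> \<bar>ones_between 0 (J r) (starts 1 A) / r - p 1\<bar>
            + \<bar>pairs_within (K r) (starts 2 A) / r - p 2\<bar>"
          unfolding dist_Pair_Pair J_def K_def items_within_starts[OF A x(1)] items_within_starts[OF A x(2)]
          by (simp add: dist_prod_def dist_real_def sqrt_sum_squares_le_sum_abs)
        also have "\<dots> = (\<bar>ones_between 0 (J r) (starts 1 A) - p 1 * r\<bar> + \<bar>pairs_within (K r) (starts 2 A) - p 2 * r\<bar>) / r"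
        proof -
          have "\<bar>z / r - c\<bar> = \<bar>z - c * r\<bar> / r" for z c :: real
          proof -
            have "z / r - c = (z - c * r) / r" using r0 by (simp add: diff_divide_distrib)
            then show ?thesis using r0 by (simp only: abs_divide abs_of_pos)
          qed
          then show ?thesis by (simp only: add_divide_distrib)
        qed
        also have "\<dots> \<le> ?D A / r"
          using deviation_bounds[OF cells_ok_starts[OF A] r0] r0 by (intro divide_right_mono) auto
        finally show ?thesis .
      qed
      have "measure (\<mu> r) {A \<in> space (\<mu> r). dist (?X r A) (p 1, p 2) > \<epsilon>}
          = measure_pmf.expectation (\<mu> r) (indicator {A. dist (?X r A) (p 1, p 2) > \<epsilon>})" by simp
      also have "\<dots> \<le> measure_pmf.expectation (\<mu> r) (\<lambda>A. ?D A / r / \<epsilon>)"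
      proof (rule integral_mono_AE)
        show "integrable (\<mu> r) (indicator {A. dist (?X r A) (p 1, p 2) > \<epsilon>} :: _ \<Rightarrow> real)"
          by (rule integrable_pmf_bounded[where c=1]) (auto split: split_indicator)
        show "integrable (\<mu> r) (\<lambda>A. ?D A / r / \<epsilon>)" using int by simp
        show "AE A in \<mu> r. indicator {A. dist (?X r A) (p 1, p 2) > \<epsilon>} A \<le> ?D A / r / \<epsilon>"
        proof (rule AE_pmfI)
          fix A assume "A \<in> set_pmf (\<mu> r)"
          note d = dist[OF this]
          have "0 \<le> ?D A / r" using d zero_le_dist order_trans by blast
          show "indicator {A. dist (?X r A) (p 1, p 2) > \<epsilon>} A \<le> ?D A / r / \<epsilon>"
          proof (cases "dist (?X r A) (p 1, p 2) > \<epsilon>")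
            case True
            then have "1 \<le> ?D A / r / \<epsilon>" using d \<epsilon> by (subst pos_le_divide_eq) linarith+
            with True show ?thesis by simp
          next
            case False
            have "0 \<le> ?D A / r / \<epsilon>" by (rule divide_nonneg_pos) fact+
            with False show ?thesis by simp
          qed
        qed
      qed
      also have "\<dots> = E r (deviation r) / r / \<epsilon>"
        unfolding c.Ex_def by (simp add: cell_pmf_def)
      finally show ?thesis .
    qed
    show "((\<lambda>r. measure (\<mu> r) {A \<in> space (\<mu> r). dist (?X r A) (p 1, p 2) > \<epsilon>}) \<longlongrightarrow> 0) at_top"
    proof (rule tendsto_sandwich[OF _ _ tendsto_const])
      show "((\<lambda>r. E r (deviation r) / r / \<epsilon>) \<longlongrightarrow> 0) at_top"
        using tendsto_divide[OF _ tendsto_const[of \<epsilon>], of "\<lambda>r. E r (deviation r) / r" 0]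
          sublinear_deviation \<epsilon> unfolding sublinear_def by simp
      show "\<forall>\<^sub>F r in at_top. measure (\<mu> r) {A \<in> space (\<mu> r). dist (?X r A) (p 1, p 2) > \<epsilon>}
          \<le> E r (deviation r) / r / \<epsilon>"
        using eventually_ge_at_top[of "1::real"] by eventually_elim (rule le)
    qed simp
  qed
qed

end
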